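(* Let $(w_n)_{n\ge 0}$ and $(v_k)_{k\ge 1}$ be nonnegative reals with $W(z)=\sum_{n\ge0}w_nz^n$, and assume there are $\rho_w>0$, $\alpha>-1$ and slowly varying $L_w,L_v$ with $$w_n\sim L_w(n)\,n^{-1}\rho_w^{-n},\qquad W(\rho_w)\in(0,\infty),\qquad v_n\sim L_v(n)\,n^{\alpha-1}W(\rho_w)^{-n}.$$ Let $X$ have probability generating function $W(\rho_w z)/W(\rho_w)$ and suppose that there is $\gamma\ge0$ with $\lim_{n\to\infty}\mathbb{P}(X>n^t)/\mathbb{P}(X>n)=t^{-\gamma}$ for all $0<t<1$. Let $\Lambda$ be the locally finite Borel measure on $(0,1]$ with $\Lambda([a,b])=a^{-\gamma}-b^{-\gamma}$ for $0<a<b\le1$. Let $(K_1,\dots,K_{N_n})$ follow the Gibbs partition model $\mathbb{P}_n$, with decreasing order statistics $K_{(1)}\ge K_{(2)}\ge\cdots\ge K_{(N_n)}$. Then the point process on $(0,1]$ $$\sum_{i=2}^{N_n}\delta_{\log(K_{(i)})/\log(n)}\,\mathbb{1}_{K_{(i)}>1}$$ converges in distribution (with respect to the vague topology) to a Cox process directed by the random measure $Z\Lambda$, where $Z$ is $\mathrm{Gamma}(\alpha+1,1)$-distributed.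
   Context: For $k\ge1$ set $w_n^{(k)}=\sum_{n_1+\dots+n_k=n,\ n_i\ge0}\prod_{i=1}^k w_{n_i}$ and $u_n=\sum_{k\ge1}v_k w_n^{(k)}$. For $n$ with $0<u_n<\infty$, the Gibbs partition model is the probability measure on finite sequences $(n_1,\dots,n_k)$ ($k\ge1$) of nonnegative integers summing to $n$ given by $\mathbb{P}_n(n_1,\dots,n_k)=v_k\prod_{i=1}^k w_{n_i}/u_n$. $\delta_y$ denotes the Dirac measure at $y$. (The paper states the hypothesis as existence of $\lim \mathbb{P}(X>n^t)/\mathbb{P}(X>n)$ for all $0<t<1$, which is equivalent to the power form $t^{-\gamma}$ for some $\gamma\ge0$.) *)

theory Defs
  imports "HOL-Probability.Probability" "HOL-Library.Landau_Symbols"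
begin

definition slowly_varying :: "(real \<Rightarrow> real) \<Rightarrow> bool" where
  "slowly_varying L \<longleftrightarrow> L \<in> borel_measurable borel \<and>
     (\<forall>\<^sub>F x in at_top. L x > 0) \<and>
     (\<forall>c>0. ((\<lambda>x. L (c * x) / L x) \<longlongrightarrow> 1) at_top)"

definition comps :: "nat \<Rightarrow> nat \<Rightarrow> nat list set" where
  "comps k n = {ks. length ks = k \<and> sum_list ks = n}"

definition wconv :: "(nat \<Rightarrow> real) \<Rightarrow> nat \<Rightarrow> nat \<Rightarrow> real" where
  "wconv w k n = (\<Sum>ks\<in>comps k n. prod_list (map w ks))"

definition gibbs_u :: "(nat \<Rightarrow> real) \<Rightarrow> (nat \<Rightarrow> real) \<Rightarrow> nat \<Rightarrow> real" where
  "gibbs_u w v n = (\<Sum>k. v (Suc k) * wconv w (Suc k) n)"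

definition all_comps :: "nat \<Rightarrow> nat list set" where
  "all_comps n = {ks. ks \<noteq> [] \<and> sum_list ks = n}"

definition gibbs_P :: "(nat \<Rightarrow> real) \<Rightarrow> (nat \<Rightarrow> real) \<Rightarrow> nat \<Rightarrow> nat list \<Rightarrow> real" where
  "gibbs_P w v n ks = v (length ks) * prod_list (map w ks) / gibbs_u w v n"

definition gibbs_E :: "(nat \<Rightarrow> real) \<Rightarrow> (nat \<Rightarrow> real) \<Rightarrow> nat \<Rightarrow> (nat list \<Rightarrow> real) \<Rightarrow> real" where
  "gibbs_E w v n G = (\<Sum>\<^sub>\<infinity>ks\<in>all_comps n. gibbs_P w v n ks * G ks)"

definition pp_points :: "nat \<Rightarrow> nat list \<Rightarrow> real list" where
  "pp_points n ks = map (\<lambda>k. ln (real k) / ln (real n))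
      (filter (\<lambda>k. k > 1) (drop 1 (rev (sort ks))))"

definition count_measure_of_list :: "real list \<Rightarrow> real measure" where
  "count_measure_of_list xs =
     measure_of UNIV (sets borel) (\<lambda>A. of_nat (length (filter (\<lambda>x. x \<in> A) xs)))"

definition pp :: "nat \<Rightarrow> nat list \<Rightarrow> real measure" where
  "pp n ks = count_measure_of_list (pp_points n ks)"

definition LF :: "real measure set" where
  "LF = {\<mu>. sets \<mu> = sets borel \<and> emeasure \<mu> (- {0<..1}) = 0 \<and>
              (\<forall>a>0. emeasure \<mu> {a..1} < \<infinity>)}"

definition Cc01 :: "(real \<Rightarrow> real) set" where
  "Cc01 = {f. continuous_on {0<..1} f \<and>
              (\<exists>a. 0 < a \<and> a \<le> 1 \<and> (\<forall>x. x \<notin> {a..1} \<longrightarrow> f x = 0))}"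

definition vague_topology :: "real measure topology" where
  "vague_topology = topology_generated_by
     {{\<mu>\<in>LF. integral\<^sup>L \<mu> f \<in> U} | f U. f \<in> Cc01 \<and> open U}"

definition poisson_pmf_real :: "real \<Rightarrow> nat \<Rightarrow> real" where
  "poisson_pmf_real r m = exp (- r) * r ^ m / fact m"

definition gamma_dens :: "real \<Rightarrow> real \<Rightarrow> real" where
  "gamma_dens \<alpha> z = (if z > 0 then z powr \<alpha> * exp (- z) / Gamma (\<alpha> + 1) else 0)"

definition cox_gamma :: "'a measure \<Rightarrow> ('a \<Rightarrow> real) \<Rightarrow> ('a \<Rightarrow> real measure) \<Rightarrow> real \<Rightarrow> real measure \<Rightarrow> bool" where
  "cox_gamma M Z \<xi> \<alpha> \<Lambda> \<longleftrightarrow>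
     prob_space M \<and> Z \<in> borel_measurable M \<and>
     (\<forall>\<omega>\<in>space M. \<xi> \<omega> \<in> LF) \<and>
     (\<forall>U. openin vague_topology U \<longrightarrow> {\<omega>\<in>space M. \<xi> \<omega> \<in> U} \<in> sets M) \<and>
     (\<forall>(k::nat) (B::nat \<Rightarrow> real set) (m::nat \<Rightarrow> nat) (A::real set) (a::real).
        0 < a \<and> (\<forall>i<k. B i \<in> sets borel \<and> B i \<subseteq> {a..1}) \<and>
        disjoint_family_on B {..<k} \<and> A \<in> sets borel \<longrightarrow>
        measure M {\<omega>\<in>space M. Z \<omega> \<in> A \<and> (\<forall>i<k. emeasure (\<xi> \<omega>) (B i) = of_nat (m i))}
        = (LINT z:A|lborel. (\<Prod>i<k. poisson_pmf_real (z * measure \<Lambda> (B i)) (m i))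
                            * gamma_dens \<alpha> z))"

end

theory Submission
  imports Defs "HOL-Real_Asymp.Real_Asymp" "HOL-Computational_Algebra.Formal_Power_Series"
begin

text \<open>
  Let \<open>S\<^sub>k\<close> be a sum of \<open>k\<close> independent copies of \<open>X\<close>, let \<open>p\<^sub>n = P(X = n)\<close> and \<open>q\<^sub>k = v\<^sub>k W(\<rho>)\<^sup>k\<close>. Up to the factor
  \<open>\<rho>\<^sup>-\<^sup>n\<close> the partition function is the sum of \<open>q\<^sub>k P(S\<^sub>k = n)\<close>, and by the principle of a single big jump
  \<open>P(S\<^sub>k = n)\<close> behaves like \<open>k p\<^sub>n P(X \<le> n)\<^sup>k\<^sup>-\<^sup>1\<close>. Hence \<open>k\<close> is of order \<open>1 / P(X > n)\<close>, the rescaled number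
  of summands converges to a Gamma variable \<open>Z\<close>, and the summands other than the largest behave like
  independent copies of \<open>X\<close> conditioned on \<open>X \<le> n\<close>, whose logarithms on the scale \<open>log n\<close> form in the limit a
  Poisson process with intensity \<open>Z \<Lambda>\<close>.

  Since the limiting probabilities of cell counts add up to one, it suffices to bound the probabilities
  for the Gibbs model from below. The numerator is bounded from below by inserting a big summand into a short
  composition. The partition function is bounded from above through the size-bias identity
  \<open>n P(S\<^sub>k = n) = k \<Sum>\<^sub>j j p\<^sub>j P(S\<^sub>k\<^sub>-\<^sub>1 = n - j)\<close>, in which the terms with \<open>j < n/2\<close> are negligible by the uniform local
  bound \<open>P(S\<^sub>k = n) \<le> C k p\<^sub>n\<close>.

  For the vague topology, every open set around \<open>\<mu>\<close> contains all measures that agree with \<open>\<mu>\<close> on the cells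
  \<open>(i/R, (i+1)/R]\<close>, \<open>1 \<le> i < R\<close>, for \<open>R\<close> large. So convergence of cell counts gives a lower bound for the limit inferior
  of the expectations of bounded continuous functionals, and applying it to \<open>F\<close> and \<open>-F\<close> gives convergence.
\<close>

section \<open>Slowly varying functions\<close>

text \<open>What shapes the proof is that \<open>n * p n\<close> and the tail of \<open>X\<close>
  decay slower than any power, so sums of copies of \<open>X\<close> have no scaling limit. Only the
  thresholds \<open>n powr t\<close> separate magnitudes. The tail hypothesis therefore serves
  twice. For \<open>t\<close> close to 1 it says that a summand between \<open>n powr t\<close> and
  \<open>n\<close> is rare even relative to \<open>P(X > n)\<close>; this makes the truncated mean
  of \<open>X\<close>, divided by \<open>n\<close>, negligible against \<open>P(X > n)\<close>, and
  it closes the induction for the local bound. At the grid points \<open>t = i / R\<close> it yields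
  the intensities of the limit. The Gamma law arises from two sources. The big jump has
  \<open>k\<close> possible positions, and \<open>k * q k\<close> has exponent \<alpha>. The other
  \<open>k - 1\<close> summands must stay at most \<open>n\<close>, and with
  \<open>z = k * P(X > n)\<close> the probability of this tends to \<open>exp (- z)\<close>.
  Together they give the density proportional to \<open>z powr \<alpha> * exp (- z)\<close>.\<close>

text \<open>Karamata's uniform convergence theorem in additive form. If it fails along \<open>x n\<close>, \<open>u n\<close>,
  the sets of shifts that barely move \<open>h\<close> from \<open>x n\<close> and from \<open>x n + u n\<close> both have measure above
  \<open>3/2\<close> inside an interval of length \<open>3\<close>, so they meet.\<close>

lemma uct_additive:
  fixes h :: "real \<Rightarrow> real"
  assumes meas: "h \<in> borel_measurable borel"
    and lim: "\<And>u. ((\<lambda>x. h (x + u) - h x) \<longlongrightarrow> 0) at_top"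
    and e: "e > 0"
  shows "\<exists>X. \<forall>x\<ge>X. \<forall>u\<in>{0..1}. \<bar>h (x + u) - h x\<bar> < e"
proof (rule ccontr)
  assume "\<not> ?thesis"
  hence "\<exists>x u. x \<ge> real n \<and> u \<in> {0..1} \<and> \<bar>h (x + u) - h x\<bar> \<ge> e" for n :: nat
    unfolding not_ex not_all not_imp Bex_def Ball_def not_less by meson
  then obtain x u where x: "\<And>n::nat. x n \<ge> real n" and u: "\<And>n. u n \<in> {0..1}"
    and far: "\<And>n. \<bar>h (x n + u n) - h (x n)\<bar> \<ge> e"
    by metis
  have x_top: "filterlim x at_top sequentially"
    by (rule filterlim_at_top_mono[OF filterlim_real_sequentially]) (use x in auto)
  have y_top: "filterlim (\<lambda>n. x n + u n) at_top sequentially"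
    by (rule filterlim_at_top_mono[OF x_top]) (use u in auto)
  have large: "\<exists>n0. \<forall>n\<ge>n0. measure lborel {t\<in>{0..2}. \<bar>h (y n + t) - h (y n)\<bar> < e/2} > 3/2"
    if y: "filterlim y at_top sequentially" for y :: "nat \<Rightarrow> real"
  proof -
    \<comment> \<open>Asking for the bound at all later indices makes these sets increase in
      \<open>n\<close>, so their measures converge to that of their union
      \<open>{0..2}\<close>.\<close>
    define V where "V n = {t\<in>{0..2}. \<forall>m\<ge>n. \<bar>h (y m + t) - h (y m)\<bar> < e/2}" for n :: nat
    have V_sets: "V n \<in> sets lborel" for n
      unfolding V_def using meas by measurable
    have "(\<Union>n. V n) = {0..2}"
    proof (intro equalityI subsetI)
      fix t :: real assume t: "t \<in> {0..2}"
      have "((\<lambda>n. h (y n + t) - h (y n)) \<longlongrightarrow> 0) sequentially"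
        by (rule filterlim_compose[OF lim y])
      hence "eventually (\<lambda>n. \<bar>h (y n + t) - h (y n)\<bar> < e/2) sequentially"
        using e by (auto dest!: tendstoD[of _ _ _ "e/2"] simp: dist_real_def)
      thus "t \<in> (\<Union>n. V n)" using t by (auto simp: V_def eventually_sequentially)
    qed (auto simp: V_def)
    moreover have "(\<lambda>n. measure lborel (V n)) \<longlonglongrightarrow> measure lborel (\<Union>n. V n)"
    proof (rule Lim_measure_incseq)
      show "range V \<subseteq> sets lborel" using V_sets by auto
      show "incseq V" by (rule incseq_SucI) (auto simp: V_def)
      have "emeasure lborel (\<Union>n. V n) \<le> emeasure lborel {0..2::real}"
        by (intro emeasure_mono) (auto simp: V_def)
      thus "emeasure lborel (\<Union>n. V n) \<noteq> \<infinity>" by (auto simp: top_unique)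
    qed
    ultimately have "(\<lambda>n. measure lborel (V n)) \<longlonglongrightarrow> 2" by simp
    hence "eventually (\<lambda>n. measure lborel (V n) > 3/2) sequentially"
      by (rule order_tendstoD) simp
    then obtain n0 where n0: "\<And>n. n \<ge> n0 \<Longrightarrow> measure lborel (V n) > 3/2"
      by (auto simp: eventually_sequentially)
    show ?thesis
    proof (intro exI allI impI)
      fix n assume "n \<ge> n0"
      have S: "{t\<in>{0..2}. \<bar>h (y n + t) - h (y n)\<bar> < e/2} \<in> sets lborel"
        using meas by measurable
      have "measure lborel (V n) \<le> measure lborel {t\<in>{0..2}. \<bar>h (y n + t) - h (y n)\<bar> < e/2}"
      proof (rule measure_mono_fmeasurable[OF _ V_sets])
        have "emeasure lborel {t\<in>{0..2}. \<bar>h (y n + t) - h (y n)\<bar> < e/2} \<le> emeasure lborel {0..2::real}"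
          by (intro emeasure_mono) auto
        also have "... < \<infinity>" by simp
        finally show "{t\<in>{0..2}. \<bar>h (y n + t) - h (y n)\<bar> < e/2} \<in> fmeasurable lborel"
          using S by (simp add: fmeasurable_def)
      qed (auto simp: V_def)
      with n0[OF \<open>n \<ge> n0\<close>] show "measure lborel {t\<in>{0..2}. \<bar>h (y n + t) - h (y n)\<bar> < e/2} > 3/2" by simp
    qed
  qed
  obtain n1 n2 where n1: "\<And>n. n \<ge> n1 \<Longrightarrow> measure lborel {t\<in>{0..2}. \<bar>h (x n + t) - h (x n)\<bar> < e/2} > 3/2"
    and n2: "\<And>n. n \<ge> n2 \<Longrightarrow> measure lborel {t\<in>{0..2}. \<bar>h (x n + u n + t) - h (x n + u n)\<bar> < e/2} > 3/2"
    using large[OF x_top] large[OF y_top] by blast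
  define n where "n = max n1 n2"
  define V where "V = {t\<in>{0..2}. \<bar>h (x n + t) - h (x n)\<bar> < e/2}"
  define W where "W = {t\<in>{0..2}. \<bar>h (x n + u n + t) - h (x n + u n)\<bar> < e/2}"
  have V_sets[measurable]: "V \<in> sets lborel" and W_sets[measurable]: "W \<in> sets lborel"
    unfolding V_def W_def using meas by measurable
  \<comment> \<open>Translation by \<open>u n\<close> refers both sets of shifts to the common base
    point \<open>x n\<close>.\<close>
  define W' where "W' = (+) (u n) ` W"
  have W'_eq: "W' = (\<lambda>t. t - u n) -` W"
    unfolding W'_def by (auto simp: image_iff intro!: bexI[of _ "_ - u n"])
  have W'_sets[measurable]: "W' \<in> sets lborel"
    unfolding W'_eq using measurable_sets[of "\<lambda>t. t - u n" borel borel W] W_sets by simp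
  have W'_meas: "measure lborel W' = measure lborel W"
    unfolding W'_def using measure_translation[of "u n" W] measure_completion[OF W_sets]
      measure_completion[OF W'_sets] by (simp add: W'_def)
  have fin: "A \<in> fmeasurable lborel" if "A \<subseteq> {0..3::real}" "A \<in> sets lborel" for A
  proof -
    have "emeasure lborel A \<le> emeasure lborel {0..3::real}"
      using that by (intro emeasure_mono) auto
    also have "... < \<infinity>" by simp
    finally show ?thesis using that by (simp add: fmeasurable_def)
  qed
  have V3: "V \<subseteq> {0..3}" by (auto simp: V_def)
  have W3: "W' \<subseteq> {0..3}" using u[of n] by (auto simp: W'_def W_def)
  have "V \<inter> W' \<noteq> {}"
  proof
    assume "V \<inter> W' = {}"
    hence "measure lborel (V \<union> W') = measure lborel V + measure lborel W'"
      using fin[OF V3 V_sets] fin[OF W3 W'_sets]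
      by (intro measure_Un_AE) auto
    moreover have "measure lborel (V \<union> W') \<le> measure lborel {0..3::real}"
      by (rule measure_mono_fmeasurable) (use V3 W3 fin V_sets W'_sets in auto)
    moreover have "measure lborel V > 3/2" "measure lborel W > 3/2"
      using n1[of n] n2[of n] by (auto simp: V_def W_def n_def)
    ultimately show False using W'_meas by simp
  qed
  then obtain t where "t \<in> V" "t \<in> W'" by blast
  hence "\<bar>h (x n + t) - h (x n)\<bar> < e/2" "\<bar>h (x n + t) - h (x n + u n)\<bar> < e/2"
    by (auto simp: V_def W'_def W_def algebra_simps)
  hence "\<bar>h (x n + u n) - h (x n)\<bar> < e" by linarith
  with far[of n] show False by simp
qed

lemma slowly_varyingD:
  assumes "slowly_varying L"
  shows "L \<in> borel_measurable borel" "\<forall>\<^sub>F x in at_top. L x > 0"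
    "c > 0 \<Longrightarrow> ((\<lambda>x. L (c * x) / L x) \<longlongrightarrow> 1) at_top"
  using assms by (auto simp: slowly_varying_def)

text \<open>With \<open>h t = ln (L (exp t))\<close> the ratio condition becomes the hypothesis of
  \<open>uct_additive\<close>, and a factor between 1 and 2 becomes a shift of at most
  \<open>ln 2\<close>, inside the unit interval treated there.\<close>

lemma slowly_varying_local_ln:
  assumes L: "slowly_varying L" and e: "e > 0"
  shows "\<exists>X>0. \<forall>x\<ge>X. L x > 0 \<and> (\<forall>y\<in>{x..2*x}. L y > 0 \<and> \<bar>ln (L y) - ln (L x)\<bar> < e)"
proof -
  define h where "h t = ln (L (exp t))" for t
  have "h \<in> borel_measurable borel"
    unfolding h_def using slowly_varyingD(1)[OF L] by measurable
  moreover have "((\<lambda>x. h (x + u) - h x) \<longlongrightarrow> 0) at_top" for u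
  proof -
    have "((\<lambda>x. L (exp u * exp x) / L (exp x)) \<longlongrightarrow> 1) at_top"
      by (rule filterlim_compose[OF slowly_varyingD(3)[OF L] exp_at_top]) simp
    hence "((\<lambda>x. ln (L (exp u * exp x) / L (exp x))) \<longlongrightarrow> ln 1) at_top"
      by (intro tendsto_intros) auto
    moreover have "eventually (\<lambda>x. ln (L (exp u * exp x) / L (exp x)) = h (x + u) - h x) at_top"
    proof -
      have 1: "eventually (\<lambda>x. L (exp x) > 0) at_top"
        by (rule eventually_compose_filterlim[OF slowly_varyingD(2)[OF L] exp_at_top])
      have 2: "eventually (\<lambda>x. L (exp (x + u)) > 0) at_top"
        by (rule eventually_compose_filterlim[OF 1, of "\<lambda>x. x + u"])
           (subst add.commute, rule filterlim_tendsto_add_at_top[OF tendsto_const filterlim_ident])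
      show ?thesis using 1 2
        by eventually_elim (simp add: h_def exp_add ln_div mult.commute)
    qed
    ultimately show ?thesis by (simp add: tendsto_cong)
  qed
  ultimately obtain X0 where X0: "\<And>x u. x \<ge> X0 \<Longrightarrow> u \<in> {0..1} \<Longrightarrow> \<bar>h (x + u) - h x\<bar> < e"
    using uct_additive[OF _ _ e] by meson
  obtain X1 where X1: "\<And>x. x \<ge> X1 \<Longrightarrow> L x > 0"
    using slowly_varyingD(2)[OF L] by (auto simp: eventually_at_top_linorder)
  define X where "X = max (exp X0) X1"
  have "X > 0" by (simp add: X_def less_max_iff_disj)
  moreover have "L x > 0 \<and> (\<forall>y\<in>{x..2*x}. L y > 0 \<and> \<bar>ln (L y) - ln (L x)\<bar> < e)" if "x \<ge> X" for x
  proof (intro conjI ballI)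
    have x: "x > 0" "x \<ge> exp X0" "x \<ge> X1" using that \<open>X > 0\<close> by (auto simp: X_def)
    show "L x > 0" using X1 x by simp
    fix y assume y: "y \<in> {x..2*x}"
    show "L y > 0" using X1 x y by simp
    have "ln x \<ge> X0" using x by (simp add: ln_ge_iff)
    moreover have "ln (y / x) \<in> {0..1}"
    proof -
      have "y / x \<le> 2" using y x by (simp add: field_simps)
      also have "2 \<le> exp (1::real)" using exp_ge_add_one_self[of 1] by simp
      finally have "ln (y / x) \<le> 1" using y x using ln_le_cancel_iff[of "y/x" "exp 1"] by simp
      moreover have "y / x \<ge> 1" using y x by simp
      ultimately show ?thesis by simp
    qed
    ultimately have "\<bar>h (ln x + ln (y/x)) - h (ln x)\<bar> < e" by (rule X0)
    moreover have "ln x + ln (y/x) = ln y" using x y by (simp add: ln_div)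
    ultimately show "\<bar>ln (L y) - ln (L x)\<bar> < e" using x y by (simp add: h_def)
  qed
  ultimately show ?thesis by blast
qed

text \<open>The local estimate is chained over doublings from \<open>x\<close> to \<open>y\<close>.
  Each costs at most \<open>e * ln 2\<close>, which is the growth of \<open>e * ln (y/x)\<close>
  under doubling; the summand 1 pays for the last, incomplete one.\<close>

lemma slowly_varying_dyadic:
  assumes L: "slowly_varying L" and e: "e > 0"
  shows "\<exists>X>0. \<forall>x\<ge>X. \<forall>y\<ge>x. L x > 0 \<and> L y > 0 \<and> \<bar>ln (L y) - ln (L x)\<bar> \<le> e * (1 + ln (y/x))"
proof -
  define d where "d = e * ln 2"
  have "d > 0" using e by (simp add: d_def)
  then obtain X where X: "X > 0" "\<And>x. x \<ge> X \<Longrightarrow> L x > 0"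
     "\<And>x y. x \<ge> X \<Longrightarrow> y \<in> {x..2*x} \<Longrightarrow> \<bar>ln (L y) - ln (L x)\<bar> < d"
    using slowly_varying_local_ln[OF L] by meson
  have ln2: "ln 2 \<le> (1::real)" using ln_2_less_1 by simp
  have main: "\<bar>ln (L y) - ln (L x)\<bar> \<le> e * (1 + ln (y/x))" if "x \<ge> X" "y \<ge> x" "y \<le> 2 ^ n * x" for n x y
    using that
  proof (induction n arbitrary: y)
    case 0
    hence "y = x" by simp
    thus ?case using 0 X(1) e by simp
  next
    case (Suc n)
    show ?case
    proof (cases "y \<le> 2 * x")
      case True
      hence "\<bar>ln (L y) - ln (L x)\<bar> < d" using Suc.prems X(3) by simp
      also have "d \<le> e * 1" unfolding d_def using ln2 e by (intro mult_left_mono) auto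
      also have "e * 1 \<le> e * (1 + ln (y/x))" using Suc.prems X(1) e by (intro mult_left_mono) auto
      finally show ?thesis by simp
    next
      case False
      hence "\<bar>ln (L (y/2)) - ln (L x)\<bar> \<le> e * (1 + ln (y/2/x))"
        using Suc.prems by (intro Suc.IH) auto
      moreover have "\<bar>ln (L y) - ln (L (y/2))\<bar> < d"
        using False Suc.prems X(1) by (intro X(3)) auto
      moreover have "e * (1 + ln (y/2/x)) + d = e * (1 + ln (y/x))"
        using Suc.prems X(1) False by (simp add: d_def ln_div ln_mult algebra_simps)
      ultimately show ?thesis by linarith
    qed
  qed
  show ?thesis
  proof (intro exI conjI allI impI)
    show "X > 0" by fact
    fix x y assume xy: "x \<ge> X" "y \<ge> x"
    show "L x > 0" "L y > 0" using X(2) xy by auto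
    obtain n where "y / x < 2 ^ n" using real_arch_pow[of 2 "y/x"] by auto
    hence "y \<le> 2 ^ n * x" using xy X(1) by (simp add: field_simps)
    thus "\<bar>ln (L y) - ln (L x)\<bar> \<le> e * (1 + ln (y/x))" using main xy by blast
  qed
qed

text \<open>These are Potter's bounds, the exponentiated form of the previous estimate. The maximum
  of the two powers covers both orders of \<open>x\<close> and \<open>y\<close>.\<close>

lemma slowly_varying_potter:
  assumes L: "slowly_varying L" and e: "e > 0"
  shows "\<exists>X>0. \<forall>x\<ge>X. \<forall>y\<ge>X. L x > 0 \<and> L y > 0 \<and> 
    L y / L x \<le> exp e * max ((y/x) powr e) ((y/x) powr (-e))"
proof -
  obtain X where X: "X > 0" "\<And>x y. x \<ge> X \<Longrightarrow> y \<ge> x \<Longrightarrow> L x > 0 \<and> L y > 0 \<and> \<bar>ln (L y) - ln (L x)\<bar> \<le> e * (1 + ln (y/x))"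
    using slowly_varying_dyadic[OF L e] by meson
  have "L x > 0 \<and> L y > 0 \<and> L y / L x \<le> exp e * max ((y/x) powr e) ((y/x) powr (-e))"
    if "x \<ge> X" "y \<ge> X" for x y
  proof (intro conjI)
    have pos: "L x > 0" "L y > 0" using X(2)[of x x] X(2)[of y y] that by auto
    thus "L x > 0" "L y > 0" by auto
    have xy: "x > 0" "y > 0" using that X(1) by auto
    have Lxy: "L y / L x = exp (ln (L y) - ln (L x))" using pos by (simp add: exp_diff)
    show "L y / L x \<le> exp e * max ((y/x) powr e) ((y/x) powr (-e))"
    proof (cases "x \<le> y")
      case True
      hence "ln (L y) - ln (L x) \<le> e * (1 + ln (y/x))" using X(2)[of x y] that by auto
      hence "L y / L x \<le> exp (e * (1 + ln (y/x)))" unfolding Lxy by simp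
      also have "... = exp e * (y/x) powr e" using xy by (simp add: powr_def distrib_left exp_add)
      also have "... \<le> exp e * max ((y/x) powr e) ((y/x) powr (-e))" by simp
      finally show ?thesis .
    next
      case False
      hence "ln (L y) - ln (L x) \<le> e * (1 + ln (x/y))" using X(2)[of y x] that by auto
      hence "L y / L x \<le> exp (e * (1 + ln (x/y)))" unfolding Lxy by simp
      also have "... = exp e * (y/x) powr (-e)" using xy by (simp add: powr_def distrib_left exp_add ln_div right_diff_distrib)
      also have "... \<le> exp e * max ((y/x) powr e) ((y/x) powr (-e))" by simp
      finally show ?thesis .
    qed
  qed
  thus ?thesis using X(1) by blast
qed

text \<open>Potter's bound with exponent \<open>e/2\<close>, read from \<open>x\<close> back to the
  fixed point \<open>X\<close>, bounds \<open>L x\<close> below by a multiple of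
  \<open>x powr (-e/2)\<close>. A factor \<open>x powr (e/2)\<close> is left to diverge.\<close>

lemma slowly_varying_times_powr:
  assumes L: "slowly_varying L" and e: "e > 0"
  shows "filterlim (\<lambda>x. x powr e * L x) at_top at_top"
proof -
  obtain X where X: "X > 0" "\<And>x y. x \<ge> X \<Longrightarrow> y \<ge> X \<Longrightarrow> L x > 0 \<and> L y > 0 \<and> 
      L y / L x \<le> exp (e/2) * max ((y/x) powr (e/2)) ((y/x) powr (-(e/2)))"
    using slowly_varying_potter[OF L, of "e/2"] e by auto
  define c where "c = L X / exp (e/2) * X powr (e/2)"
  have "c > 0" using X(2)[of X X] X(1) by (auto simp: c_def)
  have "filterlim (\<lambda>x. c * x powr (e/2)) at_top at_top"
    using e \<open>c > 0\<close> by (intro filterlim_tendsto_pos_mult_at_top[OF tendsto_const]) (auto intro!: real_powr_at_top)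
  moreover have "eventually (\<lambda>x. c * x powr (e/2) \<le> x powr e * L x) at_top"
    using eventually_ge_at_top[of X]
  proof eventually_elim
    case (elim x)
    have x: "x > 0" using elim X(1) by simp
    have "X / x \<le> 1" using elim x by simp
    have "L X / L x \<le> exp (e/2) * max ((X/x) powr (e/2)) ((X/x) powr (-(e/2)))" "L x > 0"
      using X(2)[of x X] elim by auto
    moreover have "(X/x) powr (e/2) \<le> (X/x) powr (-(e/2))"
      using powr_mono'[of "-(e/2)" "e/2" "X/x"] \<open>X/x \<le> 1\<close> X(1) x e by simp
    ultimately have "L X / L x \<le> exp (e/2) * (X/x) powr (-(e/2))" by simp
    also have "(X/x) powr (-(e/2)) = x powr (e/2) * X powr (-(e/2))"
      using X(1) x by (simp add: powr_divide powr_minus field_simps)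
    finally have "L X \<le> L x * (exp (e/2) * (x powr (e/2) * X powr (-(e/2))))"
      using \<open>L x > 0\<close> by (simp add: field_simps)
    hence "c \<le> L x * (exp (e/2) * (x powr (e/2) * X powr (-(e/2)))) / exp (e/2) * X powr (e/2)"
      unfolding c_def by (intro mult_right_mono divide_right_mono) auto
    also have "... = L x * x powr (e/2)" using X(1) by (simp add: powr_minus field_simps)
    finally have "c * x powr (e/2) \<le> L x * x powr (e/2) * x powr (e/2)" by (intro mult_right_mono) auto
    also have "... = (x powr (e/2) * x powr (e/2)) * L x" by (simp only: ac_simps)
    also have "... = x powr e * L x" by (simp flip: powr_add)
    finally show ?case .
  qed
  ultimately show ?thesis by (rule filterlim_at_top_mono)
qed

text \<open>Slow variation speaks of fixed ratios, whereas here the ratio varies with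
  \<open>n\<close>. Since \<open>ln (y n / x n)\<close> stays bounded, the dyadic estimate with a
  small slope \<open>d\<close> is uniform enough.\<close>

lemma slowly_varying_ratio_tendsto:
  assumes L: "slowly_varying L" and x: "filterlim x at_top F" and xy: "((\<lambda>n. y n / x n) \<longlongrightarrow> c) F" and c: "c > 0"
  shows "((\<lambda>n. L (y n) / L (x n)) \<longlongrightarrow> 1) F"
proof -
  have y: "filterlim y at_top F"
  proof -
    have top: "filterlim (\<lambda>n. y n / x n * x n) at_top F"
      by (rule filterlim_tendsto_pos_mult_at_top[OF xy c x])
    have "eventually (\<lambda>n. x n > 0) F" using x by (simp add: filterlim_at_top_dense)
    hence "eventually (\<lambda>n. y n / x n * x n = y n) F" by eventually_elim simp
    from filterlim_cong[OF refl refl this, of at_top] top show ?thesis by simp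
  qed
  have "((\<lambda>n. ln (L (y n)) - ln (L (x n))) \<longlongrightarrow> 0) F"
  proof (rule tendstoI)
    fix e :: real assume e: "e > 0"
    \<comment> \<open>\<open>C\<close> eventually dominates
      \<open>1 + \<bar>ln (y n / x n)\<bar>\<close>, and \<open>d * C = e / 2\<close>.\<close>
    define C where "C = 1 + \<bar>ln c\<bar> + 1"
    define d where "d = e / (2 * C)"
    have C: "C > 0" by (simp add: C_def)
    have d: "d > 0" using e C by (simp add: d_def)
    obtain X where X: "X > 0" "\<And>x y. x \<ge> X \<Longrightarrow> y \<ge> x \<Longrightarrow> L x > 0 \<and> L y > 0 \<and> \<bar>ln (L y) - ln (L x)\<bar> \<le> d * (1 + ln (y/x))"
      using slowly_varying_dyadic[OF L d] by meson
    have "((\<lambda>n. ln (y n / x n)) \<longlongrightarrow> ln c) F" using xy c by (intro tendsto_ln) auto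
    hence "eventually (\<lambda>n. \<bar>ln (y n / x n) - ln c\<bar> < 1) F"
      by (auto dest!: tendstoD[of _ _ _ 1] simp: dist_real_def)
    moreover have "eventually (\<lambda>n. x n \<ge> X) F" "eventually (\<lambda>n. y n \<ge> X) F"
      using x y by (auto simp: filterlim_at_top)
    ultimately show "eventually (\<lambda>n. dist (ln (L (y n)) - ln (L (x n))) 0 < e) F"
    proof eventually_elim
      case (elim n)
      have pos: "x n > 0" "y n > 0" using elim X(1) by auto
      have "\<bar>ln (L (y n)) - ln (L (x n))\<bar> \<le> d * (1 + \<bar>ln (y n / x n)\<bar>)"
      proof (cases "x n \<le> y n")
        case True
        thus ?thesis using X(2)[of "x n" "y n"] elim pos by simp
      next
        case False
        hence "\<bar>ln (L (x n)) - ln (L (y n))\<bar> \<le> d * (1 + ln (x n / y n))" using X(2)[of "y n" "x n"] elim by simp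
        also have "ln (x n / y n) = - ln (y n / x n)" using pos by (simp add: ln_div)
        also have "d * (1 + - ln (y n / x n)) \<le> d * (1 + \<bar>ln (y n / x n)\<bar>)" using d by (intro mult_left_mono) auto
        finally show ?thesis by simp
      qed
      also have "... \<le> d * C" using d elim by (intro mult_left_mono) (auto simp: C_def)
      also have "... < e" using C e by (simp add: d_def)
      finally show ?case by simp
    qed
  qed
  hence "((\<lambda>n. exp (ln (L (y n)) - ln (L (x n)))) \<longlongrightarrow> exp 0) F" by (rule tendsto_exp)
  moreover have "eventually (\<lambda>n. exp (ln (L (y n)) - ln (L (x n))) = L (y n) / L (x n)) F"
    using eventually_compose_filterlim[OF slowly_varyingD(2)[OF L] x]
      eventually_compose_filterlim[OF slowly_varyingD(2)[OF L] y]
    by eventually_elim (simp add: exp_diff)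
  ultimately show ?thesis by (simp add: tendsto_cong)
qed

section \<open>Weighted sums with regularly varying weights\<close>

lemma Gamma_has_bochner_integral:
  fixes x :: real assumes "x > 0"
  shows "has_bochner_integral lborel (\<lambda>t. indicator {0<..} t * (t powr (x - 1) * exp (- t))) (Gamma x)"
proof -
  let ?f = "\<lambda>t::real. indicator {0<..} t * (t powr (x - 1) * exp (- t))"
  have "((\<lambda>t. t powr (x - 1) / exp t) has_integral Gamma x) {0..}"
    using Gamma_integral_real[OF assms] .
  hence "((\<lambda>t. if t \<in> {0..} then t powr (x - 1) / exp t else 0) has_integral Gamma x) UNIV"
    using has_integral_restrict_UNIV[of "{0..}" "\<lambda>t. t powr (x - 1) / exp t"] by simp
  also have "(\<lambda>t. if t \<in> {0..} then t powr (x - 1) / exp t else 0) = ?f"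
    by (auto simp: fun_eq_iff indicator_def exp_minus field_simps)
  finally have "(?f has_integral Gamma x) UNIV" .
  hence "integral\<^sup>N lborel ?f = ennreal (Gamma x)"
    by (intro nn_integral_has_integral_lborel) auto
  thus ?thesis
    using Gamma_real_pos[OF assms] by (intro has_bochner_integral_nn_integral) auto
qed

lemma integrable_powr_exp:
  fixes \<theta> c :: real assumes "\<theta> > -1" "c > 0"
  shows "integrable lborel (\<lambda>t. indicator {0<..} t * (t powr \<theta> * exp (- c * t)))"
proof -
  have "integrable lborel (\<lambda>t. indicator {0<..} t * (t powr \<theta> * exp (- t)))"
    using Gamma_has_bochner_integral[of "\<theta> + 1"] assms by (auto simp: has_bochner_integral_iff)
  from lborel_integrable_real_affine[OF this, of c 0]
  have "integrable lborel (\<lambda>t. indicator {0<..} (c * t) * ((c * t) powr \<theta> * exp (- (c * t))))"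
    using assms by simp
  hence "integrable lborel (\<lambda>t. c powr (-\<theta>) * (indicator {0<..} (c * t) * ((c * t) powr \<theta> * exp (- (c * t)))))"
    by simp
  also have "(\<lambda>t. c powr (-\<theta>) * (indicator {0<..} (c * t) * ((c * t) powr \<theta> * exp (- (c * t))))) 
      = (\<lambda>t. indicator {0<..} t * (t powr \<theta> * exp (- c * t)))"
    using assms by (auto simp: fun_eq_iff indicator_def powr_mult powr_minus field_simps zero_less_mult_iff)
  finally show ?thesis .
qed

text \<open>This is \<open>ln u \<le> u - 1\<close> at \<open>u = (1 + x) * (c / m)\<close>; the
  constant is the value of the left side at its stationary point
  \<open>1 + x = m / c\<close>.\<close>

lemma powr_exp_bounded:
  fixes m c x :: real assumes "m > 0" "c > 0" "x \<ge> 0"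
  shows "(1 + x) powr m * exp (- c * x) \<le> exp (c - m - m * ln (c / m))"
proof -
  have "ln ((1 + x) * (c / m)) \<le> (1 + x) * (c / m) - 1"
    using assms by (intro ln_le_minus_one) auto
  hence "ln (1 + x) + ln (c / m) \<le> (1 + x) * (c / m) - 1"
    using assms by (subst (asm) ln_mult) auto
  hence "m * (ln (1 + x) + ln (c / m)) \<le> m * ((1 + x) * (c / m) - 1)"
    using assms by (intro mult_left_mono) auto
  also have "m * ((1 + x) * (c / m) - 1) = c + c * x - m" using assms by (simp add: field_simps)
  finally have "m * ln (1 + x) - c * x \<le> c - m - m * ln (c / m)" by (simp add: algebra_simps)
  moreover have "(1 + x) powr m * exp (- c * x) = exp (m * ln (1 + x) - c * x)"
    using assms by (simp add: powr_def flip: exp_add)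
  ultimately show ?thesis by simp
qed

lemma has_bochner_integral_ceiling:
  fixes g :: "nat \<Rightarrow> real"
  assumes "summable (\<lambda>k. \<bar>g (Suc k)\<bar>)"
  shows "has_bochner_integral lborel (\<lambda>x. indicator {0<..} x * g (nat \<lceil>x::real\<rceil>)) (\<Sum>k. g (Suc k))"
proof -
  define f where "f k x = g (Suc k) * indicator {real k<..real (Suc k)} x" for k x
  have int_f: "has_bochner_integral lborel (f k) (g (Suc k))" for k
    unfolding f_def using has_bochner_integral_mult_right[OF has_bochner_integral_real_indicator[of "{real k<..real (Suc k)}" lborel], of "g (Suc k)"]
    by simp
  have int_nf: "has_bochner_integral lborel (\<lambda>x. norm (f k x)) \<bar>g (Suc k)\<bar>" for k
    unfolding f_def using has_bochner_integral_mult_right[OF has_bochner_integral_real_indicator[of "{real k<..real (Suc k)}" lborel], of "\<bar>g (Suc k)\<bar>"]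
    by (simp add: abs_mult)
  have zero: "f k x = 0" if "k \<noteq> nat \<lceil>x\<rceil> - 1 \<or> x \<le> 0" for k x
    using that unfolding f_def indicator_def by (auto; linarith)
  have val: "f (nat \<lceil>x\<rceil> - 1) x = g (nat \<lceil>x\<rceil>)" if "x > 0" for x
  proof -
    have "nat \<lceil>x\<rceil> > 0" using that by simp
    then obtain k where k: "nat \<lceil>x\<rceil> = Suc k" by (cases "nat \<lceil>x\<rceil>") auto
    hence "\<lceil>x\<rceil> = int (Suc k)" by linarith
    hence "real k < x \<and> x \<le> real (Suc k)" by linarith
    thus ?thesis using k by (simp add: f_def indicator_def)
  qed
  have sums: "(\<lambda>k. f k x) sums (indicator {0<..} x * g (nat \<lceil>x\<rceil>))" for x
  proof (cases "x > 0")
    case True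
    have "(\<lambda>k. f k x) sums f (nat \<lceil>x\<rceil> - 1) x"
      using sums_finite[of "{nat \<lceil>x\<rceil> - 1}" "\<lambda>k. f k x"] True by (force intro!: zero)
    thus ?thesis using val True by simp
  next
    case False
    hence "f k x = 0" for k using zero by auto
    thus ?thesis using False by simp
  qed
  have summ: "summable (\<lambda>k. norm (f k x))" for x
  proof (rule summable_finite[of "{nat \<lceil>x\<rceil> - 1}"])
    fix k assume "k \<notin> {nat \<lceil>x\<rceil> - 1}"
    thus "norm (f k x) = 0" using zero[of k x] zero[of k x] by (cases "x > 0") auto
  qed auto
  have eq: "(\<Sum>k. f k x) = indicator {0<..} x * g (nat \<lceil>x\<rceil>)" for x using sums_unique[OF sums] by metis
  have 1: "integrable lborel (\<lambda>x. \<Sum>k. f k x)"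
    using int_f int_nf assms summ by (intro integrable_suminf) (auto simp: has_bochner_integral_iff)
  have 2: "(\<integral>x. (\<Sum>k. f k x) \<partial>lborel) = (\<Sum>k. g (Suc k))"
    using int_f int_nf assms summ by (subst integral_suminf) (auto simp: has_bochner_integral_iff)
  show ?thesis using 1 2 unfolding eq by (simp add: has_bochner_integral_iff)
qed

text \<open>The substitution \<open>x = z / s\<close> puts the macroscopic variable
  \<open>z = k * s\<close> on the axis. The sum becomes an integral over a fixed domain, ready for
  dominated convergence as \<open>s\<close> tends to 0.\<close>

lemma suminf_eq_integral_scaled:
  fixes g :: "nat \<Rightarrow> real"
  assumes "summable (\<lambda>k. \<bar>g (Suc k)\<bar>)" "s > 0"
  shows "(\<Sum>k. g (Suc k)) = (\<integral>z. indicator {0<..} z * g (nat \<lceil>z / s\<rceil>) \<partial>lborel) / s"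
proof -
  have "(\<Sum>k. g (Suc k)) = (\<integral>x. indicator {0<..} x * g (nat \<lceil>x::real\<rceil>) \<partial>lborel)"
    using has_bochner_integral_ceiling[OF assms(1)] by (metis has_bochner_integral_iff)
  also have "... = \<bar>1 / s\<bar> *\<^sub>R (\<integral>x. indicator {0<..} (0 + 1 / s * x) * g (nat \<lceil>0 + 1 / s * x\<rceil>) \<partial>lborel)"
    using assms(2) by (intro lborel_integral_real_affine) auto
  also have "(\<lambda>x. indicator {0<..} (0 + 1 / s * x) * g (nat \<lceil>0 + 1 / s * x\<rceil>)) = (\<lambda>z. indicator {0<..} z * g (nat \<lceil>z / s\<rceil>) :: real)"
    using assms(2) by (auto simp: fun_eq_iff indicator_def zero_less_divide_iff)
  finally show ?thesis using assms(2) by simp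
qed

text \<open>Potter's bound is extended to every \<open>k \<ge> 1\<close>: the finitely many
  \<open>k < k0\<close> are absorbed in the constant, paid for by
  \<open>y powr \<eta> * L y \<ge> 1\<close>. The maximum of the two powers is relaxed to their sum,
  whose terms can be dominated separately.\<close>

lemma regular_weights_potter:
  fixes a :: "nat \<Rightarrow> real"
  assumes L: "slowly_varying L"
    and a: "a \<sim>[sequentially] (\<lambda>k. L (real k) * real k powr \<alpha>)" and eta: "\<eta> > 0"
  shows "\<exists>C>0. \<exists>X>0. \<forall>y\<ge>X. L y > 0 \<and> (\<forall>k\<ge>1. 
     \<bar>a k\<bar> \<le> C * (L y * y powr \<alpha> * ((real k / y) powr (\<alpha> + \<eta>) + (real k / y) powr (\<alpha> - \<eta>))))"
proof -
  obtain X1 where X1: "X1 > 0" "\<And>x y. x \<ge> X1 \<Longrightarrow> y \<ge> X1 \<Longrightarrow> L x > 0 \<and> L y > 0 \<and> 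
    L y / L x \<le> exp \<eta> * max ((y/x) powr \<eta>) ((y/x) powr (-\<eta>))"
    using slowly_varying_potter[OF L eta] by auto
  obtain X2 where X2: "\<And>y. y \<ge> X2 \<Longrightarrow> y powr \<eta> * L y \<ge> 1"
    using slowly_varying_times_powr[OF L eta] by (auto simp: filterlim_at_top eventually_at_top_linorder)
  have "eventually (\<lambda>k. \<bar>a k\<bar> \<le> 2 * \<bar>L (real k) * real k powr \<alpha>\<bar>) sequentially"
    using asymp_equiv_imp_eventually_le[OF a, of 2] by simp
  then obtain k1 where k1: "\<And>k. k \<ge> k1 \<Longrightarrow> \<bar>a k\<bar> \<le> 2 * \<bar>L (real k) * real k powr \<alpha>\<bar>"
    by (auto simp: eventually_sequentially)
  define k0 where "k0 = max k1 (nat \<lceil>X1\<rceil> + 1)"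
  define C1 where "C1 = (\<Sum>k<k0. \<bar>a k\<bar>)"
  define D where "D = (\<Sum>k\<in>{1..<k0}. real k powr (-(\<alpha>-\<eta>)))"
  \<comment> \<open>The three entries serve positivity, the indices from \<open>k0\<close> on, and
    the indices below \<open>k0\<close>.\<close>
  define C where "C = max 1 (max (2 * exp \<eta>) (C1 * D))"
  have C1: "C1 \<ge> 0" unfolding C1_def by (intro sum_nonneg) auto
  have "\<bar>a k\<bar> \<le> C * (L y * y powr \<alpha> * ((real k / y) powr (\<alpha> + \<eta>) + (real k / y) powr (\<alpha> - \<eta>)))"
    if y: "y \<ge> max X1 X2" and k: "k \<ge> 1" for y k
  proof -
    have ypos: "y > 0" and Ly: "L y > 0" using y X1(1) X1(2)[of y y] by auto
    have kpos: "real k > 0" using k by simp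
    show ?thesis
    proof (cases "k < k0")
      case True
      have "\<bar>a k\<bar> \<le> C1" unfolding C1_def using True by (intro member_le_sum) auto
      also have "C1 \<le> C1 * (D * real k powr (\<alpha> - \<eta>))"
      proof -
        have "real k powr (-(\<alpha>-\<eta>)) \<le> D" unfolding D_def using True k 
          by (intro member_le_sum[of k "{1..<k0}" "\<lambda>k. real k powr (-(\<alpha>-\<eta>))"]) auto
        hence "real k powr (-(\<alpha>-\<eta>)) * real k powr (\<alpha> - \<eta>) \<le> D * real k powr (\<alpha> - \<eta>)"
          by (intro mult_right_mono) auto
        hence "1 \<le> D * real k powr (\<alpha> - \<eta>)" using kpos by (simp flip: powr_add)
        thus ?thesis using C1 mult_left_mono by fastforce
      qed
      also have "... \<le> C1 * (D * real k powr (\<alpha> - \<eta>)) * (y powr \<eta> * L y)"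
      proof -
        have "D \<ge> 0" unfolding D_def by (intro sum_nonneg) auto
        hence "C1 * (D * real k powr (\<alpha> - \<eta>)) \<ge> 0" using C1 by simp
        thus ?thesis using X2[of y] y mult_left_mono by fastforce
      qed
      also have "... = (C1 * D) * (L y * y powr \<alpha> * (real k / y) powr (\<alpha> - \<eta>))"
        using ypos kpos by (simp add: powr_divide powr_diff field_simps)
      also have "... \<le> C * (L y * y powr \<alpha> * ((real k / y) powr (\<alpha> + \<eta>) + (real k / y) powr (\<alpha> - \<eta>)))"
        using Ly by (intro mult_mono mult_nonneg_nonneg) (auto simp: C_def)
      finally show ?thesis .
    next
      case False
      hence kX: "real k \<ge> X1" "k \<ge> k1" unfolding k0_def by linarith+
      have Lk: "L (real k) > 0" and "L (real k) / L y \<le> exp \<eta> * max ((real k/y) powr \<eta>) ((real k/y) powr (-\<eta>))"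
        using X1(2)[of y "real k"] y kX by auto
      hence *: "L (real k) \<le> exp \<eta> * max ((real k/y) powr \<eta>) ((real k/y) powr (-\<eta>)) * L y"
        using Ly by (simp add: field_simps)
      have "max ((real k/y) powr \<eta>) ((real k/y) powr (-\<eta>)) \<le> (real k/y) powr \<eta> + (real k/y) powr (-\<eta>)" by simp
      hence "L (real k) \<le> exp \<eta> * ((real k/y) powr \<eta> + (real k/y) powr (-\<eta>)) * L y"
        using Ly by (intro order.trans[OF *] mult_right_mono mult_left_mono) auto
      hence "\<bar>a k\<bar> \<le> 2 * (exp \<eta> * ((real k/y) powr \<eta> + (real k/y) powr (-\<eta>)) * L y * real k powr \<alpha>)"
        using Lk by (intro order.trans[OF k1[OF kX(2)]] mult_left_mono) (auto simp: abs_mult intro!: mult_right_mono)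
      also have "real k powr \<alpha> = y powr \<alpha> * (real k / y) powr \<alpha>" using kpos ypos by (simp add: powr_divide)
      also have "2 * (exp \<eta> * ((real k/y) powr \<eta> + (real k/y) powr (-\<eta>)) * L y * (y powr \<alpha> * (real k / y) powr \<alpha>))
         = 2 * exp \<eta> * (L y * y powr \<alpha> * ((real k / y) powr (\<alpha> + \<eta>) + (real k / y) powr (\<alpha> - \<eta>)))"
        using kpos ypos by (simp add: powr_add powr_diff powr_minus field_simps)
      also have "... \<le> C * (L y * y powr \<alpha> * ((real k / y) powr (\<alpha> + \<eta>) + (real k / y) powr (\<alpha> - \<eta>)))"
        using Ly by (intro mult_right_mono mult_nonneg_nonneg) (auto simp: C_def)
      finally show ?thesis .
    qed
  qed
  moreover have "L y > 0" if "y \<ge> max X1 X2" for y using X1(2)[of y y] that by auto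
  moreover have "max X1 X2 > 0" using X1(1) by simp
  moreover have "C > 0" by (simp add: C_def)
  ultimately show ?thesis by blast
qed

text \<open>The surplus \<open>x powr (\<beta> - \<theta>) * (1 + x)\<close> is at most a power of
  \<open>1 + x\<close>, which half of the exponential beats.\<close>

lemma weight_bound:
  fixes \<beta> \<theta> c x :: real
  assumes "\<beta> \<ge> \<theta>" "c > 0"
  shows "\<exists>D>0. \<forall>x>0. x powr \<beta> * (1 + x) * exp (- c * x) \<le> D * (x powr \<theta> * exp (- (c/2) * x))"
proof (intro exI conjI allI impI)
  define m where "m = \<beta> - \<theta> + 1"
  have m: "m > 0" using assms by (simp add: m_def)
  show "exp (c/2 - m - m * ln (c/2 / m)) > 0" by simp
  fix x :: real assume x: "x > 0"
  have split: "x powr \<beta> * (1 + x) * exp (- c * x) = x powr \<theta> * exp (- (c/2) * x) * (x powr (\<beta> - \<theta>) * (1 + x) * exp (- (c/2) * x))"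
    using x by (simp add: powr_diff flip: exp_add)
  have "x powr (\<beta> - \<theta>) * (1 + x) * exp (- (c/2) * x) \<le> (1 + x) powr (\<beta> - \<theta>) * (1 + x) * exp (- (c/2) * x)"
    using x assms by (intro mult_right_mono powr_mono2) auto
  also have "(1 + x) powr (\<beta> - \<theta>) * (1 + x) = (1 + x) powr m"
    using x by (simp add: m_def powr_add)
  also have "(1 + x) powr m * exp (- (c/2) * x) \<le> exp (c/2 - m - m * ln (c/2 / m))"
    using x m assms by (intro powr_exp_bounded) auto
  finally have "x powr (\<beta> - \<theta>) * (1 + x) * exp (- (c/2) * x) \<le> exp (c/2 - m - m * ln (c/2 / m))" .
  thus "x powr \<beta> * (1 + x) * exp (- c * x) \<le> exp (c/2 - m - m * ln (c/2 / m)) * (x powr \<theta> * exp (- (c/2) * x))"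
    unfolding split by (subst (2) mult.commute) (intro mult_left_mono, auto)
qed

lemma nat_ceiling_times_bounds:
  fixes s z :: real
  assumes "s > 0" "z > 0"
  shows "z \<le> real (nat \<lceil>z / s\<rceil>) * s" "real (nat \<lceil>z / s\<rceil>) * s \<le> z + s" "1 \<le> nat \<lceil>z / s\<rceil>"
proof -
  have "0 < z / s" using assms by simp
  hence *: "z / s \<le> real (nat \<lceil>z / s\<rceil>)" "real (nat \<lceil>z / s\<rceil>) \<le> z / s + 1" "1 \<le> nat \<lceil>z / s\<rceil>" by linarith+
  show "z \<le> real (nat \<lceil>z / s\<rceil>) * s" "1 \<le> nat \<lceil>z / s\<rceil>"
    using *(1,3) assms(1) by (simp_all only: pos_divide_le_eq)
  have "real (nat \<lceil>z / s\<rceil>) * s \<le> (z / s + 1) * s" using *(2) assms by (intro mult_right_mono) auto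
  thus "real (nat \<lceil>z / s\<rceil>) * s \<le> z + s" using assms by (simp add: distrib_right)
qed

text \<open>The second form counts one summand less: it concerns the summands that remain beside the
  largest one.\<close>

lemma tendsto_nat_ceiling_times:
  fixes s :: "nat \<Rightarrow> real"
  assumes s_pos: "eventually (\<lambda>n. s n > 0) sequentially" and s_lim: "s \<longlonglongrightarrow> 0" and z: "z > 0"
  shows "(\<lambda>n. real (nat \<lceil>z / s n\<rceil>) * s n) \<longlonglongrightarrow> z"
    and "(\<lambda>n. real (nat \<lceil>z / s n\<rceil> - 1) * s n) \<longlonglongrightarrow> z"
proof -
  show *: "(\<lambda>n. real (nat \<lceil>z / s n\<rceil>) * s n) \<longlonglongrightarrow> z"
  proof (rule tendsto_sandwich)
    show "eventually (\<lambda>n. z \<le> real (nat \<lceil>z / s n\<rceil>) * s n) sequentially" 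
      "eventually (\<lambda>n. real (nat \<lceil>z / s n\<rceil>) * s n \<le> z + s n) sequentially"
      using s_pos nat_ceiling_times_bounds[OF _ z] by (auto elim: eventually_mono)
    show "(\<lambda>n. z + s n) \<longlonglongrightarrow> z" using tendsto_add[OF tendsto_const s_lim, of z] by simp
  qed auto
  have "(\<lambda>n. real (nat \<lceil>z / s n\<rceil>) * s n - s n) \<longlonglongrightarrow> z"
    using tendsto_diff[OF * s_lim] by simp
  moreover have "eventually (\<lambda>n. real (nat \<lceil>z / s n\<rceil>) * s n - s n = real (nat \<lceil>z / s n\<rceil> - 1) * s n) sequentially"
    using s_pos
  proof eventually_elim
    case (elim n)
    from nat_ceiling_times_bounds(3)[OF this z] show ?case
      by (subst of_nat_diff) (auto simp: left_diff_distrib)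
  qed
  ultimately show "(\<lambda>n. real (nat \<lceil>z / s n\<rceil> - 1) * s n) \<longlonglongrightarrow> z" by (simp add: tendsto_cong)
qed

text \<open>This is a Riemann sum in \<open>z = k * s n\<close> with mesh \<open>s n\<close>, in
  which \<open>a k\<close> is close to \<open>L (1 / s n) * (z / s n) powr \<alpha>\<close>; hence
  the normalisation. Potter's bound and the exponential in \<open>h_bound\<close> give the majorant,
  and \<open>\<alpha> > -1\<close> makes it integrable at 0.\<close>

proposition regular_weights_sum_asymp:
  fixes a :: "nat \<Rightarrow> real" and s :: "nat \<Rightarrow> real" and h :: "nat \<Rightarrow> nat \<Rightarrow> real" and H :: "real \<Rightarrow> real"
  assumes L: "slowly_varying L" and alpha: "\<alpha> > -1"
    and a: "a \<sim>[sequentially] (\<lambda>k. L (real k) * real k powr \<alpha>)"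
    and s_pos: "eventually (\<lambda>n. s n > 0) sequentially" and s_lim: "s \<longlonglongrightarrow> 0"
    and c: "c > 0"
    and h_bound: "eventually (\<lambda>n. \<forall>k\<ge>1. \<bar>h n k\<bar> \<le> C * (1 + real k * s n) * exp (- c * (real k * s n))) sequentially"
    and h_lim: "\<And>z. z > 0 \<Longrightarrow> (\<lambda>n. h n (nat \<lceil>z / s n\<rceil>)) \<longlonglongrightarrow> H z"
    and H_meas: "H \<in> borel_measurable borel"
  shows "eventually (\<lambda>n. summable (\<lambda>k. \<bar>a (Suc k) * h n (Suc k)\<bar>)) sequentially"
    and "set_integrable lborel {0<..} (\<lambda>z. z powr \<alpha> * H z)"
    and "(\<lambda>n. (\<Sum>k. a (Suc k) * h n (Suc k)) / (s n powr (- \<alpha> - 1) * L (1 / s n))) 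
          \<longlonglongrightarrow> (LINT z:{0<..}|lborel. z powr \<alpha> * H z)"
proof -
  \<comment> \<open>Half of the distance from \<alpha> to -1, so that the smaller Potter exponent
    \<open>\<alpha> - \<eta>\<close> is still integrable at 0.\<close>
  define \<eta> where "\<eta> = (\<alpha> + 1) / 2"
  have eta: "\<eta> > 0" "\<alpha> - \<eta> > -1" using alpha by (auto simp: \<eta>_def field_simps)
  \<comment> \<open>A single exponent \<open>\<theta> \<le> 0\<close> makes the majorant decreasing,
    so its value at the rounded-up point \<open>\<lceil>z / s n\<rceil> * s n\<close> is at most its
    value at \<open>z\<close>.\<close>
  define \<theta> where "\<theta> = min 0 (\<alpha> - \<eta>)"
  have theta: "\<theta> > -1" "\<theta> \<le> 0" "\<theta> \<le> \<alpha> - \<eta>" "\<theta> \<le> \<alpha> + \<eta>" using eta by (auto simp: \<theta>_def)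
  obtain C1 X where C1: "C1 > 0" "X > 0" and Lpos: "\<And>y. y \<ge> X \<Longrightarrow> L y > 0" and potter: "\<And>y k. y \<ge> X \<Longrightarrow> k \<ge> 1 \<Longrightarrow> 
     \<bar>a k\<bar> \<le> C1 * (L y * y powr \<alpha> * ((real k / y) powr (\<alpha> + \<eta>) + (real k / y) powr (\<alpha> - \<eta>)))"
    using regular_weights_potter[OF L a eta(1)] by metis
  obtain D1 D2 where D: "D1 > 0" "D2 > 0"
    "\<And>x. x > 0 \<Longrightarrow> x powr (\<alpha> + \<eta>) * (1 + x) * exp (- c * x) \<le> D1 * (x powr \<theta> * exp (- (c/2) * x))"
    "\<And>x. x > 0 \<Longrightarrow> x powr (\<alpha> - \<eta>) * (1 + x) * exp (- c * x) \<le> D2 * (x powr \<theta> * exp (- (c/2) * x))"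
    using weight_bound[OF theta(4) c] weight_bound[OF theta(3) c] by metis
  define E where "E = C1 * (D1 + D2) * \<bar>C\<bar>"
  have E: "E \<ge> 0" using C1 D by (simp add: E_def)
  have inv_s: "filterlim (\<lambda>n. 1 / s n) at_top sequentially"
    using filterlim_inverse_at_top[OF s_lim s_pos] by (simp add: inverse_eq_divide)
  have ev: "eventually (\<lambda>n. s n > 0 \<and> 1 / s n \<ge> X \<and> (\<forall>k\<ge>1. \<bar>h n k\<bar> \<le> C * (1 + real k * s n) * exp (- c * (real k * s n)))) sequentially"
    using s_pos inv_s[unfolded filterlim_at_top, rule_format, of X] h_bound by eventually_elim auto
  have bound: "\<bar>a k * h n k\<bar> \<le> E * (L (1 / s n) * s n powr (-\<alpha>)) * ((real k * s n) powr \<theta> * exp (- (c/2) * (real k * s n)))"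
    if n: "s n > 0" "1 / s n \<ge> X" "\<forall>k\<ge>1. \<bar>h n k\<bar> \<le> C * (1 + real k * s n) * exp (- c * (real k * s n))" and k: "k \<ge> 1" for n k
  proof -
    let ?x = "real k * s n"
    have x: "?x > 0" using n k by simp
    have Ls: "L (1 / s n) > 0" using Lpos n by simp
    have "\<bar>h n k\<bar> \<le> C * (1 + ?x) * exp (- c * ?x)" using n k by simp
    also have "... \<le> \<bar>C\<bar> * (1 + ?x) * exp (- c * ?x)" using x by (intro mult_right_mono) auto
    finally have hb: "\<bar>h n k\<bar> \<le> \<bar>C\<bar> * (1 + ?x) * exp (- c * ?x)" .
    have ab: "\<bar>a k\<bar> \<le> C1 * (L (1 / s n) * s n powr (-\<alpha>) * (?x powr (\<alpha> + \<eta>) + ?x powr (\<alpha> - \<eta>)))"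
      using potter[OF n(2) k] n(1) by (simp add: powr_divide powr_minus divide_simps)
    have "\<bar>a k * h n k\<bar> \<le> (C1 * (L (1 / s n) * s n powr (-\<alpha>) * (?x powr (\<alpha> + \<eta>) + ?x powr (\<alpha> - \<eta>)))) * (\<bar>C\<bar> * (1 + ?x) * exp (- c * ?x))"
      unfolding abs_mult using C1 Ls by (intro mult_mono ab hb) auto
    also have "... = C1 * \<bar>C\<bar> * (L (1 / s n) * s n powr (-\<alpha>)) * (?x powr (\<alpha> + \<eta>) * (1 + ?x) * exp (- c * ?x) + ?x powr (\<alpha> - \<eta>) * (1 + ?x) * exp (- c * ?x))"
      by (simp add: algebra_simps)
    also have "... \<le> C1 * \<bar>C\<bar> * (L (1 / s n) * s n powr (-\<alpha>)) * (D1 * (?x powr \<theta> * exp (- (c/2) * ?x)) + D2 * (?x powr \<theta> * exp (- (c/2) * ?x)))"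
      using C1 Ls by (intro mult_left_mono add_mono D x) auto
    also have "... = E * (L (1 / s n) * s n powr (-\<alpha>)) * (?x powr \<theta> * exp (- (c/2) * ?x))"
      by (simp add: E_def algebra_simps)
    finally show ?thesis .
  qed
  have summ: "summable (\<lambda>k. \<bar>a (Suc k) * h n (Suc k)\<bar>)"
    if n: "s n > 0" "1 / s n \<ge> X" "\<forall>k\<ge>1. \<bar>h n k\<bar> \<le> C * (1 + real k * s n) * exp (- c * (real k * s n))" for n
  proof (rule summable_comparison_test')
    let ?K = "E * (L (1 / s n) * s n powr (-\<alpha>)) * s n powr \<theta>"
    show "summable (\<lambda>k. ?K * exp (- (c/2) * s n) ^ Suc k)"
      using n c by (intro summable_mult summable_Suc_iff[THEN iffD2] summable_geometric) auto
    fix k :: nat assume "0 \<le> k"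
    have "(real (Suc k) * s n) powr \<theta> \<le> s n powr \<theta>"
      using n theta by (intro powr_mono2') (auto simp: mult_le_cancel_right1)
    moreover have "exp (- (c/2) * (real (Suc k) * s n)) = exp (- (c/2) * s n) ^ Suc k"
      by (subst exp_of_nat_mult[symmetric]) (simp add: mult_ac)
    ultimately have "E * (L (1 / s n) * s n powr (-\<alpha>)) * ((real (Suc k) * s n) powr \<theta> * exp (- (c/2) * (real (Suc k) * s n))) 
       \<le> E * (L (1 / s n) * s n powr (-\<alpha>)) * (s n powr \<theta> * exp (- (c/2) * s n) ^ Suc k)"
      using Lpos[of "1 / s n"] n E by (intro mult_left_mono mult_mono) auto
    thus "norm \<bar>a (Suc k) * h n (Suc k)\<bar> \<le> ?K * exp (- (c/2) * s n) ^ Suc k"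
      using bound[OF n, of "Suc k"] by (simp add: mult_ac)
  qed
  show "eventually (\<lambda>n. summable (\<lambda>k. \<bar>a (Suc k) * h n (Suc k)\<bar>)) sequentially"
    using ev by eventually_elim (use summ in blast)
  \<comment> \<open>Compared with the normalisation in the claim, one power of \<open>s n\<close> is
    missing; the change of variable supplies it.\<close>
  define \<phi> where "\<phi> n z = indicator {0<..} z * (a (nat \<lceil>z / s n\<rceil>) * h n (nat \<lceil>z / s n\<rceil>)) * (s n powr \<alpha> / L (1 / s n))" for n z
  define w where "w z = E * (indicator {0<..} z * (z powr \<theta> * exp (- (c/2) * z)))" for z :: real
  have w_int: "integrable lborel w"
    unfolding w_def using integrable_powr_exp[of \<theta> "c/2"] theta c by simp
  obtain n0 where n0: "\<And>n. n \<ge> n0 \<Longrightarrow> s n > 0 \<and> 1 / s n \<ge> X \<and> (\<forall>k\<ge>1. \<bar>h n k\<bar> \<le> C * (1 + real k * s n) * exp (- c * (real k * s n)))"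
    using ev by (auto simp: eventually_sequentially)
  have phi_bound: "norm (\<phi> n z) \<le> w z" if "n \<ge> n0" for n z
  proof (cases "z > 0")
    case True
    have n: "s n > 0" "1 / s n \<ge> X" "\<forall>k\<ge>1. \<bar>h n k\<bar> \<le> C * (1 + real k * s n) * exp (- c * (real k * s n))" using n0[OF that] by auto
    let ?k = "nat \<lceil>z / s n\<rceil>"
    note b = nat_ceiling_times_bounds[OF n(1) True]
    define x where "x = real ?k * s n"
    have x: "z \<le> x" using b(1) by (simp only: x_def)
    have Ls: "L (1 / s n) > 0" using Lpos n by simp
    have "\<bar>a ?k * h n ?k\<bar> * (s n powr \<alpha> / L (1 / s n)) \<le> E * (L (1 / s n) * s n powr (-\<alpha>)) * ((real ?k * s n) powr \<theta> * exp (- (c/2) * (real ?k * s n))) * (s n powr \<alpha> / L (1 / s n))"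
      using bound[OF n b(3)] Ls by (intro mult_right_mono) auto
    also have "... = E * (x powr \<theta> * exp (- (c/2) * x))"
      using Ls n(1) by (simp add: powr_minus field_simps x_def)
    also have "... \<le> E * (z powr \<theta> * exp (- (c/2) * z))"
      using x True theta c E by (intro mult_left_mono mult_mono powr_mono2') auto
    finally show ?thesis using True Ls by (simp add: \<phi>_def w_def abs_mult)
  qed (auto simp: \<phi>_def w_def)
  have phi_lim: "(\<lambda>n. \<phi> n z) \<longlonglongrightarrow> indicator {0<..} z * (z powr \<alpha> * H z)" for z
  proof (cases "z > 0")
    case True
    define k where "k n = nat \<lceil>z / s n\<rceil>" for n
    have ks: "(\<lambda>n. real (k n) * s n) \<longlonglongrightarrow> z"
      unfolding k_def by (rule tendsto_nat_ceiling_times(1)[OF s_pos s_lim True])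
    have k_top: "filterlim k at_top sequentially"
    proof -
      have "filterlim (\<lambda>n. z / s n) at_top sequentially"
        using filterlim_tendsto_pos_mult_at_top[OF tendsto_const True inv_s] by simp
      moreover have "eventually (\<lambda>n. z / s n \<le> real (k n)) sequentially"
        by (intro always_eventually allI) (auto simp: k_def intro: real_nat_ceiling_ge)
      ultimately have "filterlim (\<lambda>n. real (k n)) at_top sequentially" by (rule filterlim_at_top_mono)
      thus ?thesis using filterlim_sequentially_iff_filterlim_real by blast
    qed
    have 1: "(\<lambda>n. a (k n) / (L (real (k n)) * real (k n) powr \<alpha>)) \<longlonglongrightarrow> 1"
    proof -
      have "eventually (\<lambda>x::nat. L (real x) > 0) sequentially"
        by (rule eventually_compose_filterlim[OF slowly_varyingD(2)[OF L] filterlim_real_sequentially])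
      hence "eventually (\<lambda>x. L (real x) * real x powr \<alpha> \<noteq> 0) sequentially"
        using eventually_gt_at_top[of 0] by eventually_elim auto
      hence "(\<lambda>x. a x / (L (real x) * real x powr \<alpha>)) \<longlonglongrightarrow> 1"
        by (intro asymp_equivD_strong[OF a]) (auto elim: eventually_mono)
      thus ?thesis by (rule filterlim_compose[OF _ k_top])
    qed
    have 2: "(\<lambda>n. L (real (k n)) / L (1 / s n)) \<longlonglongrightarrow> 1"
      by (rule slowly_varying_ratio_tendsto[OF L inv_s _ True]) (use ks in simp)
    have 3: "(\<lambda>n. (real (k n) * s n) powr \<alpha>) \<longlonglongrightarrow> z powr \<alpha>"
      using True by (intro tendsto_intros ks) auto
    have 4: "(\<lambda>n. h n (k n)) \<longlonglongrightarrow> H z" using h_lim[OF True] by (simp add: k_def)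
    have "(\<lambda>n. a (k n) / (L (real (k n)) * real (k n) powr \<alpha>) * (L (real (k n)) / L (1 / s n)) * ((real (k n) * s n) powr \<alpha> * h n (k n))) \<longlonglongrightarrow> 1 * 1 * (z powr \<alpha> * H z)"
      by (intro tendsto_mult 1 2 3 4)
    moreover have "eventually (\<lambda>n. a (k n) / (L (real (k n)) * real (k n) powr \<alpha>) * (L (real (k n)) / L (1 / s n)) * ((real (k n) * s n) powr \<alpha> * h n (k n)) = \<phi> n z) sequentially"
    proof -
      have "eventually (\<lambda>n. L (real (k n)) > 0) sequentially"
        by (rule eventually_compose_filterlim[OF slowly_varyingD(2)[OF L] filterlim_compose[OF filterlim_real_sequentially k_top]])
      thus ?thesis using s_pos
      proof eventually_elim
        case (elim n)
        have "k n \<ge> 1" using nat_ceiling_times_bounds(3)[OF elim(2) True] by (simp add: k_def)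
        thus ?case using elim True by (simp add: \<phi>_def k_def powr_mult)
      qed
    qed
    ultimately show ?thesis using True by (simp add: tendsto_cong)
  qed (auto simp: \<phi>_def)
  have meas1: "\<phi> n \<in> borel_measurable lborel" for n unfolding \<phi>_def by measurable
  have meas2: "(\<lambda>z. indicator {0<..} z * (z powr \<alpha> * H z)) \<in> borel_measurable lborel" using H_meas by measurable
  have AE1: "AE z in lborel. (\<lambda>n. \<phi> (n + n0) z) \<longlonglongrightarrow> indicator {0<..} z * (z powr \<alpha> * H z)"
    using LIMSEQ_ignore_initial_segment[OF phi_lim] by auto
  have AE2: "AE z in lborel. norm (\<phi> (n + n0) z) \<le> w z" for n using phi_bound by auto
  show "set_integrable lborel {0<..} (\<lambda>z. z powr \<alpha> * H z)"
    using integrable_dominated_convergence[OF meas2 meas1 w_int AE1 AE2] by (simp add: set_integrable_def)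
  have "(\<lambda>n. integral\<^sup>L lborel (\<phi> (n + n0))) \<longlonglongrightarrow> (\<integral>z. indicator {0<..} z * (z powr \<alpha> * H z) \<partial>lborel)"
    using integral_dominated_convergence[OF meas2 meas1 w_int AE1 AE2] .
  hence "(\<lambda>n. integral\<^sup>L lborel (\<phi> n)) \<longlonglongrightarrow> (LINT z:{0<..}|lborel. z powr \<alpha> * H z)"
    using LIMSEQ_offset[where f = "\<lambda>n. integral\<^sup>L lborel (\<phi> n)" and k = n0]
    by (simp add: set_lebesgue_integral_def)
  moreover have "eventually (\<lambda>n. integral\<^sup>L lborel (\<phi> n) = (\<Sum>k. a (Suc k) * h n (Suc k)) / (s n powr (- \<alpha> - 1) * L (1 / s n))) sequentially"
    using ev
  proof eventually_elim
    case (elim n)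
    have "(\<Sum>k. a (Suc k) * h n (Suc k)) = (\<integral>z. indicator {0<..} z * (a (nat \<lceil>z / s n\<rceil>) * h n (nat \<lceil>z / s n\<rceil>)) \<partial>lborel) / s n"
      using suminf_eq_integral_scaled[of "\<lambda>k. a k * h n k" "s n"] summ elim by auto
    moreover have "integral\<^sup>L lborel (\<phi> n) = (\<integral>z. indicator {0<..} z * (a (nat \<lceil>z / s n\<rceil>) * h n (nat \<lceil>z / s n\<rceil>)) \<partial>lborel) * (s n powr \<alpha> / L (1 / s n))"
      unfolding \<phi>_def by simp
    ultimately show ?case using elim by (simp add: powr_diff powr_minus divide_simps)
  qed
  ultimately show "(\<lambda>n. (\<Sum>k. a (Suc k) * h n (Suc k)) / (s n powr (- \<alpha> - 1) * L (1 / s n))) 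
          \<longlonglongrightarrow> (LINT z:{0<..}|lborel. z powr \<alpha> * H z)"
    by (simp add: tendsto_cong)
qed

section \<open>Powers of probability generating functions\<close>

text \<open>\<open>convp p k n\<close> is the probability that \<open>k\<close> independent variables with law \<open>p\<close> sum to \<open>n\<close>; coding it as
  a coefficient of a power series gives the size-bias identity below by differentiation.\<close>

definition convp :: "(nat \<Rightarrow> real) \<Rightarrow> nat \<Rightarrow> nat \<Rightarrow> real" where
  "convp p k n = fps_nth (Abs_fps p ^ k) n"

lemma convp_0: "convp p 0 n = (if n = 0 then 1 else 0)"
  by (simp add: convp_def)

lemma convp_Suc: "convp p (Suc k) n = (\<Sum>j\<le>n. p j * convp p k (n - j))"
  by (simp add: convp_def fps_mult_nth atLeast0AtMost)

lemma convp_1: "convp p (Suc 0) n = p n"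
  by (simp add: convp_def)

lemma convp_add: "convp p (k + l) n = (\<Sum>a\<le>n. convp p k a * convp p l (n - a))"
  by (simp add: convp_def power_add fps_mult_nth atLeast0AtMost)

lemma convp_nonneg: "(\<And>n. p n \<ge> 0) \<Longrightarrow> convp p k n \<ge> 0"
  by (induction k arbitrary: n) (auto simp: convp_0 convp_Suc intro!: sum_nonneg)

lemma convp_mono: "(\<And>n. p n \<ge> 0) \<Longrightarrow> (\<And>n. p n \<le> p' n) \<Longrightarrow> convp p k n \<le> convp p' k n"
  by (induction k arbitrary: n) 
     (auto simp: convp_0 convp_Suc intro!: sum_mono mult_mono convp_nonneg intro: order.trans)

lemma convp_size_bias:
  "real n * convp p (Suc k) n = real (Suc k) * (\<Sum>j\<le>n. real j * p j * convp p k (n - j))"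
proof (cases n)
  case (Suc m)
  have "real (Suc m) * convp p (Suc k) (Suc m) = fps_nth (fps_deriv (Abs_fps p ^ Suc k)) m"
    by (simp add: convp_def del: power_Suc)
  also have "fps_deriv (Abs_fps p ^ Suc k) = fps_const (real (Suc k)) * (fps_deriv (Abs_fps p) * Abs_fps p ^ k)"
    by (subst fps_deriv_power) (simp add: mult.assoc)
  also have "fps_nth \<dots> m = real (Suc k) * (\<Sum>i\<le>m. real (Suc i) * p (Suc i) * convp p k (m - i))"
    by (subst fps_mult_left_const_nth) (simp add: fps_mult_nth atLeast0AtMost convp_def)
  also have "(\<Sum>i\<le>m. real (Suc i) * p (Suc i) * convp p k (m - i)) = (\<Sum>j\<le>Suc m. real j * p j * convp p k (Suc m - j))"
    by (subst sum.atMost_Suc_shift) simp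
  finally show ?thesis using Suc by simp
qed simp

text \<open>If a sum of naturals is at most \<open>n\<close>, then so is each summand; the right
  side is the mass of the latter event.\<close>

lemma sum_convp_le:
  assumes "\<And>n. p n \<ge> 0"
  shows "(\<Sum>m\<le>n. convp p k m) \<le> (\<Sum>j\<le>n. p j) ^ k"
proof (induction k)
  case 0
  have "(\<Sum>m\<le>n. convp p 0 m) = 1" by (simp add: convp_0)
  thus ?case by simp
next
  case (Suc k)
  have "(\<Sum>m\<le>n. convp p (Suc k) m) = (\<Sum>m\<le>n. \<Sum>j\<le>m. p j * convp p k (m - j))"
    by (simp add: convp_Suc)
  also have "\<dots> = (\<Sum>(j,i)\<in>{(j,i). j + i \<le> n}. p j * convp p k i)"
    by (rule sum.triangle_reindex_eq[symmetric])
  also have "\<dots> \<le> (\<Sum>(j,i)\<in>{..n} \<times> {..n}. p j * convp p k i)"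
    by (intro sum_mono2) (auto intro!: mult_nonneg_nonneg convp_nonneg assms)
  also have "\<dots> = (\<Sum>j\<le>n. p j) * (\<Sum>i\<le>n. convp p k i)"
    by (simp add: sum_product sum.cartesian_product)
  also have "\<dots> \<le> (\<Sum>j\<le>n. p j) * (\<Sum>j\<le>n. p j) ^ k"
    by (intro mult_left_mono Suc.IH sum_nonneg assms)
  finally show ?case by simp
qed

text \<open>A union bound: either all summands are at most \<open>M\<close>, or one of the
  \<open>k\<close> positions carries some \<open>j > M\<close> and the other \<open>k - 1\<close>
  summands add up to \<open>x - j\<close>.\<close>

lemma convp_split_jump:
  assumes "\<And>n. p n \<ge> 0"
  shows "convp p k x \<le> convp (\<lambda>j. if real j \<le> M then p j else 0) k x 
    + real k * (\<Sum>j | j \<le> x \<and> real j > M. p j * convp p (k - 1) (x - j))"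
proof (induction k arbitrary: x)
  case 0
  show ?case by (simp add: convp_0)
next
  case (Suc k)
  define p' where "p' j = (if real j \<le> M then p j else 0)" for j
  define S where "S k x = (\<Sum>j | j \<le> x \<and> real j > M. p j * convp p (k - 1) (x - j))" for k x
  have p': "p' n \<ge> 0" for n using assms by (simp add: p'_def)
  have IH: "convp p k x \<le> convp p' k x + real k * S k x" for x
    using Suc.IH[of x] by (simp add: p'_def[abs_def] S_def)
  have fin: "finite {j. j \<le> x \<and> P j}" for P and x :: nat by (rule finite_subset[of _ "{..x}"]) auto
  have split: "(\<Sum>j\<le>x. p j * f j) = (\<Sum>j\<le>x. p' j * f j) + (\<Sum>j | j \<le> x \<and> real j > M. p j * f j)" for f
  proof -
    have "(\<Sum>j | j \<le> x \<and> real j > M. p j * f j) = (\<Sum>j\<le>x. if real j > M then p j * f j else 0)"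
      by (subst sum.inter_filter[symmetric]) auto
    thus ?thesis by (simp add: p'_def flip: sum.distrib) (intro sum.cong, auto)
  qed
  have "convp p (Suc k) x = (\<Sum>j\<le>x. p' j * convp p k (x - j)) + S (Suc k) x"
    unfolding convp_Suc split S_def by simp
  also have "(\<Sum>j\<le>x. p' j * convp p k (x - j)) \<le> (\<Sum>j\<le>x. p' j * (convp p' k (x - j) + real k * S k (x - j)))"
    by (intro sum_mono mult_left_mono IH p')
  also have "\<dots> = convp p' (Suc k) x + real k * (\<Sum>j\<le>x. p' j * S k (x - j))"
    by (simp add: convp_Suc distrib_left sum.distrib sum_distrib_left mult_ac)
  also have "real k * (\<Sum>j\<le>x. p' j * S k (x - j)) \<le> real k * S (Suc k) x"
  proof (cases k)
    case (Suc l)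
    \<comment> \<open>The first factor is enlarged from \<open>p'\<close> to \<open>p\<close> so
      that, after the sums are exchanged, it merges with \<open>convp p l\<close> into
      \<open>convp p k\<close>.\<close>
    have "(\<Sum>j\<le>x. p' j * S k (x - j)) \<le> (\<Sum>j\<le>x. p j * S k (x - j))"
      unfolding S_def by (intro sum_mono mult_right_mono sum_nonneg mult_nonneg_nonneg convp_nonneg assms) (auto simp: p'_def assms)
    also have "\<dots> = (\<Sum>j\<le>x. \<Sum>i | i \<le> x - j \<and> real i > M. p j * (p i * convp p l (x - j - i)))"
      by (simp add: S_def Suc sum_distrib_left)
    also have "\<dots> = (\<Sum>i | i \<le> x \<and> real i > M. \<Sum>j | j \<le> x \<and> i \<le> x - j. p j * (p i * convp p l (x - j - i)))"
    proof -
      have "(\<Sum>j\<le>x. \<Sum>i | i \<le> x - j \<and> real i > M. p j * (p i * convp p l (x - j - i)))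
         = (\<Sum>j\<in>{..x}. \<Sum>i | i \<in> {i. i \<le> x \<and> real i > M} \<and> i \<le> x - j. p j * (p i * convp p l (x - j - i)))"
        by (intro sum.cong) auto
      also have "\<dots> = (\<Sum>i\<in>{i. i \<le> x \<and> real i > M}. \<Sum>j | j \<in> {..x} \<and> i \<le> x - j. p j * (p i * convp p l (x - j - i)))"
        by (rule sum.swap_restrict) (auto intro: fin)
      finally show ?thesis by simp
    qed
    also have "\<dots> = (\<Sum>i | i \<le> x \<and> real i > M. p i * convp p k (x - i))"
    proof (rule sum.cong[OF refl])
      fix i assume i: "i \<in> {i. i \<le> x \<and> real i > M}"
      have "{j. j \<le> x \<and> i \<le> x - j} = {..x - i}" using i by auto
      thus "(\<Sum>j | j \<le> x \<and> i \<le> x - j. p j * (p i * convp p l (x - j - i))) = p i * convp p k (x - i)"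
        by (simp add: Suc convp_Suc sum_distrib_left mult.left_commute add.commute)
    qed
    also have "\<dots> = S (Suc k) x" by (simp add: S_def)
    finally show ?thesis by (intro mult_left_mono) auto
  qed simp
  finally have "convp p (Suc k) x \<le> convp p' (Suc k) x + real (Suc k) * S (Suc k) x"
    by (simp add: algebra_simps)
  thus ?case by (simp add: p'_def[abs_def] S_def)
qed

lemma convp_scale: "convp (\<lambda>n. c * w n * r ^ n) k n = c ^ k * convp w k n * r ^ n"
proof (induction k arbitrary: n)
  case 0
  show ?case by (simp add: convp_0)
next
  case (Suc k)
  have "convp (\<lambda>n. c * w n * r ^ n) (Suc k) n = (\<Sum>j\<le>n. c * w j * r ^ j * (c ^ k * convp w k (n - j) * r ^ (n - j)))"
    by (simp add: convp_Suc Suc)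
  also have "\<dots> = (\<Sum>j\<le>n. c ^ Suc k * r ^ n * (w j * convp w k (n - j)))"
  proof (intro sum.cong refl)
    fix j assume "j \<in> {..n}"
    hence "r ^ j * r ^ (n - j) = r ^ n" by (simp flip: power_add)
    hence "c * w j * r ^ j * (c ^ k * convp w k (n - j) * r ^ (n - j)) = c ^ Suc k * (r ^ n) * (w j * convp w k (n - j))"
      by (simp add: mult_ac)
    thus "c * w j * r ^ j * (c ^ k * convp w k (n - j) * r ^ (n - j)) = c ^ Suc k * r ^ n * (w j * convp w k (n - j))" .
  qed
  also have "\<dots> = c ^ Suc k * r ^ n * convp w (Suc k) n" by (simp add: convp_Suc sum_distrib_left)
  finally show ?case by (simp add: mult_ac)
qed

section \<open>Compositions and convolution powers\<close>

lemma comps_0: "comps 0 n = (if n = 0 then {[]} else {})"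
  by (auto simp: comps_def)

lemma comps_Suc: "comps (Suc k) n = (\<Union>j\<le>n. (#) j ` comps k (n - j))"
proof (intro equalityI subsetI)
  fix ks assume "ks \<in> comps (Suc k) n"
  thus "ks \<in> (\<Union>j\<le>n. (#) j ` comps k (n - j))"
    by (cases ks) (auto simp: comps_def intro!: bexI[of _ "hd ks"])
qed (auto simp: comps_def)

lemma finite_comps: "finite (comps k n)"
  by (induction k arbitrary: n) (auto simp: comps_0 comps_Suc)

lemma wconv_eq_convp: "wconv w k n = convp w k n"
proof (induction k arbitrary: n)
  case 0
  show ?case by (simp add: wconv_def comps_0 convp_0)
next
  case (Suc k)
  have "wconv w (Suc k) n = (\<Sum>j\<le>n. \<Sum>ks\<in>(#) j ` comps k (n - j). prod_list (map w ks))"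
    unfolding wconv_def comps_Suc by (rule sum.UNION_disjoint) (auto simp: finite_comps)
  also have "\<dots> = (\<Sum>j\<le>n. w j * wconv w k (n - j))"
    by (intro sum.cong refl, subst sum.reindex) (auto simp: wconv_def sum_distrib_left)
  finally show ?case by (simp add: Suc convp_Suc)
qed

section \<open>Local limit bounds with a single big jump\<close>

text \<open>In the application \<open>p n = w n * \<rho> ^ n / W\<close> is the law of \<open>X\<close>. The slowly varying function
  enters only through \<open>p_local\<close> and \<open>p_large\<close>.\<close>

locale big_jump =
  fixes p :: "nat \<Rightarrow> real" and \<gamma> :: real
  assumes p_nonneg: "p n \<ge> 0"
    and p_sums: "p sums 1"
    and p_local: "e > 0 \<Longrightarrow> \<forall>\<^sub>F n in sequentially. p n > 0 \<and> 
        (\<forall>j. n \<le> 2 * j \<and> j \<le> n \<longrightarrow> \<bar>real j * p j - real n * p n\<bar> \<le> e * (real n * p n))"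
    and p_large: "e > 0 \<Longrightarrow> filterlim (\<lambda>n. real n powr e * (real n * p n)) at_top sequentially"
    and p_tail: "0 < t \<Longrightarrow> t < 1 \<Longrightarrow>
        (\<lambda>n. (\<Sum>m. if real m > real n powr t then p m else 0) / (\<Sum>m. if real m > real n then p m else 0)) 
          \<longlonglongrightarrow> t powr (-\<gamma>)"
begin

section \<open>The tail of the summand law and its truncated mean\<close>

definition tail :: "real \<Rightarrow> real" where
  "tail x = (\<Sum>m. if real m > x then p m else 0)"

lemma summable_p: "summable p"
  using p_sums by (rule sums_summable)

lemma summable_if_p: "summable (\<lambda>m. if P m then p m else 0)"
  by (rule summable_comparison_test'[OF summable_p]) (use p_nonneg in auto)

lemma tail_diff: "x \<le> y \<Longrightarrow> tail x - tail y = (\<Sum>j | x < real j \<and> real j \<le> y. p j)"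
proof -
  assume xy: "x \<le> y"
  have "{j. x < real j \<and> real j \<le> y} \<subseteq> {..nat \<lceil>y\<rceil>}"
  proof
    fix j assume "j \<in> {j. x < real j \<and> real j \<le> y}"
    hence "real j \<le> real (nat \<lceil>y\<rceil>)" using real_nat_ceiling_ge[of y] order.trans by blast
    thus "j \<in> {..nat \<lceil>y\<rceil>}" by (simp only: of_nat_le_iff atMost_iff)
  qed
  hence fin: "finite {j. x < real j \<and> real j \<le> y}"
    by (rule finite_subset) simp
  have "tail x - tail y = (\<Sum>m. (if real m > x then p m else 0) - (if real m > y then p m else 0))"
    unfolding tail_def by (intro suminf_diff summable_if_p)
  also have "\<dots> = (\<Sum>m. if m \<in> {j. x < real j \<and> real j \<le> y} then p m else 0)"
    using xy by (intro suminf_cong) auto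
  also have "\<dots> = (\<Sum>j | x < real j \<and> real j \<le> y. p j)"
    using sums_If_finite_set[OF fin, of p] by (simp add: sums_iff)
  finally show ?thesis .
qed

lemma tail_antimono: "x \<le> y \<Longrightarrow> tail y \<le> tail x"
  using tail_diff[of x y] sum_nonneg[of _ p] p_nonneg by (metis diff_ge_0_iff_ge)

lemma tail_nat: "tail (real n) = 1 - (\<Sum>j\<le>n. p j)"
proof -
  have "tail (-1) = 1" using p_sums unfolding tail_def by (simp add: sums_iff)
  moreover have "tail (-1) - tail (real n) = (\<Sum>j | -1 < real j \<and> real j \<le> real n. p j)" by (rule tail_diff) simp
  moreover have "{j. -1 < real j \<and> real j \<le> real n} = {..n}" by auto
  ultimately show ?thesis by simp
qed

lemma tail_nonneg: "tail x \<ge> 0"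
  unfolding tail_def using p_nonneg by (intro suminf_nonneg summable_if_p) auto

lemma tail_le_1: "tail x \<le> 1"
proof -
  have "tail x \<le> (\<Sum>m. p m)" unfolding tail_def
    using p_nonneg by (intro suminf_le summable_if_p summable_p) auto
  thus ?thesis using p_sums by (simp add: sums_iff)
qed

lemma tail_pos: "tail x > 0"
proof -
  obtain N where N: "\<And>n. n \<ge> N \<Longrightarrow> p n > 0"
    using p_local[of 1] by (auto simp: eventually_sequentially)
  define n where "n = max N (nat \<lceil>x\<rceil> + 1)"
  have n: "n \<ge> N" "real n > x" by (auto simp: n_def) linarith
  have "0 < p n" using N n by simp
  thus ?thesis unfolding tail_def using p_nonneg n
    by (intro suminf_pos2[OF summable_if_p, of _ n]) auto
qed

lemma tail_lim: "(\<lambda>n. tail (real n)) \<longlonglongrightarrow> 0"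
proof -
  have "(\<lambda>n. \<Sum>j\<le>n. p j) \<longlonglongrightarrow> 1" using p_sums by (simp add: sums_def_le)
  from tendsto_diff[OF tendsto_const this, of 1] show ?thesis by (simp add: tail_nat)
qed

lemma p_le_1: "p n \<le> 1"
proof -
  have "p n \<le> (\<Sum>j\<le>n. p j)" using p_nonneg by (intro member_le_sum) auto
  thus ?thesis using tail_nat[of n] tail_nonneg[of "real n"] by simp
qed

text \<open>Tolerance 1/2 gives \<open>j * p j \<le> 2 * (n * p n)\<close>, and
  \<open>n \<le> 2 * j\<close> costs another factor 2, whence the 4.\<close>

lemma p_near: "\<forall>\<^sub>F n in sequentially. p n > 0 \<and> (\<forall>j. n \<le> 2 * j \<and> j \<le> n \<longrightarrow> p j \<le> 4 * p n \<and> real n * p n \<le> 2 * (real j * p j))"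
  using p_local[of "1/2", simplified] eventually_gt_at_top[of 0]
proof eventually_elim
  case (elim n)
  show ?case
  proof (intro conjI allI impI)
    show "p n > 0" using elim by simp
    fix j assume j: "n \<le> 2 * j \<and> j \<le> n"
    with elim have *: "\<bar>real j * p j - real n * p n\<bar> \<le> (real n * p n) / 2" by simp
    thus "real n * p n \<le> 2 * (real j * p j)" by linarith
    have "real j * p j \<le> 2 * (real n * p n)" using * mult_nonneg_nonneg[OF _ p_nonneg[of n], of "real n"] by linarith
    also have "\<dots> \<le> 2 * (2 * real j * p n)" using j p_nonneg by (intro mult_left_mono mult_right_mono) auto
    finally show "p j \<le> 4 * p n" using j elim by (simp add: mult.assoc)
  qed
qed

text \<open>The atoms between \<open>n/2\<close> and \<open>n\<close> are bounded below by a
  multiple of \<open>p n\<close>, and their total mass is at most 1. Small \<open>n\<close> are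
  covered by \<open>p n \<le> 1\<close>.\<close>

lemma np_bounded: "\<exists>B>0. \<forall>n. real n * p n \<le> B"
proof -
  obtain N where N: "\<And>n j. n \<ge> N \<Longrightarrow> n \<le> 2 * j \<and> j \<le> n \<Longrightarrow> real n * p n \<le> 2 * (real j * p j)"
    using p_near by (auto simp: eventually_sequentially)
  have "real n * p n \<le> max 8 (real N)" for n
  proof (cases "n \<ge> N \<and> n > 0")
    case True
    have "real n / 2 * (real n * p n / (2 * real n)) \<le> (\<Sum>j\<in>{n - n div 2..n}. p j)"
    proof -
      have "p j \<ge> real n * p n / (2 * real n)" if "j \<in> {n - n div 2..n}" for j
      proof -
        have "real n * p n \<le> 2 * (real j * p j)" using that True by (intro N) auto
        also have "\<dots> \<le> 2 * (real n * p j)" using that p_nonneg by (intro mult_left_mono mult_right_mono) auto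
        finally show ?thesis using True by (simp add: field_simps)
      qed
      hence "real (card {n - n div 2..n}) * (real n * p n / (2 * real n)) \<le> (\<Sum>j\<in>{n - n div 2..n}. p j)"
        by (rule sum_bounded_below)
      moreover have "real n / 2 \<le> real (card {n - n div 2..n})" by simp
      moreover have "real n * p n / (2 * real n) \<ge> 0" using p_nonneg by simp
      ultimately show ?thesis by (meson mult_right_mono order.trans)
    qed
    also have "\<dots> \<le> (\<Sum>j\<le>n. p j)" using p_nonneg by (intro sum_mono2) auto
    also have "\<dots> \<le> 1" using tail_nat[of n] tail_nonneg[of "real n"] by simp
    finally show ?thesis using True by simp
  next
    case False
    hence "real n * p n \<le> real N * 1" using p_nonneg p_le_1 by (intro mult_mono) auto
    thus ?thesis by simp
  qed
  thus ?thesis by (intro exI[of _ "max 8 (real N)"]) auto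
qed

text \<open>The tail contains the \<open>n\<close> atoms in \<open>{n<..2*n}\<close>, each at least
  \<open>p (2 * n) / 2\<close>, while \<open>n * p n\<close> is at most
  \<open>3 * n * p (2 * n)\<close>.\<close>

lemma tail_ge: "\<forall>\<^sub>F n in sequentially. tail (real n) \<ge> real n * p n / 8"
proof -
  have "\<forall>\<^sub>F n in sequentially. 2 * n \<ge> n \<and> (p (2 * n) > 0 \<and> (\<forall>j. 2 * n \<le> 2 * j \<and> j \<le> 2 * n \<longrightarrow> p j \<le> 4 * p (2 * n) \<and> real (2 * n) * p (2 * n) \<le> 2 * (real j * p j)))"
  proof -
    have "filterlim (\<lambda>n::nat. 2 * n) at_top sequentially" by (rule filterlim_subseq) (auto simp: strict_mono_def)
    from eventually_compose_filterlim[OF p_near this] show ?thesis by simp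
  qed
  moreover have "\<forall>\<^sub>F n in sequentially. 2 * n \<ge> n \<and> 
        (\<forall>j. 2 * n \<le> 2 * j \<and> j \<le> 2 * n \<longrightarrow> \<bar>real j * p j - real (2 * n) * p (2 * n)\<bar> \<le> 1/2 * (real (2 * n) * p (2 * n)))"
  proof -
    have "filterlim (\<lambda>n::nat. 2 * n) at_top sequentially" by (rule filterlim_subseq) (auto simp: strict_mono_def)
    from eventually_compose_filterlim[OF p_local[of "1/2"] this] show ?thesis by (auto elim: eventually_mono)
  qed
  ultimately show ?thesis using eventually_gt_at_top[of 0]
  proof eventually_elim
    case (elim n)
    have "\<bar>real n * p n - real (2 * n) * p (2 * n)\<bar> \<le> 1/2 * (real (2 * n) * p (2 * n))"
      using elim(2) by simp
    hence 1: "real n * p n \<le> 3/2 * (real (2 * n) * p (2 * n))" by linarith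
    have "real n * (p (2 * n) / 2) \<le> (\<Sum>j\<in>{n<..2*n}. p j)"
    proof -
      have "p (2 * n) / 2 \<le> p j" if "j \<in> {n<..2*n}" for j
      proof -
        have "real (2 * n) * p (2 * n) \<le> 2 * (real j * p j)" using that elim(1) by auto
        also have "\<dots> \<le> 2 * (real (2 * n) * p j)" using that p_nonneg by (intro mult_left_mono mult_right_mono) auto
        finally have "real (2 * n) * p (2 * n) \<le> real (2 * n) * (2 * p j)" by simp
        thus ?thesis using elim by (simp add: mult_le_cancel_left)
      qed
      hence "real (card {n<..2*n}) * (p (2 * n) / 2) \<le> (\<Sum>j\<in>{n<..2*n}. p j)" by (rule sum_bounded_below)
      thus ?thesis by simp
    qed
    also have "(\<Sum>j\<in>{n<..2*n}. p j) = tail (real n) - tail (real (2 * n))"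
    proof -
      have "{j. real n < real j \<and> real j \<le> real (2 * n)} = {n<..2*n}" by auto
      thus ?thesis by (subst tail_diff) auto
    qed
    also have "\<dots> \<le> tail (real n)" using tail_nonneg by simp
    finally show ?case using 1 p_nonneg[of n] tail_nonneg[of "real n"] by simp
  qed
qed

text \<open>\<open>tail\<close> decays slower than any power, so a power of \<open>n\<close> saved
  by truncation at \<open>n powr t\<close> outweighs it.\<close>

lemma tail_large: "e > 0 \<Longrightarrow> filterlim (\<lambda>n. real n powr e * tail (real n)) at_top sequentially"
proof -
  assume e: "e > 0"
  have "filterlim (\<lambda>n. 1/8 * (real n powr e * (real n * p n))) at_top sequentially"
    by (rule filterlim_tendsto_pos_mult_at_top[OF tendsto_const _ p_large[OF e]]) simp
  moreover have "\<forall>\<^sub>F n in sequentially. 1/8 * (real n powr e * (real n * p n)) \<le> real n powr e * tail (real n)"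
    using tail_ge
  proof eventually_elim
    case (elim n)
    have "real n powr e * (real n * p n / 8) \<le> real n powr e * tail (real n)" using elim by (intro mult_left_mono) auto
    thus ?case by simp
  qed
  ultimately show ?thesis by (rule filterlim_at_top_mono)
qed

lemma tail_ratio: "0 < t \<Longrightarrow> t < 1 \<Longrightarrow> (\<lambda>n. tail (real n powr t) / tail (real n)) \<longlonglongrightarrow> t powr (-\<gamma>)"
  using p_tail unfolding tail_def .

text \<open>\<open>t powr (-\<gamma>)\<close> is continuous at 1. Summands between
  \<open>n powr t\<close> and \<open>n\<close> are thus rare relative to \<open>tail n\<close>,
  which replaces a scaling property of the tail in the estimates below.\<close>

lemma tail_ratio_near_1:
  assumes "e > 0"
  shows "\<exists>t. 0 < t \<and> t < 1 \<and> (\<forall>\<^sub>F n in sequentially. tail (real n powr t) \<le> (1 + e) * tail (real n))"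
proof -
  have "((\<lambda>t::real. t powr (-\<gamma>)) \<longlongrightarrow> 1 powr (-\<gamma>)) (at_left 1)"
    by (intro tendsto_intros) auto
  hence "\<forall>\<^sub>F t in at_left 1. t powr (-\<gamma>) < 1 + e"
    using assms by (intro order_tendstoD(2)) auto
  moreover have "\<forall>\<^sub>F t in at_left (1::real). t \<in> {0<..<1}" by (rule eventually_at_left_real) simp
  ultimately have "\<forall>\<^sub>F t in at_left 1. t powr (-\<gamma>) < 1 + e \<and> t \<in> {0<..<1}" by eventually_elim auto
  then obtain t where t: "t powr (-\<gamma>) < 1 + e" "0 < t" "t < 1"
    using eventually_happens[of _ "at_left (1::real)"] by auto
  have "\<forall>\<^sub>F n in sequentially. tail (real n powr t) / tail (real n) < 1 + e"
    using order_tendstoD(2)[OF tail_ratio[OF t(2,3)] t(1)] .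
  hence "\<forall>\<^sub>F n in sequentially. tail (real n powr t) \<le> (1 + e) * tail (real n)"
  proof eventually_elim
    case (elim n)
    thus ?case using tail_pos[of "real n"] by (simp add: divide_less_eq)
  qed
  thus ?thesis using t by blast
qed

text \<open>By Markov's inequality \<open>2 * k * mean_upto n\<close> bounds the probability that
  \<open>k\<close> summands, all at most \<open>n\<close>, add up to at least
  \<open>n/2\<close>.\<close>

definition mean_upto :: "nat \<Rightarrow> real" where
  "mean_upto n = (\<Sum>j\<le>n. real j * p j) / real n"

text \<open>Summands up to \<open>n powr t\<close> contribute at most \<open>n powr (t - 1)\<close>,
  a power and hence negligible against \<open>tail n\<close>. Those between \<open>n powr t\<close>
  and \<open>n\<close> contribute at most \<open>tail (n powr t) - tail n\<close>, a small multiple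
  of \<open>tail n\<close>. So about \<open>1 / tail n\<close> truncated summands still have a sum
  that is small against \<open>n\<close>.\<close>

lemma mean_upto_small: "(\<lambda>n. mean_upto n / tail (real n)) \<longlonglongrightarrow> 0"
proof (rule tendstoI)
  fix e :: real assume e: "e > 0"
  obtain t where t: "0 < t" "t < 1" "\<forall>\<^sub>F n in sequentially. tail (real n powr t) \<le> (1 + e/2) * tail (real n)"
    using tail_ratio_near_1[of "e/2"] e by auto
  have "\<forall>\<^sub>F n in sequentially. real n powr (1 - t) * tail (real n) \<ge> 4 / e"
    using tail_large[of "1 - t"] t by (simp add: filterlim_at_top)
  thus "\<forall>\<^sub>F n in sequentially. dist (mean_upto n / tail (real n)) 0 < e"
    using t(3) eventually_gt_at_top[of 1]
  proof eventually_elim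
    case (elim n)
    define M where "M = real n powr t"
    have M: "M \<le> real n" unfolding M_def using elim t powr_mono[of t 1 "real n"] by simp
    have "(\<Sum>j\<le>n. real j * p j) \<le> (\<Sum>j\<le>n. M * p j + (if M < real j then real n * p j else 0))"
    proof (rule sum_mono)
      fix j assume "j \<in> {..n}"
      hence "real j * p j \<le> real n * p j" "M * p j \<ge> 0" using p_nonneg[of j] by (auto intro: mult_right_mono simp: M_def)
      thus "real j * p j \<le> M * p j + (if M < real j then real n * p j else 0)"
        using p_nonneg[of j] by (auto intro: mult_right_mono)
    qed
    also have "\<dots> = M * (\<Sum>j\<le>n. p j) + real n * (\<Sum>j\<le>n. if M < real j then p j else 0)"
      by (simp only: sum.distrib sum_distrib_left if_distrib[of "\<lambda>x. real n * x"] mult_zero_right)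
    also have "(\<Sum>j\<le>n. if M < real j then p j else 0) = tail M - tail (real n)"
      unfolding tail_diff[OF M] by (subst sum.inter_filter[symmetric]) (auto intro!: sum.cong)
    also have "M * (\<Sum>j\<le>n. p j) + real n * (tail M - tail (real n)) \<le> M * 1 + real n * (e/2 * tail (real n))"
    proof (intro add_mono mult_left_mono)
      show "(\<Sum>j\<le>n. p j) \<le> 1" using tail_nat[of n] tail_nonneg[of "real n"] by simp
      show "tail M - tail (real n) \<le> e / 2 * tail (real n)" using elim(2) by (simp add: M_def algebra_simps)
    qed (auto simp: M_def)
    finally have "mean_upto n \<le> (M + real n * (e/2 * tail (real n))) / real n"
      unfolding mean_upto_def using elim by (intro divide_right_mono) auto
    also have "\<dots> = real n powr (t - 1) + e/2 * tail (real n)"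
      using elim by (simp add: M_def add_divide_distrib powr_diff)
    finally have "mean_upto n / tail (real n) \<le> real n powr (t - 1) / tail (real n) + e/2"
      using tail_pos[of "real n"] by (simp add: field_simps)
    also have "real n powr (t - 1) / tail (real n) \<le> e/4"
    proof -
      have "real n powr (t - 1) * (4 / e) \<le> real n powr (t - 1) * (real n powr (1 - t) * tail (real n))"
        using elim by (intro mult_left_mono) auto
      also have "\<dots> = tail (real n)" using elim by (simp add: mult.assoc[symmetric] powr_add[symmetric])
      finally show ?thesis using e tail_pos[of "real n"] by (simp add: field_simps)
    qed
    finally have "mean_upto n / tail (real n) \<le> e/4 + e/2" by simp
    hence "mean_upto n / tail (real n) < e" using e by linarith
    moreover have "mean_upto n \<ge> 0" unfolding mean_upto_def using p_nonneg by (intro divide_nonneg_nonneg sum_nonneg) auto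
    ultimately show ?case using tail_pos[of "real n"] by simp
  qed
qed

section \<open>Local bounds uniform in the number of summands\<close>

lemma sum_convp_tail: "(\<Sum>m\<le>n. convp p k m) \<le> (1 - tail (real n)) ^ k"
  using sum_convp_le[of p k n] p_nonneg by (simp add: tail_nat)

lemma sum_convp_le_1: "(\<Sum>m\<le>n. convp p k m) \<le> 1"
  using sum_convp_tail[of k n] power_le_one[of "1 - tail (real n)" k] tail_nonneg tail_le_1 by fastforce

lemma sum_convp_rev: "(\<Sum>a\<le>x. convp p k (x - a)) = (\<Sum>a\<le>x. convp p k a)"
  using sum.nat_diff_reindex[of "convp p k" "Suc x"] by (simp add: lessThan_Suc_atMost)

text \<open>One of the two blocks sums to at least \<open>x / 2\<close>, so its point probability is
  at most \<open>A\<close>. Summing over the value of the other block leaves at most the probability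
  that all its summands are at most \<open>x\<close>.\<close>

lemma convp_halve:
  assumes "\<And>y. x \<le> 2 * y \<Longrightarrow> y \<le> x \<Longrightarrow> convp p k y \<le> A \<and> convp p l y \<le> A" and "A \<ge> 0"
  shows "convp p (k + l) x \<le> A * ((1 - tail (real x)) ^ k + (1 - tail (real x)) ^ l)"
proof -
  have nn: "convp p k n \<ge> 0" for k n by (rule convp_nonneg) (rule p_nonneg)
  have "convp p (k + l) x \<le> (\<Sum>a\<le>x. A * convp p l (x - a) + A * convp p k a)"
    unfolding convp_add
  proof (rule sum_mono)
    fix a assume a: "a \<in> {..x}"
    show "convp p k a * convp p l (x - a) \<le> A * convp p l (x - a) + A * convp p k a"
    proof (cases "x \<le> 2 * a")
      case True
      hence "convp p k a * convp p l (x - a) \<le> A * convp p l (x - a)" using assms(1)[of a] a nn by (intro mult_right_mono) auto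
      thus ?thesis using mult_nonneg_nonneg[OF assms(2) nn[of k a]] by linarith
    next
      case False
      hence "convp p k a * convp p l (x - a) \<le> convp p k a * A" using assms(1)[of "x - a"] a nn by (intro mult_left_mono) auto
      thus ?thesis using mult_nonneg_nonneg[OF assms(2) nn[of l "x - a"]] by (simp add: mult.commute)
    qed
  qed
  also have "\<dots> = A * ((\<Sum>a\<le>x. convp p k a) + (\<Sum>a\<le>x. convp p l a))"
    by (simp add: sum.distrib sum_convp_rev distrib_left flip: sum_distrib_left)
  also have "\<dots> \<le> A * ((1 - tail (real x)) ^ k + (1 - tail (real x)) ^ l)"
    using assms(2) by (intro mult_left_mono add_mono sum_convp_tail)
  finally show ?thesis .
qed

text \<open>In the size-bias identity one summand contributes \<open>j * p j \<le> B\<close> and the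
  others have mass at most 1. This misses \<open>k * p y\<close> by a factor
  \<open>B / (y * p y)\<close>, eventually smaller than any power, which is harmless where a power
  of \<open>n\<close> is gained.\<close>

lemma convp_crude:
  assumes "\<And>n. real n * p n \<le> B" "B \<ge> 0"
  shows "real y * convp p k y \<le> real k * B"
proof (cases k)
  case 0
  thus ?thesis by (simp add: convp_0)
next
  case (Suc l)
  have "real y * convp p k y = real k * (\<Sum>j\<le>y. real j * p j * convp p l (y - j))"
    unfolding Suc by (rule convp_size_bias)
  also have "\<dots> \<le> real k * (\<Sum>j\<le>y. B * convp p l (y - j))"
    using assms by (intro mult_left_mono sum_mono mult_right_mono convp_nonneg p_nonneg) auto
  also have "\<dots> = real k * (B * (\<Sum>j\<le>y. convp p l j))" by (simp add: sum_convp_rev flip: sum_distrib_left)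
  also have "\<dots> \<le> real k * (B * 1)" using assms by (intro mult_left_mono sum_convp_le_1) auto
  finally show ?thesis by simp
qed

text \<open>Strong induction on \<open>k\<close>. If \<open>k * tail n\<close> is large, halve: one of the two halves is at least \<open>n / 2\<close>
  and the other contributes the factor \<open>(1 - tail n) ^ (k div 2)\<close>. If it is bounded, split at the largest
  summand: above \<open>n / 2\<close> gives \<open>k * p n\<close>; all below \<open>n powr t\<close> is negligible by size-biasing; and the
  summands in between have mass \<open>k * (tail (n powr t) - tail n)\<close>, which is small for \<open>t\<close> near \<open>1\<close> and so
  lets the induction close.\<close>

lemma convp_local_bound:
  "\<exists>C N. C > 0 \<and> N \<ge> 1 \<and> (\<forall>n\<ge>N. p n > 0 \<and> (\<forall>k\<ge>1. convp p k n \<le> C * real k * p n))"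
proof -
  have nn: "convp p k n \<ge> 0" for k n by (rule convp_nonneg) (rule p_nonneg)
  obtain B where B: "B > 0" "\<And>n. real n * p n \<le> B" using np_bounded by blast
  \<comment> \<open>\<open>1/72 = 1/(9 * 8)\<close>: with \<open>k * tail n \<le> 9\<close>,
    \<open>k\<close> times the mass between \<open>n powr t\<close> and \<open>n\<close> is then at
    most 1/8.\<close>
  obtain t where t: "0 < t" "t < 1" and ratio: "\<forall>\<^sub>F n in sequentially. tail (real n powr t) \<le> (1 + 1/72) * tail (real n)"
    using tail_ratio_near_1[of "1/72"] by auto
  define d where "d = (1 - t) / 2"
  have d: "d > 0" using t by (simp add: d_def)
  have half: "\<forall>\<^sub>F n in sequentially. real n powr t \<le> real n / 2"
  proof -
    have "\<forall>\<^sub>F n in sequentially. real n powr (1 - t) \<ge> 2"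
      using eventually_compose_filterlim[OF _ filterlim_real_sequentially, of "\<lambda>x. x powr (1 - t) \<ge> 2"] 
        real_powr_at_top[of "1 - t"] t by (simp add: filterlim_at_top)
    thus ?thesis using eventually_gt_at_top[of 0]
    proof eventually_elim
      case (elim n)
      have "real n powr t * 2 \<le> real n powr t * real n powr (1 - t)" using elim by (intro mult_left_mono) auto
      thus ?case using elim by (simp add: powr_add[symmetric])
    qed
  qed
  \<comment> \<open>18 is 2, from applying the crude bound at \<open>n/2\<close>, times 9, from
    \<open>k * tail n \<le> 9\<close>. The gained power \<open>n powr (1 - t)\<close> is shared
    equally between the factors \<open>n * p n\<close> and \<open>tail n\<close>.\<close>
  have small: "\<forall>\<^sub>F n in sequentially. 18 * B * real n powr (t - 1) \<le> (real n * p n) * tail (real n)"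
  proof -
    have "\<forall>\<^sub>F n in sequentially. real n powr d * (real n * p n) \<ge> 18 * B"
      using p_large[OF d] by (simp add: filterlim_at_top)
    moreover have "\<forall>\<^sub>F n in sequentially. real n powr d * tail (real n) \<ge> 1"
      using tail_large[OF d] by (simp add: filterlim_at_top)
    ultimately show ?thesis using eventually_gt_at_top[of 0]
    proof eventually_elim
      case (elim n)
      have "18 * B * 1 \<le> (real n powr d * (real n * p n)) * (real n powr d * tail (real n))"
        using elim B(1) by (intro mult_mono[of "18 * B" _ 1]) auto
      also have "\<dots> = (real n powr d * real n powr d) * ((real n * p n) * tail (real n))" by (simp add: mult_ac)
      also have "real n powr d * real n powr d = real n powr (1 - t)" by (simp add: powr_add[symmetric] d_def)
      finally have "real n powr (t - 1) * (18 * B) \<le> real n powr (t - 1) * (real n powr (1 - t) * ((real n * p n) * tail (real n)))"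
        by (intro mult_left_mono) auto
      also have "\<dots> = (real n * p n) * tail (real n)" using elim by (simp add: mult.assoc[symmetric] powr_add[symmetric])
      finally show ?case by (simp add: mult_ac)
    qed
  qed
  obtain N where N0: "\<And>n. n \<ge> N \<Longrightarrow> (p n > 0 \<and> (\<forall>j. n \<le> 2 * j \<and> j \<le> n \<longrightarrow> p j \<le> 4 * p n \<and> real n * p n \<le> 2 * (real j * p j))) \<and>
      tail (real n powr t) \<le> (1 + 1/72) * tail (real n) \<and> real n powr t \<le> real n / 2 \<and>
      18 * B * real n powr (t - 1) \<le> (real n * p n) * tail (real n) \<and> 1 \<le> n"
    using eventually_conj[OF p_near eventually_conj[OF ratio eventually_conj[OF half eventually_conj[OF small eventually_ge_at_top[of 1]]]]]
    unfolding eventually_sequentially by blast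
  have N: "\<And>n. n \<ge> N \<Longrightarrow> p n > 0" "\<And>n j. n \<ge> N \<Longrightarrow> n \<le> 2 * j \<Longrightarrow> j \<le> n \<Longrightarrow> p j \<le> 4 * p n" 
    "\<And>n. n \<ge> N \<Longrightarrow> tail (real n powr t) \<le> (1 + 1/72) * tail (real n)"
    "\<And>n. n \<ge> N \<Longrightarrow> real n powr t \<le> real n / 2"
    "\<And>n. n \<ge> N \<Longrightarrow> 18 * B * real n powr (t - 1) \<le> (real n * p n) * tail (real n)" "N \<ge> 1"
    using N0 by auto
  \<comment> \<open>The recursion below yields \<open>5 + C/2\<close>, which is at most
    \<open>C\<close> for \<open>C \<ge> 10\<close>. The sum settles
    \<open>N \<le> n < 2 * N\<close>, where halving \<open>n\<close> would leave the range in which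
    the induction hypothesis holds.\<close>
  define C where "C = 10 + (\<Sum>n\<in>{N..2*N}. 1 / p n)"
  have C10: "C \<ge> 10" unfolding C_def using p_nonneg by (auto intro!: sum_nonneg)
  have claim: "convp p k n \<le> C * real k * p n" if "k \<ge> 1" "n \<ge> N" for k n
    using that
  proof (induction k arbitrary: n rule: less_induct)
    case (less k)
    have pn: "p n > 0" using N(1) less by simp
    show ?case
    proof (cases "n < 2 * N")
      case True
      have "convp p k n \<le> (\<Sum>m\<le>n. convp p k m)" by (intro member_le_sum nn) auto
      also have "\<dots> \<le> 1" by (rule sum_convp_le_1)
      also have "1 / p n \<le> (\<Sum>n\<in>{N..2*N}. 1 / p n)"
        using True less.prems p_nonneg by (intro member_le_sum) auto
      hence "1 / p n \<le> C" by (simp add: C_def)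
      hence "1 \<le> C * 1 * p n" using pn by (simp add: field_simps)
      also have "\<dots> \<le> C * real k * p n" using less.prems C10 pn by (intro mult_right_mono mult_left_mono) auto
      finally show ?thesis by simp
    next
      case False
      have n0: "n > 0" using less.prems N(6) by simp
      have IH: "convp p l y \<le> C * real l * (4 * p n)" if "n \<le> 2 * y" "y \<le> n" "l \<ge> 1" "l < k" for l y
      proof -
        have "convp p l y \<le> C * real l * p y" using that False by (intro less.IH) auto
        also have "\<dots> \<le> C * real l * (4 * p n)" using that C10 less.prems by (intro mult_left_mono N(2)) auto
        finally show ?thesis .
      qed
      show ?thesis
      \<comment> \<open>Beyond 9, \<open>k \<le> 3 * k1\<close> gives
        \<open>k1 * tail n > 3\<close>, and \<open>exp (-3) \<le> 1/8\<close> brings the factor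
        \<open>4 * (1/8 + 1/8)\<close> down to 1.\<close>
      proof (cases "real k * tail (real n) \<le> 9")
        case False
        have "k \<noteq> 1"
        proof
          assume "k = 1"
          thus False using False tail_le_1[of "real n"] by simp
        qed
        with less.prems have k2: "k \<ge> 2" by simp
        define k1 k2 where "k1 = k div 2" and "k2 = k - k div 2"
        have k12: "k = k1 + k2" "1 \<le> k1" "k1 \<le> k2" "k2 < k" "k \<le> 3 * k1" using k2 by (auto simp: k1_def k2_def)
        let ?q = "1 - tail (real n)"
        have q: "0 \<le> ?q" "?q \<le> 1" using tail_le_1 tail_nonneg by auto
        have "convp p (k1 + k2) n \<le> (C * real k * (4 * p n)) * (?q ^ k1 + ?q ^ k2)"
        proof (rule convp_halve)
          fix y assume y: "n \<le> 2 * y" "y \<le> n"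
          have "convp p l y \<le> C * real k * (4 * p n)" if "l \<ge> 1" "l < k" for l
            using pn C10 that by (intro order.trans[OF IH[OF y that]] mult_right_mono mult_left_mono) auto
          thus "convp p k1 y \<le> C * real k * (4 * p n) \<and> convp p k2 y \<le> C * real k * (4 * p n)"
            using k12 by auto
        qed (use C10 pn in auto)
        moreover have "?q ^ k2 \<le> ?q ^ k1" using q k12 by (intro power_decreasing) auto
        moreover have "?q ^ k1 \<le> 1/8"
        proof -
          have "?q \<le> exp (- tail (real n))" using exp_ge_add_one_self[of "- tail (real n)"] by simp
          hence "?q ^ k1 \<le> exp (- tail (real n)) ^ k1" using q by (intro power_mono) auto
          also have "\<dots> = exp (- (real k1 * tail (real n)))" by (simp add: exp_of_nat_mult[symmetric])
          also have "\<dots> \<le> exp (-3)"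
          proof -
            have "9 < real k * tail (real n)" using False by simp
            also have "\<dots> \<le> (3 * real k1) * tail (real n)" using k12(5) tail_nonneg by (intro mult_right_mono) auto
            finally show ?thesis by simp
          qed
          also have "\<dots> \<le> 1/8"
          proof -
            have "(2::real) ^ 3 \<le> exp 1 ^ 3" using exp_ge_add_one_self[of 1] by (intro power_mono) auto
            also have "exp 1 ^ 3 = exp (3::real)" by (simp add: exp_of_nat_mult[symmetric])
            finally show ?thesis by (simp add: exp_minus field_simps)
          qed
          finally show ?thesis .
        qed
        ultimately have "convp p k n \<le> (C * real k * (4 * p n)) * (1/8 + 1/8)"
          unfolding k12(1)[symmetric] using C10 pn
          by (elim order.trans) (intro mult_left_mono add_mono, auto)
        thus ?thesis by simp
      next
        case True
        define M where "M = real n powr t"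
        define p' where "p' j = (if real j \<le> M then p j else 0)" for j
        have nnN: "n \<ge> N" using less.prems by simp
        have M: "M \<le> real n / 2" "M \<ge> 0" using N(4)[OF nnN] by (auto simp: M_def)
        have p': "p' j \<ge> 0" "p' j \<le> p j" for j using p_nonneg by (auto simp: p'_def)
        obtain l where l: "k = Suc l" using less.prems by (cases k) auto
        \<comment> \<open>A summand of size at most \<open>M \<le> n/2\<close> leaves at least
          \<open>n/2\<close> to the others, so the crude bound applies to them. Size-biasing weighs
          the summand by at most \<open>M = n powr t\<close>, and this gains the power of
          \<open>n\<close>.\<close>
        have part1: "convp p' k n \<le> real k * p n"
        proof -
          have term_le: "real j * p' j * convp p' l (n - j) \<le> M * (2 * real k * B / real n) * p' j" if "j \<le> n" for j
          proof (cases "real j \<le> M")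
            case jM: True
            have y: "real (n - j) \<ge> real n / 2" using jM M that by simp
            have "real (n - j) * convp p l (n - j) \<le> real l * B" using B by (intro convp_crude) auto
            hence "real n / 2 * convp p l (n - j) \<le> real l * B" using y nn[of l "n - j"] by (meson mult_right_mono order.trans)
            hence "convp p l (n - j) \<le> 2 * real l * B / real n" using n0 by (simp add: field_simps)
            also have "\<dots> \<le> 2 * real k * B / real n" using B l by (intro divide_right_mono mult_right_mono) auto
            finally have "convp p' l (n - j) \<le> 2 * real k * B / real n" using convp_mono[of p' p l] p' by (meson order.trans)
            hence "real j * p' j * convp p' l (n - j) \<le> M * p' j * (2 * real k * B / real n)"
              using jM p' B M by (intro mult_mono convp_nonneg) auto
            thus ?thesis by (simp add: mult_ac)
          qed (simp add: p'_def)
          have "real n * convp p' k n = real k * (\<Sum>j\<le>n. real j * p' j * convp p' l (n - j))"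
            unfolding l by (rule convp_size_bias)
          also have "\<dots> \<le> real k * (\<Sum>j\<le>n. M * (2 * real k * B / real n) * p' j)"
            by (intro mult_left_mono sum_mono term_le) auto
          also have "\<dots> = real k * (M * (2 * real k * B / real n) * (\<Sum>j\<le>n. p' j))"
            by (simp add: sum_distrib_left)
          finally have eq: "real n * convp p' k n \<le> real k * (M * (2 * real k * B / real n) * (\<Sum>j\<le>n. p' j))" .
          have "(\<Sum>j\<le>n. p' j) \<le> 1"
          proof -
            have "(\<Sum>j\<le>n. p' j) \<le> (\<Sum>j\<le>n. p j)" by (intro sum_mono p')
            thus ?thesis using tail_nat[of n] tail_nonneg[of "real n"] by simp
          qed
          hence "M * (2 * real k * B / real n) * (\<Sum>j\<le>n. p' j) \<le> M * (2 * real k * B / real n) * 1"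
            using M B by (intro mult_left_mono) auto
          hence "real k * (M * (2 * real k * B / real n) * (\<Sum>j\<le>n. p' j)) \<le> real k * (M * (2 * real k * B / real n))"
            by (intro mult_left_mono) auto
          from order.trans[OF eq this] have "real n * convp p' k n \<le> real k * (M * (2 * real k * B / real n))" .
          moreover have "M * (2 * real k * B / real n) \<le> real n * p n"
          proof -
            have "M * (2 * real k * B / real n) * tail (real n) = 2 * B * (M / real n) * (real k * tail (real n))" by simp
            also have "\<dots> \<le> 2 * B * (M / real n) * 9" using True B M by (intro mult_left_mono) auto
            also have "\<dots> = 18 * B * real n powr (t - 1)" using n0 by (simp add: M_def powr_diff)
            also have "\<dots> \<le> (real n * p n) * tail (real n)" by (rule N(5)[OF nnN])
            finally show ?thesis using tail_pos[of "real n"] by (rule mult_right_le_imp_le)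
          qed
          hence "real k * (M * (2 * real k * B / real n)) \<le> real k * (real n * p n)"
            by (intro mult_left_mono) auto
          ultimately have "real n * convp p' k n \<le> real n * (real k * p n)" by (simp add: mult.left_commute)
          thus ?thesis using n0 by simp
        qed
        have part2: "(\<Sum>j | j \<le> n \<and> real j > M. p j * convp p l (n - j)) \<le> 4 * p n + C * real k * (4 * p n) * (tail M - tail (real n))"
        proof -
          \<comment> \<open>Either \<open>n \<le> 2 * j\<close> and \<open>p j\<close> is at most
            \<open>4 * p n\<close>, or the remaining \<open>l < k\<close> summands have a sum above
            \<open>n/2\<close> and the induction hypothesis applies to them.\<close>
          have term_le: "p j * convp p l (n - j) \<le> 4 * p n * convp p l (n - j) + C * real k * (4 * p n) * p j" if j: "j \<le> n" for j
          proof (cases "n \<le> 2 * j")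
            case True
            have "p j * convp p l (n - j) \<le> 4 * p n * convp p l (n - j)" using True j nn nnN by (intro mult_right_mono N(2)) auto
            thus ?thesis using C10 pn p_nonneg[of j] by (simp add: add_increasing2)
          next
            case False
            have "convp p l (n - j) \<le> C * real k * (4 * p n)"
            proof (cases "l = 0")
              case True
              thus ?thesis using False C10 pn by (simp add: convp_0)
            next
              case l0: False
              have "convp p l (n - j) \<le> C * real l * (4 * p n)" using False l l0 by (intro IH) auto
              also have "\<dots> \<le> C * real k * (4 * p n)" using l C10 pn by (intro mult_right_mono mult_left_mono) auto
              finally show ?thesis .
            qed
            hence "p j * convp p l (n - j) \<le> p j * (C * real k * (4 * p n))" using p_nonneg by (intro mult_left_mono) auto
            thus ?thesis using pn nn[of l "n - j"] by (simp add: mult_ac add_increasing)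
          qed
          have fin: "finite {j. j \<le> n \<and> real j > M}" by (rule finite_subset[of _ "{..n}"]) auto
          have "(\<Sum>j | j \<le> n \<and> real j > M. p j * convp p l (n - j)) 
             \<le> (\<Sum>j | j \<le> n \<and> real j > M. 4 * p n * convp p l (n - j) + C * real k * (4 * p n) * p j)"
            by (intro sum_mono term_le) auto
          also have "\<dots> = 4 * p n * (\<Sum>j | j \<le> n \<and> real j > M. convp p l (n - j)) + C * real k * (4 * p n) * (\<Sum>j | j \<le> n \<and> real j > M. p j)"
            by (simp add: sum.distrib sum_distrib_left)
          also have "(\<Sum>j | j \<le> n \<and> real j > M. convp p l (n - j)) \<le> 1"
          proof -
            have "(\<Sum>j | j \<le> n \<and> real j > M. convp p l (n - j)) \<le> (\<Sum>j\<le>n. convp p l (n - j))"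
              by (intro sum_mono2 nn) auto
            thus ?thesis using sum_convp_le_1[of l n] by (simp add: sum_convp_rev)
          qed
          also have "(\<Sum>j | j \<le> n \<and> real j > M. p j) = tail M - tail (real n)"
            using M n0 by (subst tail_diff) (auto intro!: sum.cong)
          finally show ?thesis using pn by simp
        qed
        have "convp p k n \<le> convp p' k n + real k * (\<Sum>j | j \<le> n \<and> real j > M. p j * convp p (k - 1) (n - j))"
          unfolding p'_def by (rule convp_split_jump) (rule p_nonneg)
        also have "\<dots> \<le> real k * p n + real k * (4 * p n + C * real k * (4 * p n) * (tail M - tail (real n)))"
          using part1 part2 l by (intro add_mono mult_left_mono) auto
        also have "\<dots> = real k * p n * (5 + 4 * C * (real k * (tail M - tail (real n))))"
          by (simp add: algebra_simps)
        also have "\<dots> \<le> real k * p n * (5 + 4 * C * (1/8))"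
        proof -
          have "tail M - tail (real n) \<le> tail (real n) / 72" using N(3)[OF nnN] by (simp add: M_def)
          hence "real k * (tail M - tail (real n)) \<le> real k * (tail (real n) / 72)" by (intro mult_left_mono) auto
          also have "\<dots> \<le> 1/8" using True by simp
          finally show ?thesis using pn C10 by (intro mult_left_mono add_mono) auto
        qed
        also have "\<dots> \<le> real k * p n * C" using C10 pn by (intro mult_left_mono) auto
        finally show ?thesis by (simp add: mult_ac)
      qed
    qed
  qed
  show ?thesis using claim N C10 by (intro exI[of _ C] exI[of _ N]) auto
qed

text \<open>One more halving, with the bound just proved as \<open>A\<close>, adds a factor that
  decays once \<open>k\<close> exceeds \<open>1 / tail n\<close>. It supplies the domination in the
  sum over \<open>k\<close>, for which the bound linear in \<open>k\<close> is too large because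
  \<open>k * q k\<close> is not summable.\<close>

lemma convp_local_decay:
  "\<exists>C N. C > 0 \<and> N \<ge> 1 \<and> (\<forall>n\<ge>N. p n > 0 \<and> (\<forall>k\<ge>1. convp p k n \<le> C * real k * p n * (1 - tail (real n)) ^ (k div 2)))"
proof -
  obtain C N1 where C: "C > 0" and N1: "N1 \<ge> 1" "\<And>n. n \<ge> N1 \<Longrightarrow> p n > 0"
     "\<And>n k. n \<ge> N1 \<Longrightarrow> k \<ge> 1 \<Longrightarrow> convp p k n \<le> C * real k * p n"
    using convp_local_bound by blast
  obtain N2 where N2: "\<And>n j. n \<ge> N2 \<Longrightarrow> n \<le> 2 * j \<Longrightarrow> j \<le> n \<Longrightarrow> p j \<le> 4 * p n"
    using p_near by (auto simp: eventually_sequentially)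
  define N where "N = max (2 * N1) N2"
  have "convp p k n \<le> 8 * C * real k * p n * (1 - tail (real n)) ^ (k div 2)" if n: "n \<ge> N" and k: "k \<ge> 1" for n k
  proof -
    let ?q = "1 - tail (real n)"
    have q: "0 \<le> ?q" "?q \<le> 1" using tail_le_1 tail_nonneg by auto
    have pn: "p n > 0" using n N1 by (auto simp: N_def)
    show ?thesis
    proof (cases "k = 1")
      case True
      have "convp p k n \<le> C * real k * p n" using n k by (intro N1) (auto simp: N_def)
      also have "\<dots> \<le> 8 * C * real k * p n" using C pn by (intro mult_right_mono) auto
      finally show ?thesis using True by simp
    next
      case False
      define k1 k2 where "k1 = k div 2" and "k2 = k - k div 2"
      have k12: "k = k1 + k2" "1 \<le> k1" "k1 \<le> k2" using k False by (auto simp: k1_def k2_def)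
      have "convp p (k1 + k2) n \<le> (C * real k * (4 * p n)) * (?q ^ k1 + ?q ^ k2)"
      proof (rule convp_halve)
        fix y assume y: "n \<le> 2 * y" "y \<le> n"
        have "convp p l y \<le> C * real k * (4 * p n)" if "l \<ge> 1" "l \<le> k" for l
        proof -
          have "convp p l y \<le> C * real l * p y" using that y n by (intro N1) (auto simp: N_def)
          also have "\<dots> \<le> C * real k * (4 * p n)" using that C y n p_nonneg by (intro mult_mono N2) (auto simp: N_def)
          finally show ?thesis .
        qed
        thus "convp p k1 y \<le> C * real k * (4 * p n) \<and> convp p k2 y \<le> C * real k * (4 * p n)"
          using k12 by auto
      qed (use C pn in auto)
      also have "\<dots> \<le> (C * real k * (4 * p n)) * (?q ^ k1 + ?q ^ k1)" 
        using q k12 C pn by (intro mult_left_mono add_mono power_decreasing) auto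
      finally have "convp p k n \<le> (C * real k * (4 * p n)) * (?q ^ k1 + ?q ^ k1)" using k12(1) by simp
      thus ?thesis by (simp add: k1_def)
    qed
  qed
  moreover have "p n > 0" if "n \<ge> N" for n using that N1 by (auto simp: N_def)
  moreover have "8 * C > 0" "N \<ge> 1" using C N1 by (auto simp: N_def)
  ultimately show ?thesis by blast
qed

end

lemma tendsto_one_minus_power:
  fixes x :: "nat \<Rightarrow> real" and m :: "nat \<Rightarrow> nat"
  assumes x_pos: "eventually (\<lambda>n. x n > 0) sequentially" and x_lim: "x \<longlonglongrightarrow> 0" 
    and mx: "(\<lambda>n. real (m n) * x n) \<longlonglongrightarrow> z"
  shows "(\<lambda>n. (1 - x n) ^ m n) \<longlonglongrightarrow> exp (- z)"
proof -
  have "((\<lambda>x::real. ln (1 - x) / x) \<longlongrightarrow> -1) (at_right 0)" by real_asymp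
  moreover have "filterlim x (at_right 0) sequentially"
    using x_lim x_pos by (auto simp: filterlim_at elim: eventually_mono)
  ultimately have "(\<lambda>n. ln (1 - x n) / x n) \<longlonglongrightarrow> -1" by (rule filterlim_compose)
  from tendsto_exp[OF tendsto_mult[OF mx this]]
  have "(\<lambda>n. exp (real (m n) * x n * (ln (1 - x n) / x n))) \<longlonglongrightarrow> exp (- z)" by simp
  moreover have "eventually (\<lambda>n. exp (real (m n) * x n * (ln (1 - x n) / x n)) = (1 - x n) ^ m n) sequentially"
    using x_pos order_tendstoD(2)[OF x_lim zero_less_one]
  proof eventually_elim
    case (elim n)
    have "exp (real (m n) * x n * (ln (1 - x n) / x n)) = exp (real (m n) * ln (1 - x n))" using elim by simp
    also have "\<dots> = (1 - x n) ^ m n" using elim by (simp add: exp_of_nat_mult)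
    finally show ?case .
  qed
  ultimately show ?thesis by (simp add: tendsto_cong)
qed

section \<open>Upper bound for the partition function\<close>

locale gibbs_big_jump = big_jump p \<gamma> for p \<gamma> +
  fixes q :: "nat \<Rightarrow> real" and Lv :: "real \<Rightarrow> real" and \<alpha> :: real
  assumes alpha: "\<alpha> > -1" and Lv: "slowly_varying Lv"
    and q_nonneg: "k \<ge> 1 \<Longrightarrow> q k \<ge> 0"
    and q_asymp: "q \<sim>[sequentially] (\<lambda>k. Lv (real k) * real k powr (\<alpha> - 1))"
begin

text \<open>\<open>Gamma (\<alpha> + 1) * p n * nrm n\<close> is the asymptotic size of \<open>partition_fun n\<close>; the number of summands is
  of order \<open>1 / tail n\<close>.\<close>

definition nrm :: "nat \<Rightarrow> real" where
  "nrm n = tail (real n) powr (- \<alpha> - 1) * Lv (1 / tail (real n))"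

definition partition_fun :: "nat \<Rightarrow> real" where
  "partition_fun n = (\<Sum>k. q (Suc k) * convp p (Suc k) n)"

text \<open>The extra factor \<open>k\<close> counts the positions of the big jump. It raises the
  exponent to \<open>\<alpha> > -1\<close>, the range of
  \<open>regular_weights_sum_asymp\<close>.\<close>

lemma weights_asymp: "(\<lambda>k. real k * q k) \<sim>[sequentially] (\<lambda>k. Lv (real k) * real k powr \<alpha>)"
proof -
  have 1: "(\<lambda>k. real k * q k) \<sim>[sequentially] (\<lambda>k. real k * (Lv (real k) * real k powr (\<alpha> - 1)))"
    by (intro asymp_equiv_intros q_asymp)
  have "eventually (\<lambda>k. real k * (Lv (real k) * real k powr (\<alpha> - 1)) = Lv (real k) * real k powr \<alpha>) sequentially"
    using eventually_gt_at_top[of 0] by eventually_elim (simp add: powr_diff)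
  from asymp_equiv_cong[OF _ this, of "\<lambda>k. real k * q k" "\<lambda>k. real k * q k"] 1 show ?thesis by simp
qed

lemma nrm_pos: "eventually (\<lambda>n. nrm n > 0) sequentially"
proof -
  have "filterlim (\<lambda>n. 1 / tail (real n)) at_top sequentially"
    using filterlim_inverse_at_top[OF tail_lim] tail_pos by (simp add: inverse_eq_divide)
  from eventually_compose_filterlim[OF slowly_varyingD(2)[OF Lv] this]
  show ?thesis
  proof eventually_elim
    case (elim n)
    thus ?case using tail_pos[of "real n"] by (simp add: nrm_def)
  qed
qed

text \<open>\<open>m\<close> falls short of \<open>k / 2\<close> by at most one, which costs the
  factor \<open>exp 1\<close> because \<open>tail\<close> is at most 1. The hypothesis admits both
  exponents in use, \<open>k - 1\<close> and \<open>(k - 1) div 2\<close>.\<close>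

lemma tail_power_le: 
  assumes "2 * m + 2 \<ge> k"
  shows "(1 - tail (real n)) ^ m \<le> exp 1 * exp (- (1/2) * (real k * tail (real n)))"
proof -
  have q: "0 \<le> 1 - tail (real n)" "1 - tail (real n) \<le> exp (- tail (real n))" 
    using tail_le_1 exp_ge_add_one_self[of "- tail (real n)"] by auto
  hence "(1 - tail (real n)) ^ m \<le> exp (- tail (real n)) ^ m" by (intro power_mono) auto
  also have "\<dots> = exp (- (real m * tail (real n)))" by (simp add: exp_of_nat_mult[symmetric])
  also have "\<dots> \<le> exp (1 + - (1/2) * (real k * tail (real n)))"
  proof -
    have "real k * tail (real n) \<le> (2 * real m + 2) * tail (real n)" using assms tail_nonneg by (intro mult_right_mono) auto
    also have "\<dots> \<le> 2 * (real m * tail (real n)) + 2" using tail_le_1[of "real n"] by (simp add: algebra_simps)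
    finally show ?thesis by simp
  qed
  finally show ?thesis by (simp add: exp_add[symmetric])
qed

lemma gibbs_sum_asymp:
  assumes "eventually (\<lambda>n. \<forall>k\<ge>1. \<bar>h n k\<bar> \<le> C * (1 + real k * tail (real n)) * exp (- (1/2) * (real k * tail (real n)))) sequentially"
    and "\<And>z. z > 0 \<Longrightarrow> (\<lambda>n. h n (nat \<lceil>z / tail (real n)\<rceil>)) \<longlonglongrightarrow> H z"
    and "H \<in> borel_measurable borel"
  shows "eventually (\<lambda>n. summable (\<lambda>k. real (Suc k) * q (Suc k) * h n (Suc k))) sequentially"
    and "(\<lambda>n. (\<Sum>k. real (Suc k) * q (Suc k) * h n (Suc k)) / nrm n) \<longlonglongrightarrow> (LINT z:{0<..}|lborel. z powr \<alpha> * H z)"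
proof -
  have tail: "eventually (\<lambda>n. tail (real n) > 0) sequentially" using tail_pos by simp
  note * = regular_weights_sum_asymp[OF Lv alpha weights_asymp tail tail_lim _ assms]
  show "eventually (\<lambda>n. summable (\<lambda>k. real (Suc k) * q (Suc k) * h n (Suc k))) sequentially"
    using *(1) by (auto elim!: eventually_mono dest!: summable_rabs_cancel)
  show "(\<lambda>n. (\<Sum>k. real (Suc k) * q (Suc k) * h n (Suc k)) / nrm n) \<longlonglongrightarrow> (LINT z:{0<..}|lborel. z powr \<alpha> * H z)"
    using *(3) unfolding nrm_def by simp
qed

lemma main_sum_asymp:
  "eventually (\<lambda>n. summable (\<lambda>k. real (Suc k) * q (Suc k) * (1 - tail (real n)) ^ k)) sequentially"
  "(\<lambda>n. (\<Sum>k. real (Suc k) * q (Suc k) * (1 - tail (real n)) ^ k) / nrm n) \<longlonglongrightarrow> Gamma (\<alpha> + 1)"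
proof -
  define h where "h n k = (1 - tail (real n)) ^ (k - 1)" for n k :: nat
  have q: "0 \<le> 1 - tail (real n)" for n :: nat using tail_le_1 by simp
  have b: "\<forall>\<^sub>F n in sequentially. \<forall>k\<ge>1. \<bar>h n k\<bar> \<le> exp 1 * (1 + real k * tail (real n)) * exp (- (1/2) * (real k * tail (real n)))"
  proof (intro always_eventually allI impI)
    fix n k :: nat assume "k \<ge> 1"
    have "\<bar>h n k\<bar> \<le> exp 1 * exp (- (1/2) * (real k * tail (real n)))"
      unfolding h_def using tail_power_le[of k "k - 1" n] q[of n] by simp
    also have "\<dots> \<le> exp 1 * (1 + real k * tail (real n)) * exp (- (1/2) * (real k * tail (real n)))"
      using tail_nonneg by (intro mult_right_mono) auto
    finally show "\<bar>h n k\<bar> \<le> exp 1 * (1 + real k * tail (real n)) * exp (- (1/2) * (real k * tail (real n)))" .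
  qed
  have l: "(\<lambda>n. h n (nat \<lceil>z / tail (real n)\<rceil>)) \<longlonglongrightarrow> exp (- z)" if "z > 0" for z
    unfolding h_def
  proof (rule tendsto_one_minus_power)
    show "(\<lambda>n. real (nat \<lceil>z / tail (real n)\<rceil> - 1) * tail (real n)) \<longlonglongrightarrow> z"
      by (rule tendsto_nat_ceiling_times(2)[OF _ tail_lim that]) (use tail_pos in simp)
  qed (use tail_pos tail_lim in auto)
  note * = gibbs_sum_asymp[where h = h and H = "\<lambda>z. exp (- z)" and C = "exp 1", OF b l]
  show "eventually (\<lambda>n. summable (\<lambda>k. real (Suc k) * q (Suc k) * (1 - tail (real n)) ^ k)) sequentially"
    using *(1) by (simp add: h_def)
  have "(LINT z:{0<..}|lborel. z powr \<alpha> * exp (- z)) = Gamma (\<alpha> + 1)"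
    using Gamma_has_bochner_integral[of "\<alpha> + 1"] alpha 
    by (simp add: set_lebesgue_integral_def has_bochner_integral_iff)
  thus "(\<lambda>n. (\<Sum>k. real (Suc k) * q (Suc k) * (1 - tail (real n)) ^ k) / nrm n) \<longlonglongrightarrow> Gamma (\<alpha> + 1)"
    using *(2) by (simp add: h_def)
qed

text \<open>The sum is at most of the order \<open>nrm n\<close> of the main sum. That suffices,
  since it will be multiplied by \<open>mean_upto n / tail n\<close>, which tends to 0.\<close>

lemma error_sum_asymp:
  "eventually (\<lambda>n. summable (\<lambda>k. real (Suc k) * q (Suc k) * (real (Suc k) * tail (real n) * (1 - tail (real n)) ^ (k div 2)))) sequentially"
  "\<exists>c. (\<lambda>n. (\<Sum>k. real (Suc k) * q (Suc k) * (real (Suc k) * tail (real n) * (1 - tail (real n)) ^ (k div 2))) / nrm n) \<longlonglongrightarrow> c"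
proof -
  define h where "h n k = real k * tail (real n) * (1 - tail (real n)) ^ ((k - 1) div 2)" for n k :: nat
  have q: "0 \<le> 1 - tail (real n)" for n :: nat using tail_le_1 by simp
  have b: "\<forall>\<^sub>F n in sequentially. \<forall>k\<ge>1. \<bar>h n k\<bar> \<le> exp 1 * (1 + real k * tail (real n)) * exp (- (1/2) * (real k * tail (real n)))"
  proof (intro always_eventually allI impI)
    fix n k :: nat assume "k \<ge> 1"
    have "\<bar>h n k\<bar> \<le> real k * tail (real n) * (exp 1 * exp (- (1/2) * (real k * tail (real n))))"
      unfolding h_def using tail_power_le[of k "(k - 1) div 2" n] q[of n] tail_nonneg[of "real n"] 
      by (simp add: abs_mult) (intro mult_left_mono, auto)
    also have "\<dots> \<le> (1 + real k * tail (real n)) * (exp 1 * exp (- (1/2) * (real k * tail (real n))))"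
      using tail_nonneg by (intro mult_right_mono) auto
    finally show "\<bar>h n k\<bar> \<le> exp 1 * (1 + real k * tail (real n)) * exp (- (1/2) * (real k * tail (real n)))" by (simp add: mult_ac)
  qed
  have l: "(\<lambda>n. h n (nat \<lceil>z / tail (real n)\<rceil>)) \<longlonglongrightarrow> z * exp (- (z/2))" if "z > 0" for z
    unfolding h_def
  proof (intro tendsto_mult tendsto_one_minus_power)
    have *: "eventually (\<lambda>n. tail (real n) > 0) sequentially" using tail_pos by simp
    show lim: "(\<lambda>n. real (nat \<lceil>z / tail (real n)\<rceil>) * tail (real n)) \<longlonglongrightarrow> z"
      by (rule tendsto_nat_ceiling_times(1)[OF * tail_lim that])
    show "(\<lambda>n. real ((nat \<lceil>z / tail (real n)\<rceil> - 1) div 2) * tail (real n)) \<longlonglongrightarrow> z / 2"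
    proof (rule tendsto_sandwich)
      have half: "real k / 2 - 1 \<le> real ((k - 1) div 2)" "real ((k - 1) div 2) \<le> real k / 2" for k :: nat
        by linarith+
      show "\<forall>\<^sub>F n in sequentially. real (nat \<lceil>z / tail (real n)\<rceil>) * tail (real n) / 2 - tail (real n) \<le> real ((nat \<lceil>z / tail (real n)\<rceil> - 1) div 2) * tail (real n)"
        using mult_right_mono[OF half(1) tail_nonneg] by (intro always_eventually allI) (simp add: left_diff_distrib)
      show "\<forall>\<^sub>F n in sequentially. real ((nat \<lceil>z / tail (real n)\<rceil> - 1) div 2) * tail (real n) \<le> real (nat \<lceil>z / tail (real n)\<rceil>) * tail (real n) / 2"
        using mult_right_mono[OF half(2) tail_nonneg] by (intro always_eventually allI) simp
      show "(\<lambda>n. real (nat \<lceil>z / tail (real n)\<rceil>) * tail (real n) / 2) \<longlonglongrightarrow> z / 2"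
        by (intro tendsto_divide lim tendsto_const) simp
      show "(\<lambda>n. real (nat \<lceil>z / tail (real n)\<rceil>) * tail (real n) / 2 - tail (real n)) \<longlonglongrightarrow> z / 2"
        using tendsto_diff[OF tendsto_divide[OF lim tendsto_const[of 2]] tail_lim] by simp
    qed
  qed (use tail_pos tail_lim in auto)
  note * = gibbs_sum_asymp[where h = h and H = "\<lambda>z. z * exp (- (z/2))" and C = "exp 1", OF b l]
  show "eventually (\<lambda>n. summable (\<lambda>k. real (Suc k) * q (Suc k) * (real (Suc k) * tail (real n) * (1 - tail (real n)) ^ (k div 2)))) sequentially"
    using *(1) by (simp add: h_def)
  show "\<exists>c. (\<lambda>n. (\<Sum>k. real (Suc k) * q (Suc k) * (real (Suc k) * tail (real n) * (1 - tail (real n)) ^ (k div 2))) / nrm n) \<longlonglongrightarrow> c"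
    using *(2) by (auto simp: h_def)
qed

text \<open>In the size-bias identity a summand \<open>j \<ge> n/2\<close> has
  \<open>j * p j \<le> (1 + e) * (n * p n)\<close>, and the others only have to stay at most
  \<open>n\<close>, hence the power \<open>k\<close>. For \<open>j < n/2\<close> the others must
  exceed \<open>n/2\<close>; this costs a factor of order \<open>k * p n\<close> and leaves the
  truncated mean of \<open>j\<close>.\<close>

lemma convp_upper:
  assumes e: "e > 0"
  shows "\<exists>C>0. \<exists>N. \<forall>n\<ge>N. \<forall>k. convp p (Suc k) n \<le> real (Suc k) * p n * 
     ((1 + e) * (1 - tail (real n)) ^ k + C * (mean_upto n / tail (real n)) * (real (Suc k) * tail (real n) * (1 - tail (real n)) ^ (k div 2)))"
proof -
  have nn: "convp p k n \<ge> 0" for k n by (rule convp_nonneg) (rule p_nonneg)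
  obtain C N1 where C: "C > 0" and N1: "N1 \<ge> 1" "\<And>n. n \<ge> N1 \<Longrightarrow> p n > 0"
    "\<And>n k. n \<ge> N1 \<Longrightarrow> k \<ge> 1 \<Longrightarrow> convp p k n \<le> C * real k * p n * (1 - tail (real n)) ^ (k div 2)"
    using convp_local_decay by blast
  obtain N2 where N2: "\<And>n j. n \<ge> N2 \<Longrightarrow> n \<le> 2 * j \<Longrightarrow> j \<le> n \<Longrightarrow> p j \<le> 4 * p n"
    using p_near by (auto simp: eventually_sequentially)
  obtain N3 where N3: "\<And>n j. n \<ge> N3 \<Longrightarrow> n \<le> 2 * j \<Longrightarrow> j \<le> n \<Longrightarrow> \<bar>real j * p j - real n * p n\<bar> \<le> e * (real n * p n)"
    using p_local[OF e] by (auto simp: eventually_sequentially)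
  define N where "N = max (2 * N1) (max N2 N3)"
  have "convp p (Suc k) n \<le> real (Suc k) * p n * 
     ((1 + e) * (1 - tail (real n)) ^ k + 4 * C * (mean_upto n / tail (real n)) * (real (Suc k) * tail (real n) * (1 - tail (real n)) ^ (k div 2)))"
    if n: "n \<ge> N" for n k
  proof -
    have n0: "n > 0" using n N1 by (auto simp: N_def)
    let ?q = "1 - tail (real n)"
    \<comment> \<open>A bound for the other summands at \<open>n - j > n/2\<close>, where
      \<open>p (n - j) \<le> 4 * p n\<close> and \<open>tail (n - j) \<ge> tail n\<close>.\<close>
    let ?A = "4 * C * real (Suc k) * p n * ?q ^ (k div 2)"
    have pn: "p n > 0" using n N1 by (auto simp: N_def)
    have q: "0 \<le> ?q" "?q \<le> 1" using tail_le_1 tail_nonneg by auto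
    have A0: "?A \<ge> 0" using C pn q by simp
    have "real j * p j * convp p k (n - j) \<le> (1 + e) * (real n * p n) * convp p k (n - j) + real j * p j * ?A" if j: "j \<le> n" for j
    proof (cases "n \<le> 2 * j")
      case True
      have "real j * p j \<le> (1 + e) * (real n * p n)" using N3[of n j] True j n by (simp add: N_def algebra_simps)
      hence "real j * p j * convp p k (n - j) \<le> (1 + e) * (real n * p n) * convp p k (n - j)" using nn by (intro mult_right_mono)
      moreover have "real j * p j * ?A \<ge> 0" using mult_nonneg_nonneg[OF _ p_nonneg[of j], of "real j"] A0
        by (intro mult_nonneg_nonneg[OF _ A0]) auto
      ultimately show ?thesis by linarith
    next
      case False
      have "convp p k (n - j) \<le> ?A"
      proof (cases "k = 0")
        case True
        thus ?thesis using False C pn by (simp add: convp_0)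
      next
        case k: False
        have "convp p k (n - j) \<le> C * real k * p (n - j) * (1 - tail (real (n - j))) ^ (k div 2)"
          using False k n by (intro N1) (auto simp: N_def)
        also have "\<dots> \<le> C * real (Suc k) * (4 * p n) * ?q ^ (k div 2)"
          using C False n p_nonneg q tail_le_1 tail_antimono[of "real (n - j)" "real n"]
          by (intro mult_mono power_mono N2 mult_nonneg_nonneg zero_le_power) (auto simp: N_def)
        finally show ?thesis by (simp add: mult_ac)
      qed
      hence "real j * p j * convp p k (n - j) \<le> real j * p j * ?A" using p_nonneg by (intro mult_left_mono) auto
      moreover have "(1 + e) * (real n * p n) * convp p k (n - j) \<ge> 0" using e pn nn by (intro mult_nonneg_nonneg) auto
      ultimately show ?thesis by linarith
    qed
    hence "(\<Sum>j\<le>n. real j * p j * convp p k (n - j)) \<le> (\<Sum>j\<le>n. (1 + e) * (real n * p n) * convp p k (n - j) + real j * p j * ?A)"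
      by (intro sum_mono) auto
    also have "\<dots> = (1 + e) * (real n * p n) * (\<Sum>j\<le>n. convp p k (n - j)) + (\<Sum>j\<le>n. real j * p j) * ?A"
      by (simp only: sum.distrib sum_distrib_left sum_distrib_right)
    also have "\<dots> \<le> (1 + e) * (real n * p n) * ?q ^ k + (real n * mean_upto n) * ?A"
    proof (intro add_mono mult_left_mono)
      have "real n * mean_upto n = (\<Sum>j\<le>n. real j * p j)" using n0 by (simp add: mean_upto_def)
      thus "(\<Sum>j\<le>n. real j * p j) * ?A \<le> (real n * mean_upto n) * ?A" by simp
    qed (use e pn in \<open>auto simp: sum_convp_rev sum_convp_tail\<close>)
    finally have "real n * convp p (Suc k) n \<le> real (Suc k) * ((1 + e) * (real n * p n) * ?q ^ k + (real n * mean_upto n) * ?A)"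
      unfolding convp_size_bias by (intro mult_left_mono) auto
    also have "\<dots> = real n * (real (Suc k) * p n * ((1 + e) * ?q ^ k + 4 * C * (mean_upto n / tail (real n)) * (real (Suc k) * tail (real n) * ?q ^ (k div 2))))"
      using tail_pos[of "real n"] by (simp add: field_simps)
    finally show ?thesis using n0 by (simp only: mult_le_cancel_left_pos of_nat_0_less_iff)
  qed
  thus ?thesis using C by (intro exI[of _ "4 * C"] conjI exI[of _ N]) auto
qed

text \<open>Summability belongs to the conclusion because the value of the series is meaningful only
  together with it.\<close>

proposition partition_fun_upper:
  assumes e: "e > 0"
  shows "eventually (\<lambda>n. summable (\<lambda>k. q (Suc k) * convp p (Suc k) n) \<and> 
     partition_fun n \<le> (Gamma (\<alpha> + 1) + e) * p n * nrm n) sequentially"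
proof -
  have nn: "convp p k n \<ge> 0" for k n by (rule convp_nonneg) (rule p_nonneg)
  have G: "Gamma (\<alpha> + 1) > 0" using alpha by (intro Gamma_real_pos) auto
  \<comment> \<open>With this \<open>d\<close> the main term is
    \<open>Gamma (\<alpha> + 1) + e/2\<close>; the other half of \<open>e\<close> absorbs the
    vanishing error term.\<close>
  define d where "d = e / (2 * Gamma (\<alpha> + 1))"
  have d: "d > 0" using e G by (simp add: d_def)
  define A where "A n = (\<Sum>k. real (Suc k) * q (Suc k) * (1 - tail (real n)) ^ k)" for n
  define E where "E n = (\<Sum>k. real (Suc k) * q (Suc k) * (real (Suc k) * tail (real n) * (1 - tail (real n)) ^ (k div 2)))" for n
  obtain C N where C: "C > 0" and up: "\<And>n k. n \<ge> N \<Longrightarrow> convp p (Suc k) n \<le> real (Suc k) * p n * 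
     ((1 + d) * (1 - tail (real n)) ^ k + C * (mean_upto n / tail (real n)) * (real (Suc k) * tail (real n) * (1 - tail (real n)) ^ (k div 2)))"
    using convp_upper[OF d] by blast
  obtain c where c: "(\<lambda>n. E n / nrm n) \<longlonglongrightarrow> c" using error_sum_asymp(2) by (auto simp: E_def)
  have "(\<lambda>n. (1 + d) * (A n / nrm n) + C * (mean_upto n / tail (real n)) * (E n / nrm n)) \<longlonglongrightarrow> (1 + d) * Gamma (\<alpha> + 1) + C * 0 * c"
    using main_sum_asymp(2) unfolding A_def[symmetric] by (intro tendsto_intros c mean_upto_small)
  moreover have "(1 + d) * Gamma (\<alpha> + 1) + C * 0 * c < Gamma (\<alpha> + 1) + e"
    using G e by (simp add: d_def field_simps)
  ultimately have "eventually (\<lambda>n. (1 + d) * (A n / nrm n) + C * (mean_upto n / tail (real n)) * (E n / nrm n) < Gamma (\<alpha> + 1) + e) sequentially"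
    by (rule order_tendstoD(2))
  thus ?thesis using main_sum_asymp(1) error_sum_asymp(1) nrm_pos eventually_ge_at_top[of N]
  proof eventually_elim
    case (elim n)
    let ?a = "\<lambda>k. real (Suc k) * q (Suc k) * (1 - tail (real n)) ^ k"
    let ?b = "\<lambda>k. real (Suc k) * q (Suc k) * (real (Suc k) * tail (real n) * (1 - tail (real n)) ^ (k div 2))"
    let ?g = "\<lambda>k. p n * ((1 + d) * ?a k + C * (mean_upto n / tail (real n)) * ?b k)"
    have le: "q (Suc k) * convp p (Suc k) n \<le> ?g k" for k
    proof -
      have "q (Suc k) * convp p (Suc k) n \<le> q (Suc k) * (real (Suc k) * p n * 
     ((1 + d) * (1 - tail (real n)) ^ k + C * (mean_upto n / tail (real n)) * (real (Suc k) * tail (real n) * (1 - tail (real n)) ^ (k div 2))))"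
        using q_nonneg[of "Suc k"] up[OF elim(5)] by (intro mult_left_mono) auto
      also have "\<dots> = ?g k" by (simp add: algebra_simps)
      finally show ?thesis .
    qed
    have g: "?g sums (p n * ((1 + d) * A n + C * (mean_upto n / tail (real n)) * E n))"
      unfolding A_def E_def using elim(2,3) by (intro sums_mult sums_add summable_sums)
    have summ: "summable (\<lambda>k. q (Suc k) * convp p (Suc k) n)"
      by (rule summable_comparison_test'[OF sums_summable[OF g]]) (use le nn q_nonneg in auto)
    have "partition_fun n \<le> p n * ((1 + d) * A n + C * (mean_upto n / tail (real n)) * E n)"
      unfolding partition_fun_def sums_unique[OF g] by (intro suminf_le le summ sums_summable[OF g])
    also have "\<dots> = p n * (((1 + d) * (A n / nrm n) + C * (mean_upto n / tail (real n)) * (E n / nrm n)) * nrm n)"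
      using elim(4) by (simp add: field_simps)
    also have "\<dots> \<le> p n * ((Gamma (\<alpha> + 1) + e) * nrm n)"
      using elim p_nonneg by (intro mult_left_mono mult_right_mono) auto
    finally show ?case using summ by (simp add: mult_ac)
  qed
qed

end

section \<open>Multinomial counts and the insertion of a big summand\<close>

text \<open>The multinomial probability, with a remaining class of weight
  \<open>\<beta>\<^sub>0\<close>. The weights may add up to less than 1: for summands restricted to
  values up to \<open>n\<close> the missing mass is \<open>tail n\<close>.\<close>

definition multinom :: "nat \<Rightarrow> (nat \<Rightarrow> real) \<Rightarrow> real \<Rightarrow> nat \<Rightarrow> (nat \<Rightarrow> nat) \<Rightarrow> real" where
  "multinom r \<beta> \<beta>\<^sub>0 n m = (if (\<Sum>i<r. m i) \<le> n then 
     fact n / fact (n - (\<Sum>i<r. m i)) * (\<Prod>i<r. \<beta> i ^ m i / fact (m i)) * \<beta>\<^sub>0 ^ (n - (\<Sum>i<r. m i)) else 0)"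

lemma multinom_0: "multinom r \<beta> \<beta>\<^sub>0 0 m = (if \<forall>i<r. m i = 0 then 1 else 0)"
  by (auto simp: multinom_def)

text \<open>Condition on the cell of the last draw.\<close>

lemma multinom_Suc:
  "multinom r \<beta> \<beta>\<^sub>0 (Suc n) m = \<beta>\<^sub>0 * multinom r \<beta> \<beta>\<^sub>0 n m 
    + (\<Sum>i<r. if m i > 0 then \<beta> i * multinom r \<beta> \<beta>\<^sub>0 n (m(i := m i - 1)) else 0)"
proof -
  define S where "S = (\<Sum>i<r. m i)"
  define P where "P m = (\<Prod>i<r. \<beta> i ^ m i / fact (m i))" for m :: "nat \<Rightarrow> nat"
  have sum_upd: "(\<Sum>j<r. (m(i := m i - 1)) j) = S - 1" if "i < r" "m i > 0" for i
  proof -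
    have "S = m i + (\<Sum>j\<in>{..<r} - {i}. m j)" unfolding S_def using that by (intro sum.remove) auto
    moreover have "(\<Sum>j<r. (m(i := m i - 1)) j) = (m i - 1) + (\<Sum>j\<in>{..<r} - {i}. (m(i := m i - 1)) j)"
      using that by (subst sum.remove[of _ i]) auto
    moreover have "(\<Sum>j\<in>{..<r} - {i}. (m(i := m i - 1)) j) = (\<Sum>j\<in>{..<r} - {i}. m j)" by (intro sum.cong) auto
    ultimately show ?thesis using that by simp
  qed
  have P_upd: "\<beta> i * P (m(i := m i - 1)) = real (m i) * P m" if "i < r" "m i > 0" for i
  proof -
    have "P m = \<beta> i ^ m i / fact (m i) * (\<Prod>j\<in>{..<r} - {i}. \<beta> j ^ m j / fact (m j))"
      unfolding P_def using that by (intro prod.remove) auto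
    moreover have "P (m(i := m i - 1)) = \<beta> i ^ (m i - 1) / fact (m i - 1) * (\<Prod>j\<in>{..<r} - {i}. (\<beta> j ^ (m(i := m i - 1)) j / fact ((m(i := m i - 1)) j)))"
      unfolding P_def using that by (subst prod.remove[of _ i]) auto
    moreover have "(\<Prod>j\<in>{..<r} - {i}. (\<beta> j ^ (m(i := m i - 1)) j / fact ((m(i := m i - 1)) j))) = (\<Prod>j\<in>{..<r} - {i}. \<beta> j ^ m j / fact (m j))"
      by (intro prod.cong) auto
    moreover have "\<beta> i * (\<beta> i ^ (m i - 1) / fact (m i - 1)) = real (m i) * (\<beta> i ^ m i / fact (m i))"
      using that by (cases "m i") (auto simp del: of_nat_Suc)
    ultimately show ?thesis by (simp only: mult.assoc[symmetric])
  qed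
  have mSn: "S \<ge> 1" if "i < r" "m i > 0" for i
    using member_le_sum[of i "{..<r}" m] that by (simp add: S_def)
  show ?thesis
  proof (cases "S \<le> Suc n")
    case True
    have 1: "\<beta>\<^sub>0 * multinom r \<beta> \<beta>\<^sub>0 n m = real (Suc n - S) * (fact n / fact (Suc n - S) * P m * \<beta>\<^sub>0 ^ (Suc n - S))"
    proof (cases "S \<le> n")
      case True
      hence "Suc n - S = Suc (n - S)" by simp
      thus ?thesis using True by (simp add: multinom_def S_def[symmetric] P_def[symmetric] del: of_nat_Suc)
    next
      case False
      thus ?thesis using \<open>S \<le> Suc n\<close> by (simp add: multinom_def S_def[symmetric])
    qed
    have 2: "(if m i > 0 then \<beta> i * multinom r \<beta> \<beta>\<^sub>0 n (m(i := m i - 1)) else 0) 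
         = real (m i) * (fact n / fact (Suc n - S) * P m * \<beta>\<^sub>0 ^ (Suc n - S))" if "i < r" for i
    proof (cases "m i > 0")
      case m: True
      have le: "S - 1 \<le> n" "n - (S - 1) = Suc n - S" using True mSn[OF that m] by auto
      have "multinom r \<beta> \<beta>\<^sub>0 n (m(i := m i - 1)) = fact n / fact (Suc n - S) * P (m(i := m i - 1)) * \<beta>\<^sub>0 ^ (Suc n - S)"
        unfolding multinom_def sum_upd[OF that m] P_def using le by simp
      hence "\<beta> i * multinom r \<beta> \<beta>\<^sub>0 n (m(i := m i - 1)) = fact n / fact (Suc n - S) * (\<beta> i * P (m(i := m i - 1))) * \<beta>\<^sub>0 ^ (Suc n - S)"
        by simp
      thus ?thesis using m unfolding P_upd[OF that m] by simp
    qed simp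
    have "(\<Sum>i<r. if m i > 0 then \<beta> i * multinom r \<beta> \<beta>\<^sub>0 n (m(i := m i - 1)) else 0) 
       = (\<Sum>i<r. real (m i) * (fact n / fact (Suc n - S) * P m * \<beta>\<^sub>0 ^ (Suc n - S)))"
      by (intro sum.cong refl 2) auto
    also have "\<dots> = real S * (fact n / fact (Suc n - S) * P m * \<beta>\<^sub>0 ^ (Suc n - S))"
      unfolding S_def of_nat_sum by (rule sum_distrib_right[symmetric])
    finally have 3: "\<beta>\<^sub>0 * multinom r \<beta> \<beta>\<^sub>0 n m + (\<Sum>i<r. if m i > 0 then \<beta> i * multinom r \<beta> \<beta>\<^sub>0 n (m(i := m i - 1)) else 0) 
       = (real (Suc n - S) + real S) * (fact n / fact (Suc n - S) * P m * \<beta>\<^sub>0 ^ (Suc n - S))"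
      unfolding 1 by (simp only: distrib_right)
    have "real (Suc n - S) + real S = real (Suc n)" using True by simp
    thus ?thesis unfolding 3 using True by (simp add: multinom_def S_def[symmetric] P_def[symmetric])
  next
    case False
    have z: "multinom r \<beta> \<beta>\<^sub>0 n (m(i := m i - 1)) = 0" if "i < r" "m i > 0" for i
      unfolding multinom_def sum_upd[OF that] using False by simp
    have "(\<Sum>i<r. if m i > 0 then \<beta> i * multinom r \<beta> \<beta>\<^sub>0 n (m(i := m i - 1)) else 0) = 0"
      using z by (intro sum.neutral ballI) (auto simp del: One_nat_def)
    moreover have "multinom r \<beta> \<beta>\<^sub>0 n m = 0" "multinom r \<beta> \<beta>\<^sub>0 (Suc n) m = 0"
      using False by (auto simp: multinom_def S_def[symmetric])
    ultimately show ?thesis by simp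
  qed
qed

text \<open>Counts of independent draws satisfy this recursion. It identifies their law both for
  finite words and for infinite sequences of points, without enumerating arrangements.\<close>

lemma multinom_unique:
  assumes "\<And>m. g 0 m = (if \<forall>i<r. m i = 0 then 1 else 0)"
    and "\<And>n m. g (Suc n) m = \<beta>\<^sub>0 * g n m + (\<Sum>i<r. if m i > 0 then \<beta> i * g n (m(i := m i - 1)) else 0)"
  shows "g n m = multinom r \<beta> \<beta>\<^sub>0 n m"
  by (induction n arbitrary: m) (simp_all add: assms multinom_0 multinom_Suc cong: if_cong)

lemma falling_fact_asymp:
  assumes "filterlim k at_top sequentially"
  shows "(\<lambda>n. (fact (k n) / fact (k n - S)) / real (k n) ^ S) \<longlonglongrightarrow> (1::real)"
proof (induction S)
  case 0
  show ?case by simp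
next
  case (Suc S)
  have ev: "eventually (\<lambda>n. k n \<ge> Suc (Suc S)) sequentially" using assms by (simp add: filterlim_at_top)
  have "(\<lambda>x. (real x - real S) / real x) \<longlonglongrightarrow> 1" by real_asymp
  hence "(\<lambda>n. (real (k n) - real S) / real (k n)) \<longlonglongrightarrow> 1" by (rule filterlim_compose[OF _ assms])
  from tendsto_mult[OF Suc this]
  have "(\<lambda>n. (fact (k n) / fact (k n - S)) / real (k n) ^ S * ((real (k n) - real S) / real (k n))) \<longlonglongrightarrow> 1" by simp
  moreover have "eventually (\<lambda>n. (fact (k n) / fact (k n - S)) / real (k n) ^ S * ((real (k n) - real S) / real (k n)) 
      = (fact (k n) / fact (k n - Suc S)) / real (k n) ^ Suc S) sequentially"
    using ev
  proof eventually_elim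
    case (elim n)
    hence "k n - S = Suc (k n - Suc S)" by simp
    hence "(fact (k n - S) :: real) = (real (k n) - real S) * fact (k n - Suc S)" 
      using elim by (simp add: of_nat_diff)
    moreover define x where "x = real (k n) - real S"
    ultimately have F: "(fact (k n - S) :: real) = x * fact (k n - Suc S)" by (simp only: x_def)
    have "x \<noteq> 0" using elim by (simp add: x_def)
    thus ?case unfolding F x_def[symmetric] by simp
  qed
  ultimately show ?case by (simp add: tendsto_cong)
qed

text \<open>The Poisson limit of multinomial counts. The constant \<open>c\<close> is not tied to
  the rates \<open>l i\<close>: in the application it exceeds their sum by \<open>z\<close>, because
  draws above \<open>n\<close> are excluded.\<close>

lemma multinom_tendsto:
  fixes k :: "nat \<Rightarrow> nat" and \<beta> :: "nat \<Rightarrow> nat \<Rightarrow> real"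
  assumes k: "filterlim k at_top sequentially"
    and \<beta>: "\<And>i. i < r \<Longrightarrow> (\<lambda>n. real (k n) * \<beta> n i) \<longlonglongrightarrow> l i"
    and b0: "(\<lambda>n. real (k n) * b n) \<longlonglongrightarrow> c" "b \<longlonglongrightarrow> 0" "eventually (\<lambda>n. b n > 0) sequentially"
  shows "(\<lambda>n. multinom r (\<beta> n) (1 - b n) (k n) m) \<longlonglongrightarrow> exp (- c) * (\<Prod>i<r. l i ^ m i / fact (m i))"
proof -
  define S where "S = (\<Sum>i<r. m i)"
  have "(\<lambda>n. real (k n - S) * b n) \<longlonglongrightarrow> c - real S * 0"
  proof -
    have "(\<lambda>n. real (k n) * b n - real S * b n) \<longlonglongrightarrow> c - real S * 0"
      by (intro tendsto_intros b0)
    moreover have "eventually (\<lambda>n. real (k n) * b n - real S * b n = real (k n - S) * b n) sequentially"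
    proof -
      have "eventually (\<lambda>n. k n \<ge> S) sequentially" using k by (simp add: filterlim_at_top)
      thus ?thesis by eventually_elim (simp add: of_nat_diff left_diff_distrib)
    qed
    ultimately show ?thesis by (simp add: tendsto_cong)
  qed
  hence pow: "(\<lambda>n. (1 - b n) ^ (k n - S)) \<longlonglongrightarrow> exp (- c)"
    using tendsto_one_minus_power[OF b0(3,2)] by simp
  have pr: "(\<lambda>n. \<Prod>i<r. (real (k n) * \<beta> n i) ^ m i / fact (m i)) \<longlonglongrightarrow> (\<Prod>i<r. l i ^ m i / fact (m i))"
    by (intro tendsto_prod tendsto_divide tendsto_power \<beta>) auto
  have "(\<lambda>n. (fact (k n) / fact (k n - S)) / real (k n) ^ S * (\<Prod>i<r. (real (k n) * \<beta> n i) ^ m i / fact (m i)) * (1 - b n) ^ (k n - S)) 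
       \<longlonglongrightarrow> 1 * (\<Prod>i<r. l i ^ m i / fact (m i)) * exp (- c)"
    by (intro tendsto_mult falling_fact_asymp k pr pow)
  moreover have "eventually (\<lambda>n. (fact (k n) / fact (k n - S)) / real (k n) ^ S * (\<Prod>i<r. (real (k n) * \<beta> n i) ^ m i / fact (m i)) * (1 - b n) ^ (k n - S)
       = multinom r (\<beta> n) (1 - b n) (k n) m) sequentially"
  proof -
    have "eventually (\<lambda>n. k n \<ge> Suc S) sequentially" using k by (simp add: filterlim_at_top)
    thus ?thesis
    proof eventually_elim
      case (elim n)
      have "(\<Prod>i<r. (real (k n) * \<beta> n i) ^ m i / fact (m i)) = (\<Prod>i<r. real (k n) ^ m i * (\<beta> n i ^ m i / fact (m i)))"
        by (intro prod.cong) (auto simp: power_mult_distrib)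
      also have "\<dots> = real (k n) ^ S * (\<Prod>i<r. \<beta> n i ^ m i / fact (m i))"
        by (simp only: prod.distrib S_def power_sum)
      finally show ?case using elim by (simp add: multinom_def S_def[symmetric])
    qed
  qed
  ultimately show ?thesis by (simp add: tendsto_cong mult.commute)
qed

section \<open>Words with prescribed letter counts\<close>

definition words :: "nat set \<Rightarrow> nat \<Rightarrow> nat list set" where
  "words A k = {x. length x = k \<and> set x \<subseteq> A}"

lemma finite_words: "finite A \<Longrightarrow> finite (words A k)"
  unfolding words_def using finite_lists_length_eq[of A k] by (simp add: conj_commute)

lemma words_0: "words A 0 = {[]}"
  by (auto simp: words_def)

lemma words_Suc: "words A (Suc k) = (\<lambda>(j, x). j # x) ` (A \<times> words A k)"
  by (auto simp: words_def image_iff length_Suc_conv)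

lemma sum_words_Suc:
  fixes f :: "nat list \<Rightarrow> real"
  shows "(\<Sum>x\<in>words A (Suc k). f x) = (\<Sum>j\<in>A. \<Sum>x\<in>words A k. f (j # x))"
proof -
  have "(\<Sum>x\<in>words A (Suc k). f x) = (\<Sum>(j, x)\<in>A \<times> words A k. f (j # x))"
    unfolding words_Suc by (subst sum.reindex) (auto simp: inj_on_def case_prod_beta)
  thus ?thesis by (simp add: sum.cartesian_product)
qed

lemma sum_words_prod: "(\<Sum>x\<in>words A k. prod_list (map p x)) = (\<Sum>j\<in>A. p j :: real) ^ k"
  by (induction k) (auto simp: words_0 sum_words_Suc sum_distrib_right simp flip: sum_distrib_left)

text \<open>Linearity of expectation for a law of mass at most 1; the letters not being averaged
  contribute a factor at most 1, hence the inequality.\<close>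

lemma sum_words_sum_list:
  fixes p :: "nat \<Rightarrow> real"
  assumes "\<And>j. p j \<ge> 0" "(\<Sum>j\<in>A. p j) \<le> 1"
  shows "(\<Sum>x\<in>words A k. real (sum_list x) * prod_list (map p x)) \<le> real k * (\<Sum>j\<in>A. real j * p j)"
proof (induction k)
  case 0
  show ?case by (simp add: words_0)
next
  case (Suc k)
  let ?W = "\<Sum>x\<in>words A k. real (sum_list x) * prod_list (map p x)"
  have W0: "?W \<ge> 0" using assms(1) by (intro sum_nonneg mult_nonneg_nonneg prod_list_nonneg) auto
  have M0: "(\<Sum>j\<in>A. real j * p j) \<ge> 0" "(\<Sum>j\<in>A. p j) \<ge> 0" using assms(1) by (auto intro!: sum_nonneg)
  have "(\<Sum>x\<in>words A (Suc k). real (sum_list x) * prod_list (map p x)) 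
      = (\<Sum>j\<in>A. \<Sum>x\<in>words A k. real j * p j * prod_list (map p x) + p j * (real (sum_list x) * prod_list (map p x)))"
    unfolding sum_words_Suc by (intro sum.cong refl) (simp add: algebra_simps)
  also have "\<dots> = (\<Sum>j\<in>A. real j * p j) * (\<Sum>j\<in>A. p j) ^ k + (\<Sum>j\<in>A. p j) * ?W"
    by (simp add: sum.distrib sum_words_prod sum_distrib_right flip: sum_distrib_left)
  also have "\<dots> \<le> (\<Sum>j\<in>A. real j * p j) * 1 + 1 * ?W"
    using M0 W0 assms by (intro add_mono mult_left_mono mult_right_mono power_le_one) auto
  finally show ?case using Suc by (simp add: algebra_simps)
qed

text \<open>Conditioning on the first letter gives the recursion of \<open>multinom\<close>: a
  letter in cell \<open>i\<close> lowers the required count \<open>m i\<close> by one.\<close>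

lemma sum_words_counts:
  fixes p :: "nat \<Rightarrow> real" and c :: "nat \<Rightarrow> nat set"
  assumes A: "finite A" and c: "\<And>i. i < r \<Longrightarrow> c i \<subseteq> A" and disj: "disjoint_family_on c {..<r}"
  shows "(\<Sum>x | x \<in> words A k \<and> (\<forall>i<r. length (filter (\<lambda>j. j \<in> c i) x) = m i). prod_list (map p x))
    = multinom r (\<lambda>i. \<Sum>j\<in>c i. p j) (\<Sum>j\<in>A - (\<Union>i<r. c i). p j) k m"
proof -
  define cn where "cn i x = length (filter (\<lambda>j. j \<in> c i) x)" for i and x :: "nat list"
  define g where "g k m = (\<Sum>x\<in>words A k. if \<forall>i<r. cn i x = m i then prod_list (map p x) else 0)" for k and m :: "nat \<Rightarrow> nat"
  have "g k m = multinom r (\<lambda>i. \<Sum>j\<in>c i. p j) (\<Sum>j\<in>A - (\<Union>i<r. c i). p j) k m"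
  proof (rule multinom_unique)
    show "g 0 m = (if \<forall>i<r. m i = 0 then 1 else 0)" for m
      unfolding g_def words_0 by (auto simp: cn_def)
    fix k m
    have split: "A = (A - (\<Union>i<r. c i)) \<union> (\<Union>i<r. c i)" using c by auto
    have fin: "finite (c i)" if "i < r" for i using c[OF that] A by (rule finite_subset)
    have out: "(\<Sum>x\<in>words A k. if \<forall>i<r. cn i (j # x) = m i then prod_list (map p (j # x)) else 0) = p j * g k m"
      if "j \<in> A - (\<Union>i<r. c i)" for j
    proof -
      have "cn i (j # x) = cn i x" if "i < r" for i x using that \<open>j \<in> _\<close> by (auto simp: cn_def)
      thus ?thesis by (auto simp: g_def sum_distrib_left intro!: sum.cong)
    qed
    have inn: "(\<Sum>x\<in>words A k. if \<forall>i<r. cn i (j # x) = m i then prod_list (map p (j # x)) else 0) 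
       = (if m i > 0 then p j * g k (m(i := m i - 1)) else 0)"
      if i: "i < r" and j: "j \<in> c i" for i j
    proof -
      have cnj: "cn l (j # x) = (if l = i then Suc (cn l x) else cn l x)" if "l < r" for l x
        using disj i j that by (auto simp: cn_def disjoint_family_on_def)
      have iff: "(\<forall>l<r. cn l (j # x) = m l) \<longleftrightarrow> m i > 0 \<and> (\<forall>l<r. cn l x = (m(i := m i - 1)) l)" for x
      proof
        assume a: "\<forall>l<r. cn l (j # x) = m l"
        have "m i = Suc (cn i x)" using a[rule_format, of i] cnj[of i x] i by simp
        moreover have "cn l x = m l" if "l < r" "l \<noteq> i" for l using a cnj[of l x] that by auto
        ultimately show "m i > 0 \<and> (\<forall>l<r. cn l x = (m(i := m i - 1)) l)" by auto
      next
        assume b: "m i > 0 \<and> (\<forall>l<r. cn l x = (m(i := m i - 1)) l)"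
        show "\<forall>l<r. cn l (j # x) = m l"
        proof (intro allI impI)
          fix l assume "l < r"
          thus "cn l (j # x) = m l" using b cnj[of l x] by (cases "l = i") auto
        qed
      qed
      show ?thesis unfolding iff by (auto simp: g_def sum_distrib_left intro!: sum.cong)
    qed
    have "g (Suc k) m = (\<Sum>j\<in>A. \<Sum>x\<in>words A k. if \<forall>i<r. cn i (j # x) = m i then prod_list (map p (j # x)) else 0)"
      unfolding g_def sum_words_Suc ..
    also have "\<dots> = (\<Sum>j\<in>A - (\<Union>i<r. c i). p j * g k m) + (\<Sum>j\<in>(\<Union>i<r. c i). \<Sum>x\<in>words A k. if \<forall>i<r. cn i (j # x) = m i then prod_list (map p (j # x)) else 0)"
      by (subst split, subst sum.union_disjoint) (use A fin out in auto)
    also have "(\<Sum>j\<in>(\<Union>i<r. c i). \<Sum>x\<in>words A k. if \<forall>i<r. cn i (j # x) = m i then prod_list (map p (j # x)) else 0)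
      = (\<Sum>i<r. \<Sum>j\<in>c i. \<Sum>x\<in>words A k. if \<forall>i<r. cn i (j # x) = m i then prod_list (map p (j # x)) else 0)"
      using fin disj by (intro sum.UNION_disjoint) (auto simp: disjoint_family_on_def)
    also have "\<dots> = (\<Sum>i<r. \<Sum>j\<in>c i. if m i > 0 then p j * g k (m(i := m i - 1)) else 0)"
      using inn by (intro sum.cong refl) auto
    also have "\<dots> = (\<Sum>i<r. if m i > 0 then (\<Sum>j\<in>c i. p j) * g k (m(i := m i - 1)) else 0)"
      by (intro sum.cong refl) (auto simp: sum_distrib_right)
    finally show "g (Suc k) m = (\<Sum>j\<in>A - (\<Union>i<r. c i). p j) * g k m + (\<Sum>i<r. if m i > 0 then (\<Sum>j\<in>c i. p j) * g k (m(i := m i - 1)) else 0)"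
      by (simp add: sum_distrib_right)
  qed
  moreover have "g k m = (\<Sum>x | x \<in> words A k \<and> (\<forall>i<r. cn i x = m i). prod_list (map p x))"
    unfolding g_def using finite_words[OF A] by (subst sum.inter_filter[symmetric]) auto
  ultimately show ?thesis by (simp add: cn_def)
qed

lemma sort_insert_max:
  fixes xs ys :: "nat list"
  assumes "\<And>y. y \<in> set xs \<Longrightarrow> y \<le> b" "mset ys = add_mset b (mset xs)"
  shows "sort ys = sort xs @ [b]"
proof (rule properties_for_sort)
  show "mset (sort xs @ [b]) = mset ys" using assms(2) by simp
  show "sorted (sort xs @ [b])" using assms(1) by (simp add: sorted_append)
qed

lemma length_filter_mset: "length (filter P xs) = size (filter_mset P (mset xs))"
  by (metis mset_filter size_mset)

text \<open>The big summand \<open>n - sum_list x\<close> is inserted at one of the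
  \<open>Suc k\<close> positions of a short word. As \<open>2 * sum_list x < n\<close>, it exceeds
  \<open>n/2\<close>. It is thus the unique largest entry, which \<open>pp_points\<close> drops, and
  its position can be read off, so no composition arises twice.\<close>

lemma sum_compositions_ge_insert:
  fixes p :: "nat \<Rightarrow> real" and B :: "nat \<Rightarrow> real set"
  assumes p: "\<And>j. p j \<ge> 0"
  shows "real (Suc k) * (\<Sum>x | x \<in> words {..n} k \<and> 2 * sum_list x < n \<and> 
       (\<forall>i<r. length (filter (\<lambda>j. 1 < j \<and> ln (real j) / ln (real n) \<in> B i) x) = m i). 
         p (n - sum_list x) * prod_list (map p x))
    \<le> (\<Sum>ks | ks \<in> comps (Suc k) n \<and> (\<forall>i<r. length (filter (\<lambda>y. y \<in> B i) (pp_points n ks)) = m i). 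
         prod_list (map p ks))"
proof -
  define X where "X = {x. x \<in> words {..n} k \<and> 2 * sum_list x < n \<and> 
       (\<forall>i<r. length (filter (\<lambda>j. 1 < j \<and> ln (real j) / ln (real n) \<in> B i) x) = m i)}"
  define Y where "Y = {ks. ks \<in> comps (Suc k) n \<and> (\<forall>i<r. length (filter (\<lambda>y. y \<in> B i) (pp_points n ks)) = m i)}"
  define \<phi> where "\<phi> = (\<lambda>(i, x). take i x @ [n - sum_list x] @ drop i x)"
  have len: "length x = k" if "x \<in> X" for x using that by (auto simp: X_def words_def)
  have mset_phi: "mset (\<phi> (i, x)) = add_mset (n - sum_list x) (mset x)" for i x
  proof -
    have "mset x = mset (take i x) + mset (drop i x)" unfolding mset_append[symmetric] append_take_drop_id ..
    thus ?thesis by (simp add: \<phi>_def)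
  qed
  have elem_small: "2 * y < n" if "x \<in> X" "y \<in> set x" for x y
    using member_le_sum_list[of y x] that by (auto simp: X_def)
  have big: "2 * (n - sum_list x) > n" if "x \<in> X" for x using that by (auto simp: X_def)
  have phi_Y: "\<phi> (i, x) \<in> Y" if "i \<le> k" and x: "x \<in> X" for i x
  proof -
    have "sum_list (\<phi> (i, x)) = n"
    proof -
      have "sum_list (\<phi> (i, x)) = sum_mset (mset (\<phi> (i, x)))" by (rule sum_mset_sum_list[symmetric])
      also have "\<dots> = (n - sum_list x) + sum_list x" unfolding mset_phi by (simp add: sum_mset_sum_list)
      finally show ?thesis using x by (simp add: X_def)
    qed
    moreover have "length (\<phi> (i, x)) = Suc k" using len[OF x] that by (simp add: \<phi>_def)
    moreover have "length (filter (\<lambda>y. y \<in> B l) (pp_points n (\<phi> (i, x)))) = m l" if "l < r" for l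
    proof -
      have "sort (\<phi> (i, x)) = sort x @ [n - sum_list x]"
        using elem_small[OF x] big[OF x] by (intro sort_insert_max mset_phi) fastforce
      hence "pp_points n (\<phi> (i, x)) = map (\<lambda>k. ln (real k) / ln (real n)) (filter (\<lambda>k. k > 1) (rev (sort x)))"
        by (simp add: pp_points_def)
      hence "length (filter (\<lambda>y. y \<in> B l) (pp_points n (\<phi> (i, x)))) = length (filter (\<lambda>j. 1 < j \<and> ln (real j) / ln (real n) \<in> B l) (rev (sort x)))"
        by (simp add: filter_map o_def conj_commute)
      also have "\<dots> = length (filter (\<lambda>j. 1 < j \<and> ln (real j) / ln (real n) \<in> B l) x)"
        unfolding length_filter_mset by simp
      finally show ?thesis using x that by (simp add: X_def)
    qed
    ultimately show ?thesis by (simp add: Y_def comps_def)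
  qed
  have inj: "inj_on \<phi> ({..k} \<times> X)"
  proof (rule inj_onI)
    fix z z' assume z: "z \<in> {..k} \<times> X" and z': "z' \<in> {..k} \<times> X" and eqz: "\<phi> z = \<phi> z'"
    obtain i x j y where zx: "z = (i, x)" "z' = (j, y)" by (metis surj_pair)
    have i: "i \<in> {..k}" "x \<in> X" and j: "j \<in> {..k}" "y \<in> X" and eq: "\<phi> (i, x) = \<phi> (j, y)"
      using z z' eqz by (auto simp: zx)
    have nth: "\<phi> (i, x) ! l = (if l < i then x ! l else if l = i then n - sum_list x else x ! (l - 1))" 
      if "i \<le> k" "x \<in> X" "l \<le> k" for i x l
      using that len[OF that(2)] by (auto simp: \<phi>_def nth_append nth_Cons' min_def)
    have bigi: "2 * (\<phi> (i, x) ! l) > n \<longleftrightarrow> l = i" if "i \<le> k" "x \<in> X" "l \<le> k" for i x l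
    proof -
      have "2 * (x ! l') < n" if "l' < k" for l' using elem_small[OF \<open>x \<in> X\<close>, of "x ! l'"] len[OF \<open>x \<in> X\<close>] that by simp
      thus ?thesis unfolding nth[OF that] using that big[OF that(2)] by (auto simp: not_less less_imp_le)
    qed
    have "i = j" using bigi[of i x i] bigi[of j y i] i j eq by auto
    have rem: "take i (\<phi> (i, x)) @ drop (Suc i) (\<phi> (i, x)) = x" if "i \<le> k" "x \<in> X" for i x
      using that len[OF that(2)] by (simp add: \<phi>_def min_def)
    have "x = take i (\<phi> (i, x)) @ drop (Suc i) (\<phi> (i, x))" using rem[of i x] i by simp
    also have "\<dots> = take j (\<phi> (j, y)) @ drop (Suc j) (\<phi> (j, y))" unfolding eq by (simp only: \<open>i = j\<close>)
    also have "\<dots> = y" using rem[of j y] j by simp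
    finally have "x = y" .
    thus "z = z'" using \<open>i = j\<close> by (simp add: zx)
  qed
  have prod_phi: "prod_list (map p (\<phi> (i, x))) = p (n - sum_list x) * prod_list (map p x)" for i x
  proof -
    have "prod_list (map p (\<phi> (i, x))) = prod_mset (image_mset p (mset (\<phi> (i, x))))"
      by (simp add: prod_mset_prod_list[symmetric])
    thus ?thesis unfolding mset_phi by (simp add: prod_mset_prod_list[symmetric])
  qed
  have "real (Suc k) * (\<Sum>x\<in>X. p (n - sum_list x) * prod_list (map p x)) = (\<Sum>i\<in>{..k}. \<Sum>x\<in>X. p (n - sum_list x) * prod_list (map p x))"
    by simp
  also have "\<dots> = (\<Sum>i\<in>{..k}. \<Sum>x\<in>X. prod_list (map p (\<phi> (i, x))))"
    by (simp only: prod_phi)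
  also have "\<dots> = (\<Sum>z\<in>{..k} \<times> X. prod_list (map p (\<phi> z)))"
    by (subst sum.cartesian_product) (simp add: case_prod_beta)
  also have "\<dots> = (\<Sum>ks\<in>\<phi> ` ({..k} \<times> X). prod_list (map p ks))"
    by (simp add: sum.reindex[OF inj])
  also have "\<dots> \<le> (\<Sum>ks\<in>Y. prod_list (map p ks))"
  proof (rule sum_mono2)
    show "finite Y" unfolding Y_def using finite_comps[of "Suc k" n] by (rule rev_finite_subset) auto
    show "\<phi> ` ({..k} \<times> X) \<subseteq> Y" using phi_Y by auto
  qed (auto intro!: prod_list_nonneg p)
  finally show ?thesis by (simp add: X_def Y_def)
qed

text \<open>Compositions may contain any number of zeros, so the sum is infinite; its terms are
  nonnegative and may be grouped by length into finite sums.\<close>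

lemma infsum_all_comps:
  fixes f :: "nat list \<Rightarrow> real"
  assumes f: "\<And>ks. ks \<in> all_comps n \<Longrightarrow> f ks \<ge> 0"
    and summ: "summable (\<lambda>k. \<Sum>ks | ks \<in> comps (Suc k) n \<and> Q ks. f ks)"
  shows "f summable_on {ks\<in>all_comps n. Q ks}" 
    and "infsum f {ks\<in>all_comps n. Q ks} = (\<Sum>k. \<Sum>ks | ks \<in> comps (Suc k) n \<and> Q ks. f ks)"
proof -
  define c where "c k = (\<Sum>ks | ks \<in> comps (Suc k) n \<and> Q ks. f ks)" for k
  have sub: "{ks. ks \<in> comps (Suc k) n \<and> Q ks} \<subseteq> {ks\<in>all_comps n. Q ks}" for k
    by (auto simp: comps_def all_comps_def)
  have fin: "finite {ks. ks \<in> comps (Suc k) n \<and> Q ks}" for k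
    using finite_comps[of "Suc k" n] by (rule rev_finite_subset) auto
  have c0: "c k \<ge> 0" for k unfolding c_def using sub f by (intro sum_nonneg) auto
  have summ': "summable c" using summ by (simp add: c_def[abs_def])
  have part: "(\<Sum>k<K. c k) = sum f (\<Union>k<K. {ks. ks \<in> comps (Suc k) n \<and> Q ks})" for K
    unfolding c_def by (rule sum.UNION_disjoint[symmetric, OF _ ballI[OF fin]]) (auto simp: comps_def)
  have bound: "sum f F \<le> suminf c" if F: "finite F" "F \<subseteq> {ks\<in>all_comps n. Q ks}" for F
  proof -
    define K where "K = Suc (Max (insert 0 (length ` F)))"
    have "length ks < K" if "ks \<in> F" for ks
      unfolding K_def using F(1) that by (auto intro!: le_imp_less_Suc Max_ge)
    have "F \<subseteq> (\<Union>k<K. {ks. ks \<in> comps (Suc k) n \<and> Q ks})"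
    proof
      fix ks assume ks: "ks \<in> F"
      hence "ks \<noteq> []" "sum_list ks = n" "Q ks" using F by (auto simp: all_comps_def)
      then obtain l where l: "length ks = Suc l" by (cases ks) auto
      have "l < K" using \<open>\<And>ks. ks \<in> F \<Longrightarrow> length ks < K\<close>[OF ks] l by simp
      thus "ks \<in> (\<Union>k<K. {ks. ks \<in> comps (Suc k) n \<and> Q ks})" using l \<open>sum_list ks = n\<close> \<open>Q ks\<close> by (auto simp: comps_def)
    qed
    hence "sum f F \<le> sum f (\<Union>k<K. {ks. ks \<in> comps (Suc k) n \<and> Q ks})"
      using sub f by (intro sum_mono2) (auto intro!: fin dest!: subsetD[OF sub])
    also have "\<dots> = (\<Sum>k<K. c k)" by (rule part[symmetric])
    also have "\<dots> \<le> suminf c" by (rule sum_le_suminf[OF summ']) (use c0 in auto)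
    finally show ?thesis .
  qed
  show s: "f summable_on {ks\<in>all_comps n. Q ks}"
    using f bound by (intro nonneg_bdd_above_summable_on) (auto intro!: bdd_aboveI[of _ "suminf c"])
  show "infsum f {ks\<in>all_comps n. Q ks} = (\<Sum>k. \<Sum>ks | ks \<in> comps (Suc k) n \<and> Q ks. f ks)"
    unfolding c_def[symmetric]
  proof (rule antisym)
    show "infsum f {ks\<in>all_comps n. Q ks} \<le> suminf c"
      by (rule infsum_le_finite_sums[OF s bound])
    show "suminf c \<le> infsum f {ks\<in>all_comps n. Q ks}"
    proof (rule suminf_le_const[OF summ'])
      fix K
      show "sum c {..<K} \<le> infsum f {ks\<in>all_comps n. Q ks}"
        unfolding part using sub f by (intro finite_sum_le_infsum[OF s]) (auto intro!: fin dest!: subsetD[OF sub])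
    qed
  qed
qed

section \<open>Cell counts of the Gibbs partition\<close>

text \<open>The offset \<open>Suc i\<close> starts the cells at \<open>1 / R\<close>. Those with
  \<open>i < R - 1\<close> partition the points above \<open>1 / R\<close> and up to 1, away from 0,
  where the limit may accumulate infinitely many points.\<close>

definition cell :: "nat \<Rightarrow> nat \<Rightarrow> real set" where
  "cell R i = {real (Suc i) / real R <.. real (Suc (Suc i)) / real R}"

lemma cell_disjoint: "i \<noteq> j \<Longrightarrow> cell R i \<inter> cell R j = {}"
proof -
  have "\<not> (x \<in> cell R i \<and> x \<in> cell R j)" if "i < j" for i j x
  proof -
    have "real (Suc (Suc i)) / real R \<le> real (Suc j) / real R" using that by (intro divide_right_mono) auto
    thus ?thesis by (auto simp: cell_def)
  qed
  thus "i \<noteq> j \<Longrightarrow> cell R i \<inter> cell R j = {}" by (meson disjoint_iff linorder_neqE_nat)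
qed

definition cell_counts :: "nat \<Rightarrow> nat \<Rightarrow> nat list \<Rightarrow> nat \<Rightarrow> nat" where
  "cell_counts R n ks i = length (filter (\<lambda>y. y \<in> cell R i) (pp_points n ks))"

context gibbs_big_jump
begin

text \<open>The Gibbs probability in tilted form, with the law \<open>p\<close> for \<open>w\<close>
  and the weights \<open>q\<close> for \<open>v\<close>; the tilting factors cancel against the
  partition function.\<close>

definition gibbs_weight :: "nat \<Rightarrow> nat list \<Rightarrow> real" where
  "gibbs_weight n ks = q (length ks) * prod_list (map p ks) / partition_fun n"

lemma p_prod_nonneg: "prod_list (map p ks) \<ge> 0"
  by (intro prod_list_nonneg) (auto simp: p_nonneg)

lemma tail_ratio': "0 < t \<Longrightarrow> t \<le> 1 \<Longrightarrow> (\<lambda>n. tail (real n powr t) / tail (real n)) \<longlonglongrightarrow> t powr (-\<gamma>)"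
proof (cases "t = 1")
  case True
  have "tail (real n powr 1) / tail (real n) = 1" for n using tail_pos[of "real n"] by simp
  thus ?thesis using True by simp
qed (use tail_ratio in auto)

definition cellset :: "nat \<Rightarrow> nat \<Rightarrow> nat \<Rightarrow> nat set" where
  "cellset R n i = {j. 1 < j \<and> ln (real j) / ln (real n) \<in> cell R i}"

lemma cellset_eq:
  assumes "n \<ge> 2" "R \<ge> 1"
  shows "cellset R n i = {j. real n powr (real (Suc i) / real R) < real j \<and> real j \<le> real n powr (real (Suc (Suc i)) / real R)}"
proof -
  have ln_n: "ln (real n) > 0" using assms by simp
  have iff: "real n powr t < real j \<longleftrightarrow> t < ln (real j) / ln (real n)" "real j \<le> real n powr t \<longleftrightarrow> ln (real j) / ln (real n) \<le> t"
    if "j > 1" for t and j :: nat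
  proof -
    have "real n powr t < real j \<longleftrightarrow> ln (real n powr t) < ln (real j)" using that assms by (subst ln_less_cancel_iff) auto
    thus "real n powr t < real j \<longleftrightarrow> t < ln (real j) / ln (real n)" using ln_n assms by (simp add: ln_powr field_simps)
    have "real j \<le> real n powr t \<longleftrightarrow> ln (real j) \<le> ln (real n powr t)" using that assms by (subst ln_le_cancel_iff) auto
    thus "real j \<le> real n powr t \<longleftrightarrow> ln (real j) / ln (real n) \<le> t" using ln_n assms by (simp add: ln_powr field_simps)
  qed
  have "j > 1" if "real n powr (real (Suc i) / real R) < real j" for j
  proof -
    have "1 \<le> real n powr (real (Suc i) / real R)" using assms by (intro ge_one_powr_ge_zero) auto
    thus ?thesis using that by linarith
  qed
  thus ?thesis using iff by (auto simp: cellset_def cell_def)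
qed

lemma sum_cellset:
  assumes "n \<ge> 2" "R \<ge> 1"
  shows "(\<Sum>j\<in>cellset R n i. p j) = tail (real n powr (real (Suc i) / real R)) - tail (real n powr (real (Suc (Suc i)) / real R))"
  unfolding cellset_eq[OF assms] using assms
  by (subst tail_diff) (auto intro!: powr_mono divide_right_mono)

lemma cellset_subset: "n \<ge> 2 \<Longrightarrow> R \<ge> 1 \<Longrightarrow> i < R - 1 \<Longrightarrow> cellset R n i \<subseteq> {..n}"
proof
  fix j assume a: "n \<ge> 2" "R \<ge> 1" "i < R - 1" "j \<in> cellset R n i"
  have "real j \<le> real n powr (real (Suc (Suc i)) / real R)" using a by (simp add: cellset_eq)
  also have "\<dots> \<le> real n powr 1" using a by (intro powr_mono) (auto simp: field_simps)
  finally show "j \<in> {..n}" using a by simp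
qed

lemma cellset_disjoint: "disjoint_family_on (cellset R n) I"
  using cell_disjoint[of _ _ R] by (fastforce simp: disjoint_family_on_def cellset_def)

text \<open>The cell masses telescope, so what remains is the mass of the values up to
  \<open>n powr (1 / R)\<close>.\<close>

lemma sum_outside_cells:
  assumes n: "n \<ge> 2" and R: "R \<ge> 2"
  shows "(\<Sum>j\<in>{..n} - (\<Union>i<R-1. cellset R n i). p j) = 1 - tail (real n powr (1 / real R))"
proof -
  have R1: "R \<ge> 1" using R by simp
  have U: "(\<Union>i<R-1. cellset R n i) \<subseteq> {..n}" using cellset_subset[OF n R1] by auto
  have "(\<Sum>j\<in>(\<Union>i<R-1. cellset R n i). p j) = (\<Sum>i<R-1. \<Sum>j\<in>cellset R n i. p j)"
    using cellset_disjoint[of R n "{..<R-1}"] cellset_subset[OF n R1] finite_subset[of _ "{..n}"]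
    by (intro sum.UNION_disjoint) (auto simp: disjoint_family_on_def)
  also have "\<dots> = (\<Sum>i<R-1. tail (real n powr (real (Suc i) / real R)) - tail (real n powr (real (Suc (Suc i)) / real R)))"
    by (simp add: sum_cellset[OF n R1])
  also have "\<dots> = tail (real n powr (real (Suc 0) / real R)) - tail (real n powr (real (Suc (R - 1)) / real R))"
    by (rule sum_lessThan_telescope')
  also have "real (Suc (R - 1)) / real R = 1" using R by simp
  finally have "(\<Sum>j\<in>(\<Union>i<R-1. cellset R n i). p j) = tail (real n powr (1 / real R)) - tail (real n)" using n by simp
  moreover have "(\<Sum>j\<le>n. p j) = (\<Sum>j\<in>{..n} - (\<Union>i<R-1. cellset R n i). p j) + (\<Sum>j\<in>(\<Union>i<R-1. cellset R n i). p j)"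
    using U by (intro sum.subset_diff) auto
  ultimately show ?thesis using tail_nat[of n] by simp
qed

text \<open>The probability that \<open>k\<close> independent summands are all at most
  \<open>n\<close> and have cell counts \<open>m\<close>; the remaining class of
  \<open>multinom\<close> consists of the values up to \<open>n powr (1 / R)\<close>.\<close>

definition cell_mult :: "nat \<Rightarrow> (nat \<Rightarrow> nat) \<Rightarrow> nat \<Rightarrow> nat \<Rightarrow> real" where
  "cell_mult R m n k = multinom (R - 1) (\<lambda>i. \<Sum>j\<in>cellset R n i. p j) (1 - tail (real n powr (1 / real R))) k m"

lemma words_cells_eq:
  assumes n: "n \<ge> 2" and R: "R \<ge> 2"
  shows "(\<Sum>x | x \<in> words {..n} k \<and> (\<forall>i<R-1. length (filter (\<lambda>j. j \<in> cellset R n i) x) = m i). prod_list (map p x)) = cell_mult R m n k"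
  unfolding cell_mult_def sum_outside_cells[OF n R, symmetric]
  using cellset_subset[OF n] R cellset_disjoint by (intro sum_words_counts) auto

lemma cell_mult_bounds:
  assumes n: "n \<ge> 2" and R: "R \<ge> 2"
  shows "0 \<le> cell_mult R m n k" "cell_mult R m n k \<le> (1 - tail (real n)) ^ k"
proof -
  show "0 \<le> cell_mult R m n k" unfolding words_cells_eq[OF assms, symmetric]
    by (intro sum_nonneg p_prod_nonneg)
  have "cell_mult R m n k \<le> (\<Sum>x\<in>words {..n} k. prod_list (map p x))"
    unfolding words_cells_eq[OF assms, symmetric]
    by (intro sum_mono2 finite_words p_prod_nonneg) auto
  thus "cell_mult R m n k \<le> (1 - tail (real n)) ^ k" by (simp add: sum_words_prod tail_nat)
qed

text \<open>Markov's inequality discards the words with sum at least \<open>n/2\<close> at the price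
  \<open>2 * k * mean_upto n\<close>. For the others the inserted summand lies between
  \<open>n/2\<close> and \<open>n\<close>, where \<open>near\<close> bounds \<open>p\<close> below
  by \<open>(1 - e) * p n\<close>; there are \<open>Suc k\<close> places for it.\<close>

lemma comps_cells_ge:
  assumes n: "n \<ge> 2" and R: "R \<ge> 2" and e: "0 \<le> e" "e < 1"
    and near: "\<And>j. n \<le> 2 * j \<Longrightarrow> j \<le> n \<Longrightarrow> \<bar>real j * p j - real n * p n\<bar> \<le> e * (real n * p n)"
  shows "real (Suc k) * ((1 - e) * p n * (cell_mult R m n k - 2 * real k * mean_upto n))
     \<le> (\<Sum>ks | ks \<in> comps (Suc k) n \<and> (\<forall>i<R-1. cell_counts R n ks i = m i). prod_list (map p ks))"
proof -
  have n0: "real n > 0" using n by simp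
  define G where "G = {x. x \<in> words {..n} k \<and> (\<forall>i<R-1. length (filter (\<lambda>j. j \<in> cellset R n i) x) = m i)}"
  have finG: "finite G" unfolding G_def using finite_words[of "{..n}" k] by (rule rev_finite_subset) auto
  have pm: "p (n - s) \<ge> (1 - e) * p n" if "2 * s < n" for s
  proof -
    have "n \<le> 2 * (n - s)" using that by linarith
    hence "\<bar>real (n - s) * p (n - s) - real n * p n\<bar> \<le> e * (real n * p n)" by (rule near) simp
    hence "(1 - e) * (real n * p n) \<le> real (n - s) * p (n - s)" unfolding left_diff_distrib by linarith
    also have "\<dots> \<le> real n * p (n - s)" using p_nonneg by (intro mult_right_mono) auto
    finally have "real n * ((1 - e) * p n) \<le> real n * p (n - s)" by (simp add: mult_ac)
    thus ?thesis using n0 by (simp only: mult_le_cancel_left_pos)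
  qed
  have "cell_mult R m n k - 2 * real k * mean_upto n \<le> (\<Sum>x | x \<in> G \<and> 2 * sum_list x < n. prod_list (map p x))"
  proof -
    have "cell_mult R m n k = (\<Sum>x\<in>G. prod_list (map p x))"
      using words_cells_eq[OF n R, of k m] by (simp add: G_def)
    also have "\<dots> \<le> (\<Sum>x\<in>G. (if 2 * sum_list x < n then prod_list (map p x) else 0) + 2 / real n * (real (sum_list x) * prod_list (map p x)))"
    proof (rule sum_mono)
      fix x assume "x \<in> G"
      show "prod_list (map p x) \<le> (if 2 * sum_list x < n then prod_list (map p x) else 0) + 2 / real n * (real (sum_list x) * prod_list (map p x))"
      proof (cases "2 * sum_list x < n")
        case True
        thus ?thesis using p_prod_nonneg[of x] by simp
      next
        case False
        hence "real n \<le> 2 * real (sum_list x)" by linarith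
        hence "1 * prod_list (map p x) \<le> (2 / real n * real (sum_list x)) * prod_list (map p x)"
          using p_prod_nonneg n0 by (intro mult_right_mono) (auto simp: field_simps)
        thus ?thesis using False by simp
      qed
    qed
    also have "\<dots> = (\<Sum>x | x \<in> G \<and> 2 * sum_list x < n. prod_list (map p x)) + 2 / real n * (\<Sum>x\<in>G. real (sum_list x) * prod_list (map p x))"
      using finG by (simp add: sum.distrib sum_distrib_left sum.inter_filter)
    also have "(\<Sum>x\<in>G. real (sum_list x) * prod_list (map p x)) \<le> (\<Sum>x\<in>words {..n} k. real (sum_list x) * prod_list (map p x))"
      using p_prod_nonneg by (intro sum_mono2 finite_words mult_nonneg_nonneg) (auto simp: G_def)
    also have "\<dots> \<le> real k * (\<Sum>j\<le>n. real j * p j)"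
      using p_nonneg tail_nat[of n] tail_nonneg[of "real n"] by (intro sum_words_sum_list) auto
    finally have "cell_mult R m n k \<le> (\<Sum>x | x \<in> G \<and> 2 * sum_list x < n. prod_list (map p x)) + 2 / real n * (real k * (\<Sum>j\<le>n. real j * p j))"
      by (simp add: mult_left_mono divide_right_mono)
    thus ?thesis by (simp add: mean_upto_def)
  qed
  hence "(1 - e) * p n * (cell_mult R m n k - 2 * real k * mean_upto n) \<le> (1 - e) * p n * (\<Sum>x | x \<in> G \<and> 2 * sum_list x < n. prod_list (map p x))"
    using e p_nonneg by (intro mult_left_mono mult_nonneg_nonneg) auto
  also have "\<dots> = (\<Sum>x | x \<in> G \<and> 2 * sum_list x < n. ((1 - e) * p n) * prod_list (map p x))"
    by (rule sum_distrib_left)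
  also have "\<dots> \<le> (\<Sum>x | x \<in> G \<and> 2 * sum_list x < n. p (n - sum_list x) * prod_list (map p x))"
    using pm by (intro sum_mono mult_right_mono p_prod_nonneg) auto
  also have "{x. x \<in> G \<and> 2 * sum_list x < n} = {x. x \<in> words {..n} k \<and> 2 * sum_list x < n \<and> 
       (\<forall>i<R-1. length (filter (\<lambda>j. 1 < j \<and> ln (real j) / ln (real n) \<in> cell R i) x) = m i)}"
    by (auto simp: G_def cellset_def)
  finally have "real (Suc k) * ((1 - e) * p n * (cell_mult R m n k - 2 * real k * mean_upto n)) \<le> real (Suc k) * (\<Sum>x | x \<in> words {..n} k \<and> 2 * sum_list x < n \<and> 
       (\<forall>i<R-1. length (filter (\<lambda>j. 1 < j \<and> ln (real j) / ln (real n) \<in> cell R i) x) = m i). p (n - sum_list x) * prod_list (map p x))"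
    by (intro mult_left_mono) auto
  also have "\<dots> \<le> (\<Sum>ks | ks \<in> comps (Suc k) n \<and> (\<forall>i<R-1. length (filter (\<lambda>y. y \<in> cell R i) (pp_points n ks)) = m i). prod_list (map p ks))"
    by (rule sum_compositions_ge_insert) (rule p_nonneg)
  finally show ?thesis by (simp add: cell_counts_def)
qed

text \<open>The probability that the Cox process has \<open>m i\<close> points in cell \<open>i\<close> for all \<open>i\<close>.\<close>

definition mixed_prob :: "nat \<Rightarrow> (nat \<Rightarrow> nat) \<Rightarrow> real" where
  "mixed_prob R m = (LINT z:{0<..}|lborel. z powr \<alpha> * (exp (- z) * 
     (\<Prod>i<R-1. poisson_pmf_real (z * ((real (Suc i) / real R) powr (-\<gamma>) - (real (Suc (Suc i)) / real R) powr (-\<gamma>))) (m i)))) / Gamma (\<alpha> + 1)"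

text \<open>The rates of the cells telescope to \<open>z * (R powr \<gamma> - 1)\<close>, whereas
  avoiding all values above \<open>n powr (1 / R)\<close> has the exponent
  \<open>- z * R powr \<gamma>\<close>. The surplus \<open>exp (- z)\<close> is the price for having
  no other summand above \<open>n\<close>; it becomes the exponential of the Gamma density.\<close>

lemma cell_mult_tendsto:
  assumes R: "R \<ge> 2" and z: "z > 0"
  shows "(\<lambda>n. cell_mult R m n (nat \<lceil>z / tail (real n)\<rceil> - 1)) \<longlonglongrightarrow> exp (- z) * 
     (\<Prod>i<R-1. poisson_pmf_real (z * ((real (Suc i) / real R) powr (-\<gamma>) - (real (Suc (Suc i)) / real R) powr (-\<gamma>))) (m i))"
proof -
  define k where "k n = nat \<lceil>z / tail (real n)\<rceil> - 1" for n
  define l where "l i = (real (Suc i) / real R) powr (-\<gamma>) - (real (Suc (Suc i)) / real R) powr (-\<gamma>)" for i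
  have k_tail: "(\<lambda>n. real (k n) * tail (real n)) \<longlonglongrightarrow> z"
    unfolding k_def by (rule tendsto_nat_ceiling_times(2)[OF _ tail_lim z]) (use tail_pos in simp)
  have k_top: "filterlim k at_top sequentially"
  proof -
    have "filterlim (\<lambda>n. inverse (tail (real n))) at_top sequentially"
      using filterlim_inverse_at_top[OF tail_lim] tail_pos by simp
    from filterlim_tendsto_pos_mult_at_top[OF k_tail z this]
    have "filterlim (\<lambda>n. real (k n) * tail (real n) * inverse (tail (real n))) at_top sequentially" .
    moreover have "real (k n) * tail (real n) * inverse (tail (real n)) = real (k n)" for n using tail_pos[of "real n"] by simp
    ultimately have "filterlim (\<lambda>n. real (k n)) at_top sequentially" by simp
    thus ?thesis using filterlim_sequentially_iff_filterlim_real by blast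
  qed
  have k_t: "(\<lambda>n. real (k n) * tail (real n powr t)) \<longlonglongrightarrow> z * t powr (-\<gamma>)" if "0 < t" "t \<le> 1" for t
  proof -
    have "(\<lambda>n. real (k n) * tail (real n) * (tail (real n powr t) / tail (real n))) \<longlonglongrightarrow> z * t powr (-\<gamma>)"
      by (intro tendsto_mult k_tail tail_ratio' that)
    moreover have "real (k n) * tail (real n) * (tail (real n powr t) / tail (real n)) = real (k n) * tail (real n powr t)" for n
      using tail_pos[of "real n"] by simp
    ultimately show ?thesis by simp
  qed
  have frac: "0 < real (Suc i) / real R" "i < R \<Longrightarrow> real (Suc i) / real R \<le> 1" for i using R by auto
  have beta: "(\<lambda>n. real (k n) * (\<Sum>j\<in>cellset R n i. p j)) \<longlonglongrightarrow> z * l i" if i: "i < R - 1" for i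
  proof -
    have "(\<lambda>n. real (k n) * tail (real n powr (real (Suc i) / real R)) - real (k n) * tail (real n powr (real (Suc (Suc i)) / real R))) 
        \<longlonglongrightarrow> z * (real (Suc i) / real R) powr (-\<gamma>) - z * (real (Suc (Suc i)) / real R) powr (-\<gamma>)"
      using i by (intro tendsto_diff k_t frac) auto
    moreover have "eventually (\<lambda>n. real (k n) * tail (real n powr (real (Suc i) / real R)) - real (k n) * tail (real n powr (real (Suc (Suc i)) / real R)) 
         = real (k n) * (\<Sum>j\<in>cellset R n i. p j)) sequentially"
      using eventually_ge_at_top[of 2]
    proof eventually_elim
      case (elim n)
      thus ?case using R by (simp only: sum_cellset right_diff_distrib)
    qed
    ultimately show ?thesis by (simp add: tendsto_cong l_def right_diff_distrib)
  qed
  have b1: "(\<lambda>n. real (k n) * tail (real n powr (1 / real R))) \<longlonglongrightarrow> z * (1 / real R) powr (-\<gamma>)"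
    using frac[of 0] R by (intro k_t) auto
  have b2: "(\<lambda>n. tail (real n powr (1 / real R))) \<longlonglongrightarrow> 0"
  proof -
    have "(\<lambda>n. tail (real n powr (1 / real R)) / tail (real n) * tail (real n)) \<longlonglongrightarrow> (1 / real R) powr (-\<gamma>) * 0"
      using frac[of 0] R by (intro tendsto_mult tail_ratio' tail_lim) auto
    moreover have "tail (real n powr (1 / real R)) / tail (real n) * tail (real n) = tail (real n powr (1 / real R))" for n
      using tail_pos[of "real n"] by simp
    ultimately show ?thesis by simp
  qed
  have "(\<lambda>n. cell_mult R m n (k n)) \<longlonglongrightarrow> exp (- (z * (1 / real R) powr (-\<gamma>))) * (\<Prod>i<R-1. (z * l i) ^ m i / fact (m i))"
    unfolding cell_mult_def
    by (rule multinom_tendsto[OF k_top beta b1 b2]) (use tail_pos in auto)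
  also have "exp (- (z * (1 / real R) powr (-\<gamma>))) * (\<Prod>i<R-1. (z * l i) ^ m i / fact (m i)) = exp (- z) * (\<Prod>i<R-1. poisson_pmf_real (z * l i) (m i))"
  proof -
    have "(\<Sum>i<R-1. l i) = (real (Suc 0) / real R) powr (-\<gamma>) - (real (Suc (R - 1)) / real R) powr (-\<gamma>)"
      unfolding l_def by (rule sum_lessThan_telescope')
    also have "real (Suc (R - 1)) / real R = 1" using R by simp
    finally have "(\<Sum>i<R-1. z * l i) = z * ((1 / real R) powr (-\<gamma>) - 1)" by (simp flip: sum_distrib_left)
    hence "exp (- (z * (1 / real R) powr (-\<gamma>))) = exp (- z) * exp (- (\<Sum>i<R-1. z * l i))"
      by (simp add: algebra_simps flip: exp_add)
    also have "exp (- (\<Sum>i<R-1. z * l i)) = (\<Prod>i<R-1. exp (- (z * l i)))"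
      by (simp add: exp_sum flip: sum_negf)
    finally show ?thesis by (simp add: poisson_pmf_real_def prod.distrib prod_dividef)
  qed
  finally show ?thesis unfolding k_def l_def .
qed

text \<open>The bound of \<open>comps_cells_ge\<close> is summed over \<open>k\<close>. Its error
  term \<open>k * mean_upto n\<close> vanishes for each fixed \<open>z\<close> with \<open>k\<close>
  near \<open>z / tail n\<close>, so it leaves no trace in the limit integral.\<close>

lemma numerator_lower:
  assumes R: "R \<ge> 2" and e: "0 < e" "e < 1"
  shows "eventually (\<lambda>n. summable (\<lambda>k. q (Suc k) * (\<Sum>ks | ks \<in> comps (Suc k) n \<and> (\<forall>i<R-1. cell_counts R n ks i = m i). prod_list (map p ks))) \<and>
     (1 - e) * p n * nrm n * (Gamma (\<alpha> + 1) * mixed_prob R m - e) 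
     \<le> (\<Sum>k. q (Suc k) * (\<Sum>ks | ks \<in> comps (Suc k) n \<and> (\<forall>i<R-1. cell_counts R n ks i = m i). prod_list (map p ks)))) sequentially"
proof -
  define N where "N n k = (\<Sum>ks | ks \<in> comps (Suc k) n \<and> (\<forall>i<R-1. cell_counts R n ks i = m i). prod_list (map p ks))" for n k
  have N0: "N n k \<ge> 0" for n k unfolding N_def by (intro sum_nonneg p_prod_nonneg)
  have N_le: "N n k \<le> convp p (Suc k) n" for n k
    unfolding N_def wconv_eq_convp[symmetric] wconv_def
    by (intro sum_mono2 finite_comps p_prod_nonneg) auto
  \<comment> \<open>Truncation at 0 keeps \<open>h\<close> between 0 and \<open>cell_mult\<close>,
    so the exponential domination survives although the error term grows with \<open>k\<close>. For
    \<open>n < 2\<close> the logarithmic scale degenerates and \<open>h\<close> is set to 0.\<close>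
  define h where "h n k = (if n \<ge> 2 then max 0 (cell_mult R m n (k - 1) - 2 * real (k - 1) * mean_upto n) else 0)" for n k
  define H where "H z = exp (- z) * (\<Prod>i<R-1. poisson_pmf_real (z * ((real (Suc i) / real R) powr (-\<gamma>) - (real (Suc (Suc i)) / real R) powr (-\<gamma>))) (m i))" for z
  have mean0: "mean_upto n \<ge> 0" for n unfolding mean_upto_def using p_nonneg by (intro divide_nonneg_nonneg sum_nonneg) auto
  have b: "\<forall>\<^sub>F n in sequentially. \<forall>k\<ge>1. \<bar>h n k\<bar> \<le> exp 1 * (1 + real k * tail (real n)) * exp (- (1/2) * (real k * tail (real n)))"
  proof (intro always_eventually allI impI)
    fix n k :: nat assume "k \<ge> 1"
    have q: "0 \<le> 1 - tail (real n)" using tail_le_1 by simp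
    have "\<bar>h n k\<bar> \<le> (1 - tail (real n)) ^ (k - 1)"
    proof (cases "n \<ge> 2")
      case True
      have "h n k \<le> cell_mult R m n (k - 1)" using True cell_mult_bounds[OF True R, of m "k - 1"] mean0[of n] by (simp add: h_def)
      moreover have "h n k \<ge> 0" by (simp add: h_def)
      ultimately show ?thesis using cell_mult_bounds[OF True R, of m "k - 1"] by simp
    qed (use q in \<open>simp add: h_def\<close>)
    also have "\<dots> \<le> exp 1 * exp (- (1/2) * (real k * tail (real n)))"
      by (rule tail_power_le) simp
    also have "\<dots> \<le> exp 1 * (1 + real k * tail (real n)) * exp (- (1/2) * (real k * tail (real n)))"
      using tail_nonneg by (intro mult_right_mono) auto
    finally show "\<bar>h n k\<bar> \<le> exp 1 * (1 + real k * tail (real n)) * exp (- (1/2) * (real k * tail (real n)))" .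
  qed
  have l: "(\<lambda>n. h n (nat \<lceil>z / tail (real n)\<rceil>)) \<longlonglongrightarrow> H z" if z: "z > 0" for z
  proof -
    define k where "k n = nat \<lceil>z / tail (real n)\<rceil>" for n
    have "(\<lambda>n. real (k n - 1) * tail (real n)) \<longlonglongrightarrow> z"
      unfolding k_def by (rule tendsto_nat_ceiling_times(2)[OF _ tail_lim z]) (use tail_pos in simp)
    from tendsto_mult[OF this mean_upto_small]
    have "(\<lambda>n. real (k n - 1) * tail (real n) * (mean_upto n / tail (real n))) \<longlonglongrightarrow> 0" by simp
    moreover have "real (k n - 1) * tail (real n) * (mean_upto n / tail (real n)) = real (k n - 1) * mean_upto n" for n
      using tail_pos[of "real n"] by simp
    ultimately have km: "(\<lambda>n. real (k n - 1) * mean_upto n) \<longlonglongrightarrow> 0" by simp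
    have "(\<lambda>n. max 0 (cell_mult R m n (k n - 1) - 2 * (real (k n - 1) * mean_upto n))) \<longlonglongrightarrow> max 0 (H z - 2 * 0)"
      unfolding H_def k_def by (intro tendsto_max tendsto_diff tendsto_const cell_mult_tendsto R z tendsto_mult km[unfolded k_def])
    moreover have "H z \<ge> 0"
    proof (rule tendsto_lowerbound[OF cell_mult_tendsto[OF R z, of m, folded H_def]])
      show "\<forall>\<^sub>F n in sequentially. 0 \<le> cell_mult R m n (nat \<lceil>z / tail (real n)\<rceil> - 1)"
        using eventually_ge_at_top[of 2] by eventually_elim (rule cell_mult_bounds(1)[OF _ R])
    qed simp
    moreover have "eventually (\<lambda>n. max 0 (cell_mult R m n (k n - 1) - 2 * (real (k n - 1) * mean_upto n)) = h n (k n)) sequentially"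
      using eventually_ge_at_top[of 2] by eventually_elim (simp add: h_def mult.assoc)
    ultimately show ?thesis by (simp add: tendsto_cong k_def)
  qed
  have Hm: "H \<in> borel_measurable borel" unfolding H_def poisson_pmf_real_def by measurable
  note * = gibbs_sum_asymp[where h = h and H = H and C = "exp 1", OF b l Hm]
  have G: "Gamma (\<alpha> + 1) > 0" using alpha by (intro Gamma_real_pos) auto
  have "(LINT z:{0<..}|lborel. z powr \<alpha> * H z) = Gamma (\<alpha> + 1) * mixed_prob R m"
    unfolding mixed_prob_def H_def using G by simp
  with *(2) have "(\<lambda>n. (\<Sum>k. real (Suc k) * q (Suc k) * h n (Suc k)) / nrm n) \<longlonglongrightarrow> Gamma (\<alpha> + 1) * mixed_prob R m" by simp
  hence "eventually (\<lambda>n. (\<Sum>k. real (Suc k) * q (Suc k) * h n (Suc k)) / nrm n > Gamma (\<alpha> + 1) * mixed_prob R m - e) sequentially"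
    using e by (intro order_tendstoD(1)) auto
  moreover have "eventually (\<lambda>n. summable (\<lambda>k. real (Suc k) * q (Suc k) * h n (Suc k))) sequentially"
    using *(1) by simp
  ultimately show ?thesis
    using nrm_pos partition_fun_upper[OF e(1)] p_local[OF e(1)] eventually_ge_at_top[of 2]
  proof eventually_elim
    case (elim n)
    have le: "(1 - e) * p n * (real (Suc k) * q (Suc k) * h n (Suc k)) \<le> q (Suc k) * N n k" for k
    proof -
      have "real (Suc k) * ((1 - e) * p n * h n (Suc k)) \<le> N n k"
      proof (cases "cell_mult R m n k - 2 * real k * mean_upto n \<ge> 0")
        case True
        hence "h n (Suc k) = cell_mult R m n k - 2 * real k * mean_upto n" using elim by (simp add: h_def)
        thus ?thesis unfolding N_def using comps_cells_ge[of n R e k m] elim R e by auto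
      next
        case False
        hence "h n (Suc k) = 0" by (simp add: h_def)
        thus ?thesis using N0 by simp
      qed
      hence "q (Suc k) * (real (Suc k) * ((1 - e) * p n * h n (Suc k))) \<le> q (Suc k) * N n k"
        using q_nonneg by (intro mult_left_mono) auto
      thus ?thesis by (simp add: mult_ac)
    qed
    have summ: "summable (\<lambda>k. q (Suc k) * N n k)"
      by (rule summable_comparison_test'[of "\<lambda>k. q (Suc k) * convp p (Suc k) n"])
         (use elim N_le N0 q_nonneg in \<open>auto intro!: mult_left_mono\<close>)
    have "(1 - e) * p n * (nrm n * (Gamma (\<alpha> + 1) * mixed_prob R m - e)) \<le> (1 - e) * p n * (\<Sum>k. real (Suc k) * q (Suc k) * h n (Suc k))"
      using elim e by (intro mult_left_mono) (auto simp: field_simps)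
    also have "\<dots> = (\<Sum>k. (1 - e) * p n * (real (Suc k) * q (Suc k) * h n (Suc k)))"
      by (rule suminf_mult[symmetric]) (use elim in auto)
    also have "\<dots> \<le> (\<Sum>k. q (Suc k) * N n k)"
      by (intro suminf_le le summ summable_mult) (use elim in auto)
    finally show ?case using summ by (simp add: N_def mult_ac)
  qed
qed

end

section \<open>Normalisation and the lower bound for count probabilities\<close>

context gibbs_big_jump
begin

lemma convp_eventually_pos: "eventually (\<lambda>n. convp p (Suc k) n > 0) sequentially"
proof (induction k)
  case 0
  have "eventually (\<lambda>n. p n > 0) sequentially" using p_local[of 1] by (auto elim: eventually_mono)
  thus ?case by (simp add: convp_1)
next
  case (Suc k)
  have nn: "convp p k n \<ge> 0" for k n by (rule convp_nonneg) (rule p_nonneg)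
  obtain N where N: "\<And>n. n \<ge> N \<Longrightarrow> convp p (Suc k) n > 0" using Suc by (auto simp: eventually_sequentially)
  have "eventually (\<lambda>n. p n > 0) sequentially" using p_local[of 1] by (auto elim: eventually_mono)
  then obtain j where j: "p j > 0" by (auto simp: eventually_sequentially)
  have "convp p (Suc (Suc k)) n > 0" if "n \<ge> N + j" for n
  proof -
    have "0 < p j * convp p (Suc k) (n - j)" using j N[of "n - j"] that by simp
    also have "\<dots> \<le> (\<Sum>j\<le>n. p j * convp p (Suc k) (n - j))"
      using that nn p_nonneg by (intro member_le_sum) auto
    finally show ?thesis by (simp only: convp_Suc[of p "Suc k"])
  qed
  thus ?case by (auto simp: eventually_sequentially)
qed

lemma partition_fun_pos: "eventually (\<lambda>n. partition_fun n > 0) sequentially"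
proof -
  have nn: "convp p k n \<ge> 0" for k n by (rule convp_nonneg) (rule p_nonneg)
  have "eventually (\<lambda>k. Lv (real k) > 0) sequentially"
    by (rule eventually_compose_filterlim[OF slowly_varyingD(2)[OF Lv] filterlim_real_sequentially])
  hence "eventually (\<lambda>k. k \<ge> 1 \<and> q k > 0) sequentially"
    using asymp_equiv_eventually_zeros[OF q_asymp] eventually_ge_at_top[of 1]
  proof eventually_elim
    case (elim k)
    thus ?case using q_nonneg[of k] by (auto simp: less_le)
  qed
  then obtain k where "k \<ge> 1" "q k > 0" by (auto simp: eventually_sequentially)
  then obtain l where l: "q (Suc l) > 0" by (cases k) auto
  show ?thesis using convp_eventually_pos[of l] partition_fun_upper[OF zero_less_one]
  proof eventually_elim
    case (elim n)
    show ?case unfolding partition_fun_def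
      using elim l nn q_nonneg by (intro suminf_pos2[of _ l]) auto
  qed
qed

lemma gibbs_weight_nonneg: 
  assumes "partition_fun n > 0" "ks \<in> all_comps n"
  shows "gibbs_weight n ks \<ge> 0"
proof -
  have "length ks \<ge> 1" using assms(2) by (cases ks) (auto simp: all_comps_def)
  thus ?thesis using assms(1) q_nonneg p_prod_nonneg by (simp add: gibbs_weight_def)
qed

lemma sum_gibbs_weight:
  "(\<Sum>ks | ks \<in> comps (Suc k) n \<and> Q ks. gibbs_weight n ks) = q (Suc k) * (\<Sum>ks | ks \<in> comps (Suc k) n \<and> Q ks. prod_list (map p ks)) / partition_fun n"
proof -
  have "(\<Sum>ks | ks \<in> comps (Suc k) n \<and> Q ks. gibbs_weight n ks) = (\<Sum>ks | ks \<in> comps (Suc k) n \<and> Q ks. q (Suc k) / partition_fun n * prod_list (map p ks))"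
    by (intro sum.cong) (auto simp: gibbs_weight_def comps_def)
  thus ?thesis unfolding sum_distrib_left[symmetric] by simp
qed

lemma gibbs_weight_total:
  "eventually (\<lambda>n. partition_fun n > 0 \<and> gibbs_weight n summable_on all_comps n \<and> infsum (gibbs_weight n) (all_comps n) = 1) sequentially"
  using partition_fun_pos partition_fun_upper[OF zero_less_one]
proof eventually_elim
  case (elim n)
  have eq: "(\<Sum>ks | ks \<in> comps (Suc k) n \<and> True. gibbs_weight n ks) = q (Suc k) * convp p (Suc k) n / partition_fun n" for k
    unfolding sum_gibbs_weight wconv_eq_convp[symmetric] wconv_def by simp
  have 1: "summable (\<lambda>k. (\<Sum>ks | ks \<in> comps (Suc k) n \<and> True. gibbs_weight n ks))"
    unfolding eq using elim by (intro summable_divide) auto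
  have 2: "(\<Sum>k. (\<Sum>ks | ks \<in> comps (Suc k) n \<and> True. gibbs_weight n ks)) = 1"
    unfolding eq using elim by (subst suminf_divide) (auto simp: partition_fun_def)
  show ?case
    using infsum_all_comps[OF gibbs_weight_nonneg[OF elim(1)] 1] 2 elim(1) by simp
qed

proposition gibbs_counts_lower:
  assumes R: "R \<ge> 2" and d: "d > 0"
  shows "eventually (\<lambda>n. infsum (gibbs_weight n) {ks\<in>all_comps n. \<forall>i<R-1. cell_counts R n ks i = m i} \<ge> mixed_prob R m - d) sequentially"
\<comment> \<open>If the claimed bound is not positive, nonnegativity suffices. Otherwise
  \<open>mixed_prob R m - d\<close> is positive and may be multiplied with the upper bound for the
  partition function.\<close>
proof (cases "mixed_prob R m \<le> d")
  case True
  show ?thesis using partition_fun_pos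
  proof eventually_elim
    case (elim n)
    have "infsum (gibbs_weight n) {ks\<in>all_comps n. \<forall>i<R-1. cell_counts R n ks i = m i} \<ge> 0"
      using gibbs_weight_nonneg[OF elim] by (intro infsum_nonneg) auto
    thus ?case using True by simp
  qed
next
  case False
  let ?G = "Gamma (\<alpha> + 1)" and ?P = "mixed_prob R m"
  have G: "?G > 0" using alpha by (intro Gamma_real_pos) auto
  \<comment> \<open>The quotient of the bounds for numerator and partition function tends to
    \<open>mixed_prob R m\<close> as their tolerance shrinks, so some \<open>e\<close> in
    \<open>{0<..<1}\<close> loses less than \<open>d\<close>.\<close>
  have "((\<lambda>e. (1 - e) * (?G * ?P - e) / (?G + e)) \<longlongrightarrow> (1 - 0) * (?G * ?P - 0) / (?G + 0)) (at_right 0)"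
    using G by (intro tendsto_intros) auto
  hence "eventually (\<lambda>e. (1 - e) * (?G * ?P - e) / (?G + e) > ?P - d) (at_right 0)"
    using G d by (intro order_tendstoD(1)) auto
  moreover have "eventually (\<lambda>e::real. e \<in> {0<..<1}) (at_right 0)" by (rule eventually_at_right_real) simp
  ultimately have "eventually (\<lambda>e. (1 - e) * (?G * ?P - e) / (?G + e) > ?P - d \<and> e \<in> {0<..<1}) (at_right 0)"
    by eventually_elim auto
  then obtain e where e: "(1 - e) * (?G * ?P - e) / (?G + e) > ?P - d" "0 < e" "e < 1"
    using eventually_happens[of _ "at_right (0::real)"] by auto
  show ?thesis
    using partition_fun_pos partition_fun_upper[OF e(2)] numerator_lower[OF R e(2,3), of m] nrm_pos
  proof eventually_elim
    case (elim n)
    let ?Q = "\<lambda>ks. \<forall>i<R-1. cell_counts R n ks i = m i"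
    let ?S = "\<Sum>k. q (Suc k) * (\<Sum>ks | ks \<in> comps (Suc k) n \<and> ?Q ks. prod_list (map p ks))"
    have 1: "summable (\<lambda>k. (\<Sum>ks | ks \<in> comps (Suc k) n \<and> ?Q ks. gibbs_weight n ks))"
      unfolding sum_gibbs_weight using elim by (intro summable_divide) auto
    have "infsum (gibbs_weight n) {ks\<in>all_comps n. ?Q ks} = (\<Sum>k. (\<Sum>ks | ks \<in> comps (Suc k) n \<and> ?Q ks. gibbs_weight n ks))"
      by (rule infsum_all_comps(2)[where Q = ?Q, OF gibbs_weight_nonneg[OF elim(1)] 1])
    also have "\<dots> = ?S / partition_fun n"
      unfolding sum_gibbs_weight using elim by (intro suminf_divide) auto
    finally have "infsum (gibbs_weight n) {ks\<in>all_comps n. ?Q ks} = ?S / partition_fun n" .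
    moreover have "?P - d \<le> ?S / partition_fun n"
    proof -
      have pd: "?P - d > 0" using False by simp
      hence X: "(1 - e) * (?G * ?P - e) > (?P - d) * (?G + e)" using e G by (simp add: pos_less_divide_eq)
      have "(?P - d) * partition_fun n \<le> (?P - d) * ((?G + e) * p n * nrm n)" using elim pd by (intro mult_left_mono) auto
      also have "\<dots> = ((?P - d) * (?G + e)) * (p n * nrm n)" by simp
      also have "\<dots> \<le> ((1 - e) * (?G * ?P - e)) * (p n * nrm n)" 
        using X elim p_nonneg by (intro mult_right_mono) auto
      also have "\<dots> \<le> ?S" using elim by (simp add: mult_ac)
      finally show ?thesis using elim by (simp add: pos_le_divide_eq)
    qed
    ultimately show ?case by simp
  qed
qed

end

section \<open>The vague topology\<close>

lemma cell_borel [measurable]: "cell R i \<in> sets borel"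
  by (simp add: cell_def)

lemma cell_cover:
  assumes "R \<ge> 1" "1 / real R < x" "x \<le> 1"
  shows "\<exists>i<R-1. x \<in> cell R i"
proof -
  define k where "k = nat \<lceil>real R * x\<rceil>"
  have pos: "real R > 0" using assms by simp
  have Rx: "1 < real R * x" "real R * x \<le> real R" using assms pos by (auto simp: field_simps)
  have k: "real R * x \<le> real k" "real k - 1 < real R * x" unfolding k_def using Rx by linarith+
  hence "real k > 1" using Rx by linarith
  hence k2: "k \<ge> 2" by simp
  have "real k < real R + 1" using k Rx by linarith
  hence kR: "k \<le> R" by linarith
  have "real (Suc (k - 2)) = real k - 1" "real (Suc (Suc (k - 2))) = real k" using k2 by auto
  hence "x \<in> cell R (k - 2)" unfolding cell_def using k pos by (auto simp: field_simps)
  thus ?thesis using k2 kR by (intro exI[of _ "k - 2"]) auto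
qed

lemma cell_subset: "i < R - 1 \<Longrightarrow> cell R i \<subseteq> {1 / real R..1}"
proof
  fix x assume i: "i < R - 1" and x: "x \<in> cell R i"
  have "1 / real R \<le> real (Suc i) / real R" by (intro divide_right_mono) auto
  moreover have "real (Suc (Suc i)) / real R \<le> 1"
  proof -
    have "Suc (Suc i) \<le> R" "R > 0" using i by auto
    hence "real (Suc (Suc i)) \<le> real R" by (simp only: of_nat_le_iff)
    thus ?thesis using \<open>R > 0\<close> by (simp only: divide_le_eq_1_pos of_nat_0_less_iff)
  qed
  ultimately show "x \<in> {1 / real R..1}" using x by (auto simp: cell_def)
qed

lemma LF_sets: "\<mu> \<in> LF \<Longrightarrow> sets \<mu> = sets borel"
  by (simp add: LF_def)

lemma LF_finite:
  assumes "\<mu> \<in> LF" "a > 0" "B \<subseteq> {a..1}"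
  shows "emeasure \<mu> B < \<infinity>"
proof -
  have "emeasure \<mu> B \<le> emeasure \<mu> {a..1}" using assms by (intro emeasure_mono) (auto simp: LF_sets)
  also have "\<dots> < \<infinity>" using assms by (simp add: LF_def)
  finally show ?thesis .
qed

lemma LF_cell_fmeasurable:
  assumes "\<mu> \<in> LF" "i < R - 1"
  shows "cell R i \<in> fmeasurable \<mu>"
proof -
  have "R > 0" using assms by simp
  hence "emeasure \<mu> (cell R i) < \<infinity>" by (intro LF_finite[OF assms(1) _ cell_subset[OF assms(2)]]) auto
  thus ?thesis using assms by (auto simp: fmeasurable_def LF_sets)
qed

text \<open>Integrability of \<open>f\<close> comes along: its distance to the step function is
  dominated by an integrable step function.\<close>

lemma integral_step_approx:
  assumes \<nu>: "\<nu> \<in> LF" and f: "f \<in> borel_measurable borel" and I: "I \<subseteq> {..<R-1}"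
    and approx: "\<And>x. \<bar>f x - (\<Sum>i\<in>I. r i * indicator (cell R i) x)\<bar> \<le> w * (\<Sum>i\<in>I. indicator (cell R i) x)"
  shows "\<bar>integral\<^sup>L \<nu> f - (\<Sum>i\<in>I. r i * measure \<nu> (cell R i))\<bar> \<le> w * (\<Sum>i\<in>I. measure \<nu> (cell R i))"
proof -
  have fin: "finite I" using I by (rule finite_subset) simp
  have ind: "has_bochner_integral \<nu> (indicator (cell R i) :: real \<Rightarrow> real) (measure \<nu> (cell R i))" if "i \<in> I" for i
    using LF_cell_fmeasurable[OF \<nu>, of i R] I that by (intro has_bochner_integral_real_indicator) (auto simp: fmeasurable_def)
  define \<phi> where "\<phi> x = (\<Sum>i\<in>I. r i * indicator (cell R i) x)" for x :: real
  define g where "g x = w * (\<Sum>i\<in>I. indicator (cell R i) x)" for x :: real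
  have \<phi>: "has_bochner_integral \<nu> \<phi> (\<Sum>i\<in>I. r i * measure \<nu> (cell R i))"
    unfolding \<phi>_def by (intro has_bochner_integral_sum has_bochner_integral_mult_right ind)
  have g: "has_bochner_integral \<nu> g (w * (\<Sum>i\<in>I. measure \<nu> (cell R i)))"
    unfolding g_def by (intro has_bochner_integral_sum has_bochner_integral_mult_right ind)
  have fm: "f \<in> borel_measurable \<nu>" using f LF_sets[OF \<nu>] by (simp cong: measurable_cong_sets)
  have \<phi>m: "\<phi> \<in> borel_measurable \<nu>" using \<phi> by (auto simp: has_bochner_integral_iff)
  have d: "integrable \<nu> (\<lambda>x. f x - \<phi> x)"
  proof (rule Bochner_Integration.integrable_bound)
    show "integrable \<nu> g" using g by (auto simp: has_bochner_integral_iff)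
    show "(\<lambda>x. f x - \<phi> x) \<in> borel_measurable \<nu>" using fm \<phi>m by measurable
    have "\<bar>f x - \<phi> x\<bar> \<le> g x" for x using approx[of x] by (simp add: \<phi>_def g_def)
    thus "AE x in \<nu>. norm (f x - \<phi> x) \<le> norm (g x)" by (intro AE_I2) (metis abs_ge_self order.trans real_norm_def)
  qed
  have "integrable \<nu> (\<lambda>x. (f x - \<phi> x) + \<phi> x)"
    using d \<phi> by (intro Bochner_Integration.integrable_add) (auto simp: has_bochner_integral_iff)
  hence fi: "integrable \<nu> f" by simp
  have "integral\<^sup>L \<nu> f - (\<Sum>i\<in>I. r i * measure \<nu> (cell R i)) = integral\<^sup>L \<nu> (\<lambda>x. f x - \<phi> x)"
    using fi \<phi> by (subst Bochner_Integration.integral_diff) (auto simp: has_bochner_integral_iff)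
  also have "\<bar>\<dots>\<bar> \<le> integral\<^sup>L \<nu> (\<lambda>x. \<bar>f x - \<phi> x\<bar>)" by (rule integral_abs_bound)
  also have "\<dots> \<le> integral\<^sup>L \<nu> g"
    using d g approx by (intro integral_mono) (auto simp: has_bochner_integral_iff \<phi>_def g_def)
  also have "\<dots> = w * (\<Sum>i\<in>I. measure \<nu> (cell R i))" using g by (auto simp: has_bochner_integral_iff)
  finally show ?thesis .
qed

definition same_cells :: "nat \<Rightarrow> real measure \<Rightarrow> real measure \<Rightarrow> bool" where
  "same_cells R \<mu> \<nu> \<longleftrightarrow> (\<forall>i<R-1. emeasure \<mu> (cell R i) = emeasure \<nu> (cell R i))"

text \<open>On a fine partition \<open>f\<close> is uniformly close to a step function whose
  integral depends on the cell masses only. The mass that multiplies the approximation error can be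
  taken from \<mu>, since \<nu> agrees with it on the cells; hence \<open>R\<^sub>0\<close> is
  uniform in \<nu>.\<close>

lemma integral_same_cells:
  assumes f: "f \<in> Cc01" and \<mu>: "\<mu> \<in> LF" and e: "e > 0"
  shows "\<exists>R\<^sub>0. \<forall>R\<ge>R\<^sub>0. \<forall>\<nu>\<in>LF. same_cells R \<mu> \<nu> \<longrightarrow> \<bar>integral\<^sup>L \<nu> f - integral\<^sup>L \<mu> f\<bar> < e"
proof -
  obtain a where cont: "continuous_on {0<..1} f" and a: "0 < a" "a \<le> 1" and zero: "\<And>x. x \<notin> {a..1} \<Longrightarrow> f x = 0"
    using f by (auto simp: Cc01_def)
  have fm: "f \<in> borel_measurable borel"
  proof -
    have "(\<lambda>x. indicator {0<..1} x *\<^sub>R f x) \<in> borel_measurable borel"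
      by (rule borel_measurable_continuous_on_indicator[OF _ cont]) simp
    also have "(\<lambda>x. indicator {0<..1} x *\<^sub>R f x) = f"
    proof
      fix x show "indicator {0<..1} x *\<^sub>R f x = f x" using zero[of x] a by (cases "x \<le> 0") (auto simp: indicator_def)
    qed
    finally show ?thesis .
  qed
  \<comment> \<open>Room for the cell around \<open>a\<close>: it may start below \<open>a\<close>,
    but not below \<open>a / 2\<close> once \<open>1 / R < b\<close>.\<close>
  define b where "b = a / 2"
  have b: "0 < b" "b < a" using a by (auto simp: b_def)
  define C where "C = measure \<mu> {b..1}"
  \<comment> \<open>Each of the two approximation errors is at most \<open>w * C < e / 2\<close>;
    \<open>C + 1\<close> avoids division by zero.\<close>
  define w where "w = e / (4 * (C + 1))"
  have C: "C \<ge> 0" by (simp add: C_def)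
  have w: "w > 0" using e C by (simp add: w_def)
  have "uniformly_continuous_on {b..1} f"
    using b by (intro compact_uniformly_continuous continuous_on_subset[OF cont]) auto
  then obtain d where d: "d > 0" "\<And>x y. x \<in> {b..1} \<Longrightarrow> y \<in> {b..1} \<Longrightarrow> dist y x < d \<Longrightarrow> dist (f y) (f x) < w"
    using w unfolding uniformly_continuous_on_def by meson
  obtain R0 :: nat where R0: "real R0 > 1 / min d b" using reals_Archimedean2 by blast
  show ?thesis
  proof (intro exI allI impI ballI)
    fix R \<nu> assume R: "R0 \<le> R" and \<nu>: "\<nu> \<in> LF" and same: "same_cells R \<mu> \<nu>"
    have m: "min d b > 0" using d b by simp
    have R1: "1 / min d b < real R" using R R0 by linarith
    hence "real R > 0" using m by (meson less_trans zero_less_divide_1_iff)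
    hence Rpos: "R \<ge> 1" by simp
    have "1 < real R * min d b" using R1 m by (simp add: pos_divide_less_eq)
    hence "1 / real R < min d b" using \<open>real R > 0\<close> by (simp only: pos_divide_less_eq mult.commute)
    hence invR: "1 / real R < d" "1 / real R < b" unfolding min_less_iff_conj by blast+
    define r where "r i = real (Suc (Suc i)) / real R" for i
    define I where "I = {i. i < R - 1 \<and> r i \<ge> a}"
    have I: "I \<subseteq> {..<R-1}" "finite I" by (auto simp: I_def)
    have near: "r i - 1 / real R < x" "x \<le> r i" if "x \<in> cell R i" for i x
    proof -
      have "r i - 1 / real R = real (Suc i) / real R" unfolding r_def diff_divide_distrib[symmetric] by simp
      thus "r i - 1 / real R < x" "x \<le> r i" using that by (auto simp: cell_def r_def)
    qed
    have sub: "cell R i \<subseteq> {b..1}" if "i \<in> I" for i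
    proof
      fix x assume x: "x \<in> cell R i"
      have "x \<le> 1" using cell_subset[of i R] that x by (auto simp: I_def)
      moreover have "x > a - 1 / real R" using near(1)[OF x] that by (auto simp: I_def)
      ultimately show "x \<in> {b..1}" using invR by (auto simp: b_def)
    qed
    have approx: "\<bar>f x - (\<Sum>i\<in>I. f (r i) * indicator (cell R i) x)\<bar> \<le> w * (\<Sum>i\<in>I. indicator (cell R i) x)" for x
    proof (cases "\<exists>i\<in>I. x \<in> cell R i")
      case True
      then obtain i where i: "i \<in> I" "x \<in> cell R i" by blast
      have only: "indicator (cell R j) x = (if j = i then 1 else 0 :: real)" for j
        using cell_disjoint[of j i R] i by (auto simp: indicator_def)
      have "r i \<le> 1" using i(1) \<open>real R > 0\<close> by (auto simp: I_def r_def divide_le_eq)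
      hence "r i \<in> {b..1}" using i(1) b by (auto simp: I_def)
      moreover have "x \<in> {b..1}" using subsetD[OF sub[OF i(1)] i(2)] .
      moreover have "dist x (r i) < d" using near[OF i(2)] invR by (auto simp: dist_real_def)
      ultimately have "\<bar>f x - f (r i)\<bar> < w" using d(2)[of "r i" x] by (simp add: dist_real_def)
      thus ?thesis using i(1) I(2) by (simp add: only if_distrib[of "\<lambda>y. _ * y"] cong: if_cong)
    next
      case False
      have "f x = 0"
      proof (cases "x \<in> {a..1}")
        case True
        hence "1 / real R < x" "x \<le> 1" using invR b by auto
        then obtain i where i: "i < R - 1" "x \<in> cell R i" using cell_cover[OF Rpos, of x] by blast
        have "r i \<ge> a" using near(2)[OF i(2)] True by auto
        thus ?thesis using i False by (auto simp: I_def)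
      qed (use zero in auto)
      moreover have "indicator (cell R i) x = (0::real)" if "i \<in> I" for i using False that by auto
      ultimately show ?thesis by simp
    qed
    have meq: "measure \<nu> (cell R i) = measure \<mu> (cell R i)" if "i \<in> I" for i
      using same that by (auto simp: same_cells_def I_def measure_def)
    have "(\<Sum>i\<in>I. measure \<mu> (cell R i)) = measure \<mu> (\<Union>i\<in>I. cell R i)"
    proof (rule measure_finite_Union[symmetric])
      show "emeasure \<mu> (cell R i) \<noteq> \<infinity>" if "i \<in> I" for i
        using LF_cell_fmeasurable[OF \<mu>, of i R] that by (auto simp: I_def fmeasurable_def)
    qed (use I LF_sets[OF \<mu>] in \<open>auto simp: disjoint_family_on_def cell_disjoint\<close>)
    also have "\<dots> \<le> C" unfolding C_def
    proof (rule measure_mono_fmeasurable)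
      show "{b..1} \<in> fmeasurable \<mu>" using LF_finite[OF \<mu> b(1), of "{b..1}"] by (auto simp: fmeasurable_def LF_sets[OF \<mu>])
    qed (use sub I LF_sets[OF \<mu>] in auto)
    finally have mC: "(\<Sum>i\<in>I. measure \<mu> (cell R i)) \<le> C" .
    have "\<bar>integral\<^sup>L \<nu> f - (\<Sum>i\<in>I. f (r i) * measure \<mu> (cell R i))\<bar> \<le> w * (\<Sum>i\<in>I. measure \<mu> (cell R i))"
      using integral_step_approx[OF \<nu> fm I(1) approx] meq by simp
    moreover have "\<bar>integral\<^sup>L \<mu> f - (\<Sum>i\<in>I. f (r i) * measure \<mu> (cell R i))\<bar> \<le> w * (\<Sum>i\<in>I. measure \<mu> (cell R i))"
      by (rule integral_step_approx[OF \<mu> fm I(1) approx])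
    moreover have "w * (\<Sum>i\<in>I. measure \<mu> (cell R i)) \<le> w * C" using w mC by (intro mult_left_mono) auto
    moreover have "w * C < e / 2"
    proof -
      have "w * C < w * (2 * (C + 1))" using w C by (intro mult_strict_left_mono) auto
      also have "\<dots> = e / 2" using C by (simp add: w_def field_simps)
      finally show ?thesis .
    qed
    ultimately show "\<bar>integral\<^sup>L \<nu> f - integral\<^sup>L \<mu> f\<bar> < e" by linarith
  qed
qed

lemma topspace_vague: "topspace vague_topology = LF"
proof -
  have z: "(\<lambda>_. 0) \<in> Cc01" by (auto simp: Cc01_def intro!: exI[of _ 1])
  have "LF \<in> {{\<mu>\<in>LF. integral\<^sup>L \<mu> f \<in> U} | f U. f \<in> Cc01 \<and> open U}"
    by (intro CollectI exI[of _ "\<lambda>_. 0"] exI[of _ UNIV]) (use z in auto)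
  hence "LF \<subseteq> \<Union>{{\<mu>\<in>LF. integral\<^sup>L \<mu> f \<in> U} | f U. f \<in> Cc01 \<and> open U}" by (rule Union_upper)
  moreover have "\<Union>{{\<mu>\<in>LF. integral\<^sup>L \<mu> f \<in> U} | f U. f \<in> Cc01 \<and> open U} \<subseteq> LF" by blast
  ultimately show ?thesis unfolding vague_topology_def topology_generated_by_topspace by blast
qed

text \<open>Induction over the generation of open sets. Claiming all large \<open>R\<close> instead
  of one lets the levels of two intersected sets be merged by their maximum.\<close>

proposition vague_open_cells:
  assumes U: "openin vague_topology U" and \<mu>: "\<mu> \<in> U" "\<mu> \<in> LF"
  shows "\<exists>R\<^sub>0. \<forall>R\<ge>R\<^sub>0. \<forall>\<nu>\<in>LF. same_cells R \<mu> \<nu> \<longrightarrow> \<nu> \<in> U"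
proof -
  have "generate_topology_on {{\<mu>\<in>LF. integral\<^sup>L \<mu> f \<in> U} | f U. f \<in> Cc01 \<and> open U} U"
    using U unfolding vague_topology_def openin_topology_generated_by_iff .
  thus ?thesis using \<mu>
  proof (induction rule: generate_topology_on.induct)
    case Empty
    thus ?case by simp
  next
    case (Int A B)
    then obtain R1 R2 where R: "\<forall>R\<ge>R1. \<forall>\<nu>\<in>LF. same_cells R \<mu> \<nu> \<longrightarrow> \<nu> \<in> A" "\<forall>R\<ge>R2. \<forall>\<nu>\<in>LF. same_cells R \<mu> \<nu> \<longrightarrow> \<nu> \<in> B"
      by blast
    show ?case by (rule exI[of _ "max R1 R2"]) (use R in auto)
  next
    case (UN K)
    then obtain k where k: "k \<in> K" "\<mu> \<in> k" by blast
    with UN obtain R0 where "\<forall>R\<ge>R0. \<forall>\<nu>\<in>LF. same_cells R \<mu> \<nu> \<longrightarrow> \<nu> \<in> k" by blast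
    thus ?case using k by blast
  next
    case (Basis S)
    then obtain f V where S: "S = {\<mu>\<in>LF. integral\<^sup>L \<mu> f \<in> V}" "f \<in> Cc01" "open V" by blast
    have "integral\<^sup>L \<mu> f \<in> V" using Basis S by auto
    then obtain e where e: "e > 0" "\<And>y. dist y (integral\<^sup>L \<mu> f) < e \<Longrightarrow> y \<in> V"
      using S(3) unfolding open_dist by blast
    obtain R0 where "\<forall>R\<ge>R0. \<forall>\<nu>\<in>LF. same_cells R \<mu> \<nu> \<longrightarrow> \<bar>integral\<^sup>L \<nu> f - integral\<^sup>L \<mu> f\<bar> < e"
      using integral_same_cells[OF S(2) \<mu>(2) e(1)] by blast
    thus ?case using e(2) S(1) by (intro exI[of _ R0]) (auto simp: dist_real_def)
  qed
qed

text \<open>\<open>measure_of\<close> returns the intended values only if they form a measure. They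
  do, as the image of the counting measure on list positions, which counts repeated points with
  multiplicity.\<close>

lemma emeasure_count_measure:
  "B \<in> sets borel \<Longrightarrow> emeasure (count_measure_of_list xs) B = of_nat (length (filter (\<lambda>x. x \<in> B) xs))"
  "sets (count_measure_of_list xs) = sets borel"
proof -
  define M where "M = distr (count_space {..<length xs}) borel (\<lambda>i. xs ! i)"
  have em: "emeasure M B = of_nat (length (filter (\<lambda>x. x \<in> B) xs))" if "B \<in> sets borel" for B
  proof -
    have "emeasure M B = emeasure (count_space {..<length xs}) ((\<lambda>i. xs ! i) -` B \<inter> {..<length xs})"
      unfolding M_def using that by (subst emeasure_distr) auto
    also have "\<dots> = of_nat (card ((\<lambda>i. xs ! i) -` B \<inter> {..<length xs}))"
      by (subst emeasure_count_space_finite) auto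
    also have "(\<lambda>i. xs ! i) -` B \<inter> {..<length xs} = {i. i < length xs \<and> xs ! i \<in> B}" by auto
    finally show ?thesis by (simp add: length_filter_conv_card)
  qed
  have "count_measure_of_list xs = measure_of UNIV (sets borel) (emeasure M)"
    unfolding count_measure_of_list_def
    by (rule measure_of_eq) (auto simp: em sets.sigma_sets_eq[of borel, simplified])
  also have "\<dots> = M" using measure_of_of_measure[of M] by (simp add: M_def)
  finally have eq: "count_measure_of_list xs = M" .
  show "B \<in> sets borel \<Longrightarrow> emeasure (count_measure_of_list xs) B = of_nat (length (filter (\<lambda>x. x \<in> B) xs))"
    "sets (count_measure_of_list xs) = sets borel"
    using em by (auto simp: eq) (simp_all add: M_def)
qed

lemma emeasure_pp_cell: "emeasure (pp n ks) (cell R i) = of_nat (cell_counts R n ks i)"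
  by (simp add: pp_def emeasure_count_measure cell_counts_def)

lemma pp_points_range:
  assumes "ks \<in> all_comps n" "y \<in> set (pp_points n ks)"
  shows "y \<in> {0<..1}"
proof -
  obtain k where k: "k > 1" "k \<in> set (drop 1 (rev (sort ks)))" "y = ln (real k) / ln (real n)"
    using assms(2) by (auto simp: pp_points_def)
  have "k \<in> set ks" using in_set_dropD[OF k(2)] by simp
  hence "k \<le> n" using member_le_sum_list[of k ks] assms(1) by (auto simp: all_comps_def)
  hence "0 < ln (real k)" "ln (real k) \<le> ln (real n)" "0 < ln (real n)" using k(1) by auto
  thus ?thesis by (simp add: k(3))
qed

lemma pp_LF:
  assumes "ks \<in> all_comps n"
  shows "pp n ks \<in> LF"
proof -
  have "emeasure (pp n ks) (- {0<..1}) = 0"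
  proof -
    have "filter (\<lambda>x. x \<in> - {0<..1}) (pp_points n ks) = []"
      unfolding filter_empty_conv using pp_points_range[OF assms] by blast
    thus ?thesis unfolding pp_def by (subst emeasure_count_measure) (auto simp del: Compl_iff)
  qed
  thus ?thesis by (simp add: LF_def pp_def emeasure_count_measure less_top[symmetric])
qed

section \<open>Vague convergence in distribution through cell counts\<close>

text \<open>Counts are kept as lists so that they range over a countable type.\<close>

definition has_cells :: "nat \<Rightarrow> real measure \<Rightarrow> nat list \<Rightarrow> bool" where
  "has_cells R \<mu> m \<longleftrightarrow> length m = R - 1 \<and> (\<forall>i<R-1. emeasure \<mu> (cell R i) = of_nat (m ! i))"

lemma has_cells_unique: "has_cells R \<mu> m \<Longrightarrow> has_cells R \<mu> m' \<Longrightarrow> m = m'"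
  by (auto simp: has_cells_def intro!: nth_equalityI)

lemma has_cells_same: "has_cells R \<mu> m \<Longrightarrow> has_cells R \<nu> m \<longleftrightarrow> same_cells R \<mu> \<nu>"
  by (auto simp: has_cells_def same_cells_def)

text \<open>What the limit argument uses of a point process: integer cell counts with measurable
  events. As count vectors form a countable type, the other measurability facts follow from
  these.\<close>

locale random_counts = prob_space M for M :: "'a measure" +
  fixes \<xi> :: "'a \<Rightarrow> real measure"
  assumes xi_LF: "\<omega> \<in> space M \<Longrightarrow> \<xi> \<omega> \<in> LF"
    and xi_count: "\<omega> \<in> space M \<Longrightarrow> i < R - 1 \<Longrightarrow> \<exists>c::nat. emeasure (\<xi> \<omega>) (cell R i) = of_nat c"
    and xi_meas: "i < R - 1 \<Longrightarrow> {\<omega>\<in>space M. emeasure (\<xi> \<omega>) (cell R i) = of_nat c} \<in> sets M"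
begin

lemma ex_cells:
  assumes "\<omega> \<in> space M"
  shows "\<exists>m. has_cells R (\<xi> \<omega>) m"
proof -
  have "\<forall>i. \<exists>c. i < R - 1 \<longrightarrow> emeasure (\<xi> \<omega>) (cell R i) = of_nat c"
    using xi_count[OF assms, of _ R] by blast
  then obtain c where c: "\<And>i. i < R - 1 \<Longrightarrow> emeasure (\<xi> \<omega>) (cell R i) = of_nat (c i)"
    by (metis (no_types))
  show ?thesis by (rule exI[of _ "map c [0..<R-1]"]) (simp add: has_cells_def c)
qed

lemma has_cells_sets [measurable]: "{\<omega>\<in>space M. has_cells R (\<xi> \<omega>) m} \<in> sets M"
proof (cases "length m = R - 1")
  case True
  have "{\<omega>\<in>space M. \<forall>i\<in>{..<R-1}. emeasure (\<xi> \<omega>) (cell R i) = of_nat (m ! i)} \<in> sets M"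
    by (rule sets.sets_Collect_finite_All) (auto intro: xi_meas)
  also have "{\<omega>\<in>space M. \<forall>i\<in>{..<R-1}. emeasure (\<xi> \<omega>) (cell R i) = of_nat (m ! i)} = {\<omega>\<in>space M. has_cells R (\<xi> \<omega>) m}"
    using True by (auto simp: has_cells_def)
  finally show ?thesis .
qed (simp add: has_cells_def)

definition cells :: "nat \<Rightarrow> 'a \<Rightarrow> nat list" where
  "cells R \<omega> = (THE m. has_cells R (\<xi> \<omega>) m)"

lemma has_cells_cells: "\<omega> \<in> space M \<Longrightarrow> has_cells R (\<xi> \<omega>) (cells R \<omega>)"
  unfolding cells_def using ex_cells has_cells_unique by (metis theI)

lemma cells_eq_iff: "\<omega> \<in> space M \<Longrightarrow> cells R \<omega> = m \<longleftrightarrow> has_cells R (\<xi> \<omega>) m"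
  using has_cells_cells has_cells_unique by blast

lemma cells_measurable [measurable]: "cells R \<in> M \<rightarrow>\<^sub>M count_space UNIV"
proof (subst measurable_count_space_eq_countable, simp, intro conjI ballI)
  fix m :: "nat list"
  have "cells R -` {m} \<inter> space M = {\<omega>\<in>space M. has_cells R (\<xi> \<omega>) m}" by (auto simp: cells_eq_iff has_cells_cells)
  thus "cells R -` {m} \<inter> space M \<in> sets M" by simp
qed simp

text \<open>Around each of its members an open set contains all measures with the same counts at
  some level. The event is thus a countable union, over levels and count vectors, of
  \<open>has_cells\<close> events.\<close>

lemma vague_open_sets:
  assumes U: "openin vague_topology U"
  shows "{\<omega>\<in>space M. \<xi> \<omega> \<in> U} \<in> sets M"
proof -
  have "{\<omega>\<in>space M. \<xi> \<omega> \<in> U} = (\<Union>R. \<Union>m\<in>{m. \<forall>\<nu>\<in>LF. has_cells R \<nu> m \<longrightarrow> \<nu> \<in> U}. {\<omega>\<in>space M. has_cells R (\<xi> \<omega>) m})"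
  proof (intro equalityI subsetI)
    fix \<omega> assume "\<omega> \<in> {\<omega>\<in>space M. \<xi> \<omega> \<in> U}"
    hence \<omega>: "\<omega> \<in> space M" "\<xi> \<omega> \<in> U" by auto
    obtain R0 where R0: "\<And>\<nu>. \<nu> \<in> LF \<Longrightarrow> same_cells R0 (\<xi> \<omega>) \<nu> \<Longrightarrow> \<nu> \<in> U"
      using vague_open_cells[OF U \<omega>(2) xi_LF[OF \<omega>(1)]] by blast
    have "\<forall>\<nu>\<in>LF. has_cells R0 \<nu> (cells R0 \<omega>) \<longrightarrow> \<nu> \<in> U"
      using has_cells_same[OF has_cells_cells[OF \<omega>(1)]] R0 by blast
    thus "\<omega> \<in> (\<Union>R. \<Union>m\<in>{m. \<forall>\<nu>\<in>LF. has_cells R \<nu> m \<longrightarrow> \<nu> \<in> U}. {\<omega>\<in>space M. has_cells R (\<xi> \<omega>) m})"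
      using has_cells_cells[OF \<omega>(1)] \<omega>(1) by blast
  qed (use xi_LF in auto)
  also have "\<dots> \<in> sets M" by (intro sets.countable_UN' countable_UN) auto
  finally show ?thesis .
qed

lemma vague_continuous_measurable:
  fixes F :: "real measure \<Rightarrow> real"
  assumes "continuous_map vague_topology euclideanreal F"
  shows "(\<lambda>\<omega>. F (\<xi> \<omega>)) \<in> borel_measurable M"
proof (rule borel_measurableI)
  fix S :: "real set" assume "open S"
  hence "openin vague_topology {\<mu>\<in>topspace vague_topology. F \<mu> \<in> S}"
    by (intro openin_continuous_map_preimage[OF assms]) simp
  from vague_open_sets[OF this] have "{\<omega>\<in>space M. \<xi> \<omega> \<in> {\<mu>\<in>LF. F \<mu> \<in> S}} \<in> sets M" by (simp add: topspace_vague)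
  also have "{\<omega>\<in>space M. \<xi> \<omega> \<in> {\<mu>\<in>LF. F \<mu> \<in> S}} = (\<lambda>\<omega>. F (\<xi> \<omega>)) -` S \<inter> space M" using xi_LF by auto
  finally show "(\<lambda>\<omega>. F (\<xi> \<omega>)) -` S \<inter> space M \<in> sets M" .
qed

lemma finite_cells_tight:
  assumes "e > 0"
  shows "\<exists>S. finite S \<and> measure M {\<omega>\<in>space M. cells R \<omega> \<notin> S} < e"
proof -
  define A where "A K = {\<omega>\<in>space M. to_nat (cells R \<omega>) \<le> K}" for K
  have A[measurable]: "A K \<in> sets M" for K unfolding A_def by measurable
  have "(\<lambda>K. measure M (A K)) \<longlonglongrightarrow> measure M (\<Union>K. A K)"
    by (rule finite_Lim_measure_incseq) (auto simp: incseq_def A_def)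
  moreover have "(\<Union>K. A K) = space M" by (auto simp: A_def)
  ultimately have "(\<lambda>K. measure M (A K)) \<longlonglongrightarrow> 1" by (simp add: prob_space)
  hence "eventually (\<lambda>K. measure M (A K) > 1 - e) sequentially" using assms by (intro order_tendstoD(1)) auto
  then obtain K where K: "measure M (A K) > 1 - e" by (auto simp: eventually_sequentially)
  have "{\<omega>\<in>space M. cells R \<omega> \<notin> {m. to_nat m \<le> K}} = space M - A K" by (auto simp: A_def)
  hence "measure M {\<omega>\<in>space M. cells R \<omega> \<notin> {m. to_nat m \<le> K}} < e" using K by (simp add: prob_compl)
  moreover have "finite {m :: nat list. to_nat m \<le> K}"
    by (rule finite_imageD[of to_nat]) (auto intro: finite_subset[of _ "{..K}"] inj_on_subset[OF inj_to_nat])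
  ultimately show ?thesis by blast
qed

text \<open>The infimum of \<open>F\<close> over all measures with the cell counts of \<open>\<xi>\<close> at level \<open>R\<close> is a function of these
  counts and tends to \<open>F \<xi>\<close>. Lower bounds for the probabilities of count vectors suffice,
  since finitely many count vectors carry almost all the mass of the limit.\<close>

lemma weak_lower:
  fixes F :: "real measure \<Rightarrow> real" and A :: "nat \<Rightarrow> 'b set" and P :: "nat \<Rightarrow> 'b \<Rightarrow> real" and X :: "nat \<Rightarrow> 'b \<Rightarrow> real measure"
  assumes F: "continuous_map vague_topology euclideanreal F" "\<And>\<mu>. \<mu> \<in> LF \<Longrightarrow> 0 \<le> F \<mu>" "\<And>\<mu>. \<mu> \<in> LF \<Longrightarrow> F \<mu> \<le> C"
    and P: "\<forall>\<^sub>F n in sequentially. (\<forall>x\<in>A n. P n x \<ge> 0) \<and> P n summable_on A n \<and> infsum (P n) (A n) = 1"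
    and X: "\<And>n x. x \<in> A n \<Longrightarrow> X n x \<in> LF"
    and low: "\<And>R m d. R \<ge> 2 \<Longrightarrow> d > 0 \<Longrightarrow> length m = R - 1 \<Longrightarrow> 
       \<forall>\<^sub>F n in sequentially. infsum (P n) {x\<in>A n. has_cells R (X n x) m} \<ge> measure M {\<omega>\<in>space M. has_cells R (\<xi> \<omega>) m} - d"
    and e: "e > 0"
  shows "\<forall>\<^sub>F n in sequentially. infsum (\<lambda>x. P n x * F (X n x)) (A n) \<ge> (\<integral>\<omega>. F (\<xi> \<omega>) \<partial>M) - e"
proof -
  define V where "V R m = {\<nu>\<in>LF. has_cells R \<nu> m}" for R m
  \<comment> \<open>An infimum over the empty set is unspecified; the value 0 keeps \<open>G\<close>
    nonnegative and bounded.\<close>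
  define G where "G R m = (if V R m = {} then 0 else INF \<nu>\<in>V R m. F \<nu>)" for R m
  have bdd: "bdd_below (F ` V R m)" for R m using F(2) by (intro bdd_belowI[of _ 0]) (auto simp: V_def)
  have G_le: "G R m \<le> F \<nu>" if "\<nu> \<in> V R m" for R m \<nu>
    using that bdd by (auto simp: G_def intro!: cINF_lower)
  have G_0: "0 \<le> G R m" for R m
    using F(2) by (auto simp: G_def V_def intro!: cINF_greatest)
  obtain C' where C': "C' > 0" "\<And>\<mu>. \<mu> \<in> LF \<Longrightarrow> F \<mu> \<le> C'"
    using F(3) by (metis less_max_iff_disj max.coboundedI1 max.cobounded1 order.trans zero_less_one)
  have G_C: "G R m \<le> C'" for R m
  proof (cases "V R m = {}")
    case False
    then obtain \<nu> where "\<nu> \<in> V R m" by blast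
    thus ?thesis using G_le[of \<nu>] C'(2)[of \<nu>] by (force simp: V_def)
  qed (use C' in \<open>simp add: G_def\<close>)
  have Fm: "(\<lambda>\<omega>. F (\<xi> \<omega>)) \<in> borel_measurable M" by (rule vague_continuous_measurable[OF F(1)])
  have Gm: "(\<lambda>\<omega>. G R (cells R \<omega>)) \<in> borel_measurable M" for R by measurable
  have inV: "\<xi> \<omega> \<in> V R (cells R \<omega>)" if "\<omega> \<in> space M" for \<omega> R
    using that has_cells_cells xi_LF by (auto simp: V_def)
  have G_lim: "(\<lambda>R. G R (cells R \<omega>)) \<longlonglongrightarrow> F (\<xi> \<omega>)" if \<omega>: "\<omega> \<in> space M" for \<omega>
  proof (rule LIMSEQ_I)
    fix r :: real assume r: "r > 0"
    let ?U = "{\<mu>\<in>topspace vague_topology. F \<mu> \<in> {F (\<xi> \<omega>) - r/2<..}}"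
    have "openin vague_topology ?U"
      by (intro openin_continuous_map_preimage[OF F(1)]) simp
    moreover have "\<xi> \<omega> \<in> ?U" using xi_LF[OF \<omega>] r by (simp add: topspace_vague)
    ultimately obtain R0 where R0: "\<And>R \<nu>. R \<ge> R0 \<Longrightarrow> \<nu> \<in> LF \<Longrightarrow> same_cells R (\<xi> \<omega>) \<nu> \<Longrightarrow> \<nu> \<in> ?U"
      using vague_open_cells[of ?U "\<xi> \<omega>"] xi_LF[OF \<omega>] by blast
    have "norm (G R (cells R \<omega>) - F (\<xi> \<omega>)) < r" if "R \<ge> R0" for R
    proof -
      have "F \<nu> \<ge> F (\<xi> \<omega>) - r/2" if "\<nu> \<in> V R (cells R \<omega>)" for \<nu>
        using R0[OF \<open>R \<ge> R0\<close>, of \<nu>] that has_cells_same[OF has_cells_cells[OF \<omega>, of R]] by (auto simp: V_def)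
      hence "G R (cells R \<omega>) \<ge> F (\<xi> \<omega>) - r/2"
        using inV[OF \<omega>, of R] by (auto simp: G_def intro!: cINF_greatest)
      moreover have "G R (cells R \<omega>) \<le> F (\<xi> \<omega>)" by (rule G_le[OF inV[OF \<omega>]])
      ultimately show ?thesis using r by simp
    qed
    thus "\<exists>no. \<forall>n\<ge>no. norm (G n (cells n \<omega>) - F (\<xi> \<omega>)) < r" by blast
  qed
  have "(\<lambda>R. \<integral>\<omega>. G R (cells R \<omega>) \<partial>M) \<longlonglongrightarrow> (\<integral>\<omega>. F (\<xi> \<omega>) \<partial>M)"
  proof (rule integral_dominated_convergence[where w = "\<lambda>_. C'"])
    show "AE \<omega> in M. (\<lambda>R. G R (cells R \<omega>)) \<longlonglongrightarrow> F (\<xi> \<omega>)" using G_lim by (rule AE_I2)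
    show "AE \<omega> in M. norm (G R (cells R \<omega>)) \<le> C'" for R using G_0 G_C by auto
  qed (use Fm Gm in auto)
  hence "\<forall>\<^sub>F R in sequentially. (\<integral>\<omega>. G R (cells R \<omega>) \<partial>M) > (\<integral>\<omega>. F (\<xi> \<omega>) \<partial>M) - e/3"
    using e by (intro order_tendstoD(1)) auto
  then obtain R where R: "(\<integral>\<omega>. G R (cells R \<omega>) \<partial>M) > (\<integral>\<omega>. F (\<xi> \<omega>) \<partial>M) - e/3" "R \<ge> 2"
    using eventually_ge_at_top[of 2] eventually_happens'[OF sequentially_bot eventually_conj] by blast
  \<comment> \<open>The allowance \<open>e\<close> is spent in thirds: on passing to level
    \<open>R\<close>, on count vectors outside \<open>S0\<close>, and on the loss \<open>d\<close>
    for each vector in \<open>S\<close>.\<close>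
  obtain S0 where S0: "finite S0" "measure M {\<omega>\<in>space M. cells R \<omega> \<notin> S0} < e / (3 * C')"
    using finite_cells_tight[of "e / (3 * C')" R] e C' by auto
  define S where "S = {m\<in>S0. length m = R - 1}"
  have S: "finite S" using S0 by (simp add: S_def)
  have Slen: "cells R \<omega> \<in> S0 \<Longrightarrow> \<omega> \<in> space M \<Longrightarrow> cells R \<omega> \<in> S" for \<omega>
    using has_cells_cells[of \<omega> R] by (auto simp: S_def has_cells_def)
  define Q where "Q m = measure M {\<omega>\<in>space M. has_cells R (\<xi> \<omega>) m}" for m
  have "(\<integral>\<omega>. G R (cells R \<omega>) \<partial>M) \<le> (\<integral>\<omega>. (\<Sum>m\<in>S. G R m * indicator {\<omega>\<in>space M. has_cells R (\<xi> \<omega>) m} \<omega>) + C' * indicator {\<omega>\<in>space M. cells R \<omega> \<notin> S0} \<omega> \<partial>M)"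
  proof (rule integral_mono_AE)
    show "integrable M (\<lambda>\<omega>. G R (cells R \<omega>))"
      by (rule integrable_const_bound[of _ C']) (use G_0 G_C Gm in auto)
    show "integrable M (\<lambda>\<omega>. (\<Sum>m\<in>S. G R m * indicator {\<omega>\<in>space M. has_cells R (\<xi> \<omega>) m} \<omega>) + C' * indicator {\<omega>\<in>space M. cells R \<omega> \<notin> S0} \<omega>)"
      by (intro Bochner_Integration.integrable_add Bochner_Integration.integrable_sum integrable_mult_right integrable_real_indicator) (auto simp: less_top[symmetric])
    show "AE \<omega> in M. G R (cells R \<omega>) \<le> (\<Sum>m\<in>S. G R m * indicator {\<omega>\<in>space M. has_cells R (\<xi> \<omega>) m} \<omega>) + C' * indicator {\<omega>\<in>space M. cells R \<omega> \<notin> S0} \<omega>"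
    proof (rule AE_I2)
      fix \<omega> assume \<omega>: "\<omega> \<in> space M"
      have nn: "0 \<le> (\<Sum>m\<in>S. G R m * indicator {\<omega>\<in>space M. has_cells R (\<xi> \<omega>) m} \<omega>)"
        using G_0 by (intro sum_nonneg) auto
      show "G R (cells R \<omega>) \<le> (\<Sum>m\<in>S. G R m * indicator {\<omega>\<in>space M. has_cells R (\<xi> \<omega>) m} \<omega>) + C' * indicator {\<omega>\<in>space M. cells R \<omega> \<notin> S0} \<omega>"
      proof (cases "cells R \<omega> \<in> S0")
        case True
        have "G R (cells R \<omega>) = G R (cells R \<omega>) * indicator {\<omega>'\<in>space M. has_cells R (\<xi> \<omega>') (cells R \<omega>)} \<omega>"
          using \<omega> has_cells_cells by simp
        also have "\<dots> \<le> (\<Sum>m\<in>S. G R m * indicator {\<omega>\<in>space M. has_cells R (\<xi> \<omega>) m} \<omega>)"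
          using S Slen[OF True \<omega>] G_0 by (intro member_le_sum[of "cells R \<omega>" S "\<lambda>m. G R m * indicator {\<omega>\<in>space M. has_cells R (\<xi> \<omega>) m} \<omega>"]) auto
        finally show ?thesis using True by simp
      next
        case False
        thus ?thesis using nn G_C[of R "cells R \<omega>"] \<omega> by simp
      qed
    qed
  qed
  also have "\<dots> = (\<Sum>m\<in>S. G R m * Q m) + C' * measure M {\<omega>\<in>space M. cells R \<omega> \<notin> S0}"
    unfolding Q_def by (subst Bochner_Integration.integral_add) 
      (auto simp: less_top[symmetric] intro!: Bochner_Integration.integrable_sum)
  also have "C' * measure M {\<omega>\<in>space M. cells R \<omega> \<notin> S0} \<le> e / 3"
    using S0(2) C' by (simp add: field_simps)
  finally have main: "(\<integral>\<omega>. F (\<xi> \<omega>) \<partial>M) - 2 * e / 3 \<le> (\<Sum>m\<in>S. G R m * Q m)" using R(1) by simp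
  define d where "d = e / (3 * (C' * (real (card S) + 1)))"
  have d: "d > 0" using e C' by (simp add: d_def)
  have "\<forall>\<^sub>F n in sequentially. \<forall>m\<in>S. infsum (P n) {x\<in>A n. has_cells R (X n x) m} \<ge> Q m - d"
    unfolding Q_def using S R(2) d by (intro eventually_ball_finite ballI low) (auto simp: S_def)
  thus ?thesis using P
  proof eventually_elim
    case (elim n)
    define B where "B m = {x\<in>A n. has_cells R (X n x) m}" for m
    have Pn: "P n x \<ge> 0" if "x \<in> A n" for x using elim(2) that by blast
    have Ps: "P n summable_on A n" using elim(2) by blast
    have PF0: "0 \<le> P n x * F (X n x)" if "x \<in> A n" for x
      using Pn[OF that] F(2)[OF X[OF that]] by simp
    have PF: "(\<lambda>x. P n x * F (X n x)) summable_on A n"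
    proof (rule summable_on_comparison_test[where f = "\<lambda>x. C' * P n x"])
      show "(\<lambda>x. C' * P n x) summable_on A n" by (intro summable_on_cmult_right Ps)
      show "P n x * F (X n x) \<le> C' * P n x" if "x \<in> A n" for x
        using mult_right_mono[OF C'(2)[OF X[OF that]] Pn[OF that]] by (simp add: mult.commute)
    qed (use PF0 in auto)
    have PB: "P n summable_on B m" for m
      by (rule summable_on_subset_banach[OF Ps]) (auto simp: B_def)
    have "(\<Sum>m\<in>S. G R m * infsum (P n) (B m)) \<le> (\<Sum>m\<in>S. infsum (\<lambda>x. P n x * F (X n x)) (B m))"
    proof (rule sum_mono)
      fix m assume "m \<in> S"
      have "G R m * infsum (P n) (B m) = infsum (\<lambda>x. G R m * P n x) (B m)" by (rule infsum_cmult_right'[symmetric])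
      also have "\<dots> \<le> infsum (\<lambda>x. P n x * F (X n x)) (B m)"
      proof (rule infsum_mono)
        show "(\<lambda>x. G R m * P n x) summable_on B m" by (intro summable_on_cmult_right PB)
        show "(\<lambda>x. P n x * F (X n x)) summable_on B m" by (rule summable_on_subset_banach[OF PF]) (auto simp: B_def)
        show "G R m * P n x \<le> P n x * F (X n x)" if "x \<in> B m" for x
        proof -
          have "X n x \<in> V R m" "0 \<le> P n x" using that X Pn by (auto simp: B_def V_def)
          from mult_right_mono[OF G_le[OF this(1)] this(2)] show ?thesis by (simp only: mult.commute)
        qed
      qed
      finally show "G R m * infsum (P n) (B m) \<le> infsum (\<lambda>x. P n x * F (X n x)) (B m)" .
    qed
    also have "\<dots> = infsum (\<lambda>x. P n x * F (X n x)) (\<Union>m\<in>S. B m)"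
    proof (rule sum_infsum[OF S])
      show "(\<lambda>x. P n x * F (X n x)) summable_on B m" for m by (rule summable_on_subset_banach[OF PF]) (auto simp: B_def)
      show "B m \<inter> B m' = {}" if "m \<noteq> m'" for m m' using that has_cells_unique by (auto simp: B_def)
    qed
    also have "\<dots> \<le> infsum (\<lambda>x. P n x * F (X n x)) (A n)"
    proof (rule infsum_mono_neutral)
      show "(\<lambda>x. P n x * F (X n x)) summable_on (\<Union>m\<in>S. B m)" by (rule summable_on_subset_banach[OF PF]) (auto simp: B_def)
      show "0 \<le> P n x * F (X n x)" if "x \<in> A n - (\<Union>m\<in>S. B m)" for x using PF0 that by blast
    qed (use PF in \<open>auto simp: B_def\<close>)
    finally have 1: "(\<Sum>m\<in>S. G R m * infsum (P n) (B m)) \<le> infsum (\<lambda>x. P n x * F (X n x)) (A n)" .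
    have "(\<Sum>m\<in>S. G R m * Q m) - (\<Sum>m\<in>S. C' * d) \<le> (\<Sum>m\<in>S. G R m * infsum (P n) (B m))"
      unfolding sum_subtractf[symmetric]
    proof (rule sum_mono)
      fix m assume m: "m \<in> S"
      have "G R m * (Q m - d) \<le> G R m * infsum (P n) (B m)" using elim(1) m G_0 by (intro mult_left_mono) (auto simp: B_def)
      moreover have "G R m * d \<le> C' * d" using G_C d by (intro mult_right_mono) auto
      ultimately show "G R m * Q m - C' * d \<le> G R m * infsum (P n) (B m)" by (simp add: right_diff_distrib)
    qed
    moreover have "(\<Sum>m\<in>S. C' * d) \<le> e / 3"
    proof -
      have "(\<Sum>m\<in>S. C' * d) = real (card S) * (C' * d)" by simp
      also have "\<dots> \<le> (real (card S) + 1) * (C' * d)" using C' d by (intro mult_right_mono) auto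
      also have "\<dots> = e / 3"
      proof -
        have "k * (c * (e / (3 * (c * k)))) = e / 3" if "k > 0" "c > 0" for k c :: real using that by simp
        from this[of "real (card S) + 1" C'] show ?thesis using C'(1) by (simp only: d_def of_nat_0_le_iff add_nonneg_pos zero_less_one)
      qed
      finally show ?thesis .
    qed
    ultimately show ?case using main 1 by linarith
  qed
qed

text \<open>\<open>weak_lower\<close> asks for nonnegative functionals, so it is applied to
  \<open>F + C\<close> and \<open>C - F\<close>; as the weights have total 1, the constant can be
  subtracted again.\<close>

theorem weak_convergence:
  fixes F :: "real measure \<Rightarrow> real" and A :: "nat \<Rightarrow> 'b set" and P :: "nat \<Rightarrow> 'b \<Rightarrow> real" and X :: "nat \<Rightarrow> 'b \<Rightarrow> real measure"
  assumes F: "continuous_map vague_topology euclideanreal F" "\<And>\<mu>. \<mu> \<in> LF \<Longrightarrow> \<bar>F \<mu>\<bar> \<le> C"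
    and P: "\<forall>\<^sub>F n in sequentially. (\<forall>x\<in>A n. P n x \<ge> 0) \<and> P n summable_on A n \<and> infsum (P n) (A n) = 1"
    and X: "\<And>n x. x \<in> A n \<Longrightarrow> X n x \<in> LF"
    and low: "\<And>R m d. R \<ge> 2 \<Longrightarrow> d > 0 \<Longrightarrow> length m = R - 1 \<Longrightarrow> 
       \<forall>\<^sub>F n in sequentially. infsum (P n) {x\<in>A n. has_cells R (X n x) m} \<ge> measure M {\<omega>\<in>space M. has_cells R (\<xi> \<omega>) m} - d"
  shows "(\<lambda>n. infsum (\<lambda>x. P n x * F (X n x)) (A n)) \<longlonglongrightarrow> (\<integral>\<omega>. F (\<xi> \<omega>) \<partial>M)"
proof (rule tendstoI)
  fix e :: real assume e: "e > 0"
  have Fm: "(\<lambda>\<omega>. F (\<xi> \<omega>)) \<in> borel_measurable M" by (rule vague_continuous_measurable[OF F(1)])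
  have Fi: "integrable M (\<lambda>\<omega>. F (\<xi> \<omega>))"
    by (rule integrable_const_bound[of _ C]) (use F(2) xi_LF Fm in auto)
  have 1: "\<forall>\<^sub>F n in sequentially. infsum (\<lambda>x. P n x * (F (X n x) + C)) (A n) \<ge> (\<integral>\<omega>. F (\<xi> \<omega>) + C \<partial>M) - e/2"
  proof (rule weak_lower[where F = "\<lambda>\<mu>. F \<mu> + C" and C = "2 * C", OF _ _ _ P X low])
    show "continuous_map vague_topology euclideanreal (\<lambda>\<mu>. F \<mu> + C)"
      by (intro continuous_map_add F) simp
    show "0 \<le> F \<mu> + C" "F \<mu> + C \<le> 2 * C" if "\<mu> \<in> LF" for \<mu> using F(2)[OF that] by auto
  qed (use e in auto)
  have 2: "\<forall>\<^sub>F n in sequentially. infsum (\<lambda>x. P n x * (C - F (X n x))) (A n) \<ge> (\<integral>\<omega>. C - F (\<xi> \<omega>) \<partial>M) - e/2"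
  proof (rule weak_lower[where F = "\<lambda>\<mu>. C - F \<mu>" and C = "2 * C", OF _ _ _ P X low])
    show "continuous_map vague_topology euclideanreal (\<lambda>\<mu>. C - F \<mu>)"
      by (intro continuous_map_diff F) simp
    show "0 \<le> C - F \<mu>" "C - F \<mu> \<le> 2 * C" if "\<mu> \<in> LF" for \<mu> using F(2)[OF that] by auto
  qed (use e in auto)
  show "\<forall>\<^sub>F n in sequentially. dist (infsum (\<lambda>x. P n x * F (X n x)) (A n)) (\<integral>\<omega>. F (\<xi> \<omega>) \<partial>M) < e"
    using 1 2 P
  proof eventually_elim
    case (elim n)
    have CP: "((\<lambda>x. C * P n x) has_sum C * 1) (A n)"
      using elim by (intro has_sum_cmult_right) (metis has_sum_infsum)
    have PF: "(\<lambda>x. P n x * F (X n x)) summable_on A n"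
    proof (rule abs_summable_summable, rule summable_on_comparison_test[where f = "\<lambda>x. C * P n x"])
      show "(\<lambda>x. C * P n x) summable_on A n" using CP by (auto simp: summable_on_def)
      show "norm (P n x * F (X n x)) \<le> C * P n x" if "x \<in> A n" for x
        using mult_right_mono[OF F(2)[OF X[OF that]], of "P n x"] elim that by (simp add: abs_mult mult.commute)
    qed auto
    note hs = has_sum_infsum[OF PF]
    have "((\<lambda>x. P n x * F (X n x) + C * P n x) has_sum (infsum (\<lambda>x. P n x * F (X n x)) (A n) + C * 1)) (A n)"
      by (rule has_sum_add[OF hs CP])
    hence 3: "infsum (\<lambda>x. P n x * (F (X n x) + C)) (A n) = infsum (\<lambda>x. P n x * F (X n x)) (A n) + C"
      by (intro infsumI) (simp add: distrib_left mult.commute)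
    have "((\<lambda>x. C * P n x + - (P n x * F (X n x))) has_sum (C * 1 + - infsum (\<lambda>x. P n x * F (X n x)) (A n))) (A n)"
      by (rule has_sum_add[OF CP]) (simp add: has_sum_uminus hs)
    hence 4: "infsum (\<lambda>x. P n x * (C - F (X n x))) (A n) = C - infsum (\<lambda>x. P n x * F (X n x)) (A n)"
      by (intro infsumI) (simp add: right_diff_distrib mult.commute)
    have 5: "(\<integral>\<omega>. F (\<xi> \<omega>) + C \<partial>M) = (\<integral>\<omega>. F (\<xi> \<omega>) \<partial>M) + C" "(\<integral>\<omega>. C - F (\<xi> \<omega>) \<partial>M) = C - (\<integral>\<omega>. F (\<xi> \<omega>) \<partial>M)"
      using Fi by (auto simp: prob_space)
    show ?case using elim(1,2) e unfolding 3 4 5 by (simp add: dist_real_def)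
  qed
qed

end

section \<open>Poisson counts\<close>

lemma poisson_sums: "(\<lambda>n. poisson_pmf_real r n) sums 1"
proof -
  have "(\<lambda>n. exp (- r) * (r ^ n /\<^sub>R fact n)) sums (exp (- r) * exp r)"
    by (intro sums_mult exp_converges)
  thus ?thesis by (simp add: poisson_pmf_real_def exp_minus field_simps)
qed

lemma poisson_nonneg: "r \<ge> 0 \<Longrightarrow> poisson_pmf_real r n \<ge> 0"
  by (simp add: poisson_pmf_real_def)

lemma poisson_measurable [measurable]: "(\<lambda>x. poisson_pmf_real x n) \<in> borel_measurable borel"
  unfolding poisson_pmf_real_def by measurable

lemma poisson_add:
  "(\<Sum>b\<le>m. poisson_pmf_real x (m - b) * poisson_pmf_real y b) = poisson_pmf_real (x + y) m"
proof -
  have "(\<Sum>b\<le>m. poisson_pmf_real x (m - b) * poisson_pmf_real y b) 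
      = (\<Sum>b\<le>m. exp (- (x + y)) / fact m * (real (m choose b) * y ^ b * x ^ (m - b)))"
  proof (intro sum.cong refl)
    fix b assume "b \<in> {..m}"
    hence "real (m choose b) = fact m / (fact b * fact (m - b))" by (simp add: binomial_fact)
    moreover have "exp (- (x + y)) = exp (- x) * exp (- y)" by (simp add: exp_add[symmetric])
    ultimately show "poisson_pmf_real x (m - b) * poisson_pmf_real y b = exp (- (x + y)) / fact m * (real (m choose b) * y ^ b * x ^ (m - b))"
      by (simp add: poisson_pmf_real_def mult_ac)
  qed
  also have "\<dots> = exp (- (x + y)) / fact m * (y + x) ^ m"
    by (subst binomial_ring) (simp add: sum_distrib_left)
  finally show ?thesis by (simp add: poisson_pmf_real_def add.commute)
qed

text \<open>Inverse transform sampling: applied to a uniform \<open>u\<close> it is Poisson distributed with mean \<open>r\<close>,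
  jointly measurable in \<open>r\<close> and \<open>u\<close>.\<close>

definition pcount :: "real \<Rightarrow> real \<Rightarrow> nat" where
  "pcount r u = (LEAST n. u < (\<Sum>m\<le>n. poisson_pmf_real r m))"

lemma pcount_measurable [measurable]:
  assumes [measurable]: "f \<in> borel_measurable M" "g \<in> borel_measurable M"
  shows "(\<lambda>x. pcount (f x) (g x)) \<in> M \<rightarrow>\<^sub>M count_space UNIV"
  unfolding pcount_def poisson_pmf_real_def by measurable

text \<open>The partial sums increase to 1, so for \<open>u < 1\<close> the least index exists and
  the level sets are intervals whose lengths are the Poisson probabilities.\<close>

lemma pcount_eq_iff:
  assumes "r \<ge> 0" "0 \<le> u" "u < 1"
  shows "pcount r u = n \<longleftrightarrow> (\<Sum>m<n. poisson_pmf_real r m) \<le> u \<and> u < (\<Sum>m\<le>n. poisson_pmf_real r m)"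
proof -
  define s where "s n = (\<Sum>m\<le>n. poisson_pmf_real r m)" for n
  have "s \<longlonglongrightarrow> 1" using poisson_sums[of r] by (simp add: sums_def_le s_def[abs_def])
  hence "eventually (\<lambda>n. u < s n) sequentially" using assms(3) by (rule order_tendstoD(1))
  then obtain n0 where n0: "u < s n0" by (auto simp: eventually_sequentially)
  have mono: "s i \<le> s j" if "i \<le> j" for i j
    unfolding s_def using that assms(1) by (intro sum_mono2) (auto simp: poisson_nonneg)
  have L: "u < s (pcount r u)" "\<And>k. k < pcount r u \<Longrightarrow> \<not> u < s k"
    unfolding pcount_def s_def[symmetric] using n0 by (auto intro: LeastI dest: not_less_Least)
  have prev: "(\<Sum>m<n. poisson_pmf_real r m) \<le> u \<longleftrightarrow> (\<forall>k<n. \<not> u < s k)" for n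
  proof (cases n)
    case (Suc k)
    have "(\<Sum>m<n. poisson_pmf_real r m) = s k" by (simp add: Suc s_def lessThan_Suc_atMost)
    moreover have "s k \<le> u \<longleftrightarrow> (\<forall>l<Suc k. \<not> u < s l)"
    proof
      assume "s k \<le> u"
      thus "\<forall>l<Suc k. \<not> u < s l" using mono[of _ k] by (fastforce simp: less_Suc_eq_le)
    qed (auto simp: not_less)
    ultimately show ?thesis by (simp add: Suc)
  qed (use assms in simp)
  show ?thesis unfolding prev s_def[symmetric]
  proof
    assume "pcount r u = n"
    thus "(\<forall>k<n. \<not> u < s k) \<and> u < s n" using L by blast
  next
    assume a: "(\<forall>k<n. \<not> u < s k) \<and> u < s n"
    show "pcount r u = n"
    proof (rule linorder_cases[of "pcount r u" n])
      assume "pcount r u < n"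
      thus ?thesis using a L(1) by blast
    next
      assume "n < pcount r u"
      thus ?thesis using a L(2) by blast
    qed
  qed
qed

text \<open>The right end is excluded because the partial sums never exceed 1, so that
  \<open>pcount\<close> is unspecified at \<open>u = 1\<close>.\<close>

definition unif :: "real measure" where
  "unif = uniform_measure lborel {0..<1}"

lemma unif_sets [simp, measurable_cong]: "sets unif = sets borel" and unif_space [simp]: "space unif = UNIV"
  by (simp_all add: unif_def)

lemma unif_prob: "prob_space unif"
  unfolding unif_def by (rule prob_space_uniform_measure) auto

lemma pcount_law:
  assumes "r \<ge> 0"
  shows "emeasure unif {u. pcount r u = n} = ennreal (poisson_pmf_real r n)"
proof -
  have m: "{u. pcount r u = n} \<in> sets borel" by measurable
  have le1: "(\<Sum>m\<le>n. poisson_pmf_real r m) \<le> 1"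
    using sum_le_suminf[OF sums_summable[OF poisson_sums[of r]], of "{..n}"] poisson_nonneg[OF assms] sums_unique[OF poisson_sums[of r]]
    by simp
  have ge0: "(\<Sum>m<n. poisson_pmf_real r m) \<ge> 0" using poisson_nonneg[OF assms] by (intro sum_nonneg)
  have "{0..<1} \<inter> {u. pcount r u = n} = {(\<Sum>m<n. poisson_pmf_real r m)..<(\<Sum>m\<le>n. poisson_pmf_real r m)}"
    using pcount_eq_iff[OF assms] le1 ge0 by force
  hence "emeasure unif {u. pcount r u = n} = emeasure lborel {(\<Sum>m<n. poisson_pmf_real r m)..<(\<Sum>m\<le>n. poisson_pmf_real r m)}"
    unfolding unif_def using m by (subst emeasure_uniform_measure) (auto simp: divide_ennreal_def)
  also have "\<dots> = ennreal (poisson_pmf_real r n)"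
    using poisson_nonneg[OF assms] by (simp add: lessThan_Suc_atMost[symmetric])
  finally show ?thesis .
qed

text \<open>Thinning of a Poisson number of draws: terms with \<open>n < S\<close> vanish, and after
  a shift by \<open>S\<close> the draws outside all cells sum to the exponential series of
  \<open>r * b\<close>.\<close>

lemma poisson_multinom_mix:
  assumes \<beta>: "\<And>l. l < k \<Longrightarrow> \<beta> l \<ge> 0"
  shows "(\<lambda>n. poisson_pmf_real r n * multinom k \<beta> (1 - (\<Sum>l<k. \<beta> l)) n m) sums (\<Prod>l<k. poisson_pmf_real (r * \<beta> l) (m l))"
proof -
  define S where "S = (\<Sum>l<k. m l)"
  define b where "b = 1 - (\<Sum>l<k. \<beta> l)"
  define Q where "Q = (\<Prod>l<k. \<beta> l ^ m l / fact (m l))"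
  define f where "f n = poisson_pmf_real r n * multinom k \<beta> b n m" for n
  have "(\<lambda>i. exp (- r) * r ^ S * Q * ((r * b) ^ i /\<^sub>R fact i)) sums (exp (- r) * r ^ S * Q * exp (r * b))"
    by (intro sums_mult exp_converges)
  moreover have "exp (- r) * r ^ S * Q * ((r * b) ^ i /\<^sub>R fact i) = f (i + S)" for i
    by (simp add: f_def poisson_pmf_real_def multinom_def S_def[symmetric] Q_def[symmetric] power_add power_mult_distrib field_simps)
  ultimately have "(\<lambda>i. f (i + S)) sums (exp (- r) * r ^ S * Q * exp (r * b))" by simp
  moreover have "(\<Sum>i<S. f i) = 0"
    by (intro sum.neutral) (auto simp: f_def multinom_def S_def)
  ultimately have "f sums (exp (- r) * r ^ S * Q * exp (r * b))"
    using sums_iff_shift[of f S "exp (- r) * r ^ S * Q * exp (r * b)"] by simp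
  also have "exp (- r) * r ^ S * Q * exp (r * b) = (\<Prod>l<k. poisson_pmf_real (r * \<beta> l) (m l))"
  proof -
    have "(\<Prod>l<k. poisson_pmf_real (r * \<beta> l) (m l)) = (\<Prod>l<k. exp (- (r * \<beta> l)) * (r ^ m l * (\<beta> l ^ m l / fact (m l))))"
      by (intro prod.cong) (auto simp: poisson_pmf_real_def power_mult_distrib)
    also have "\<dots> = exp (\<Sum>l<k. - (r * \<beta> l)) * (r ^ S * Q)"
      unfolding prod.distrib by (simp add: exp_sum Q_def S_def power_sum)
    also have "(\<Sum>l<k. - (r * \<beta> l)) = - r + r * b"
      by (simp add: b_def sum_negf sum_distrib_left algebra_simps)
    finally show ?thesis unfolding exp_add by (simp only: ac_simps)
  qed
  finally show ?thesis by (simp add: f_def[abs_def] b_def)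
qed

section \<open>Counts of independent, identically distributed points\<close>

definition icount :: "nat \<Rightarrow> (nat \<Rightarrow> real) \<Rightarrow> real set \<Rightarrow> nat" where
  "icount n y B = (\<Sum>j<n. if y j \<in> B then 1 else 0)"

lemma icount_measurable [measurable]:
  assumes [measurable]: "sets \<nu> = sets borel" "B \<in> sets borel"
  shows "(\<lambda>y. icount n y B) \<in> PiM UNIV (\<lambda>_::nat. \<nu>) \<rightarrow>\<^sub>M count_space UNIV"
proof -
  have [measurable_cong]: "sets \<nu> = sets borel" by fact
  show ?thesis unfolding icount_def by measurable
qed

text \<open>Putting an independent draw in front preserves the law of the sequence
  (\<open>PiM_iter\<close>), so conditioning on the first point gives the recursion of
  \<open>multinom\<close>.\<close>

lemma iid_counts:
  assumes \<nu>: "prob_space \<nu>" "sets \<nu> = sets borel"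
    and B: "\<And>l. l < k \<Longrightarrow> B l \<in> sets borel" and disj: "disjoint_family_on B {..<k}"
  shows "measure (PiM UNIV (\<lambda>_::nat. \<nu>)) {y\<in>space (PiM UNIV (\<lambda>_::nat. \<nu>)). \<forall>l<k. icount n y (B l) = m l}
    = multinom k (\<lambda>l. measure \<nu> (B l)) (1 - (\<Sum>l<k. measure \<nu> (B l))) n m"
proof -
  interpret \<nu>: prob_space \<nu> by fact
  interpret sequence_space \<nu> by (rule sequence_space.intro, rule product_prob_spaceI) (rule \<nu>(1))
  have \<nu>sp: "space \<nu> = UNIV" using sets_eq_imp_space_eq[OF \<nu>(2)] by simp
  have Ssp: "space S = UNIV" by (simp add: space_PiM \<nu>sp)
  define E where "E n m = {y. \<forall>l<k. icount n y (B l) = m l}" for n m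
  have Em: "E n m \<in> sets S" for n m
  proof -
    have "{y\<in>space S. \<forall>l\<in>{..<k}. icount n y (B l) = m l} \<in> sets S"
    proof (rule sets.sets_Collect_finite_All)
      fix l assume "l \<in> {..<k}"
      hence "(\<lambda>y. icount n y (B l)) \<in> S \<rightarrow>\<^sub>M count_space UNIV" using B \<nu>(2) by (intro icount_measurable) auto
      from measurable_sets[OF this, of "{m l}"] show "{y\<in>space S. icount n y (B l) = m l} \<in> sets S"
        by (simp add: vimage_def Collect_conj_eq Int_commute)
    qed simp
    thus ?thesis by (simp add: E_def Ssp Ball_def)
  qed
  define rest where "rest = UNIV - (\<Union>l<k. B l)"
  have restm: "rest \<in> sets borel" unfolding rest_def using B by auto
  have mrest: "measure \<nu> rest = 1 - (\<Sum>l<k. measure \<nu> (B l))"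
  proof -
    have "measure \<nu> (\<Union>l<k. B l) = (\<Sum>l<k. measure \<nu> (B l))"
      using B \<nu>(2) disj by (intro \<nu>.finite_measure_finite_Union) auto
    moreover have "measure \<nu> rest = 1 - measure \<nu> (\<Union>l<k. B l)"
      using \<nu>.prob_compl[of "\<Union>l<k. B l"] B \<nu>(2) by (auto simp: rest_def \<nu>sp)
    ultimately show ?thesis by simp
  qed
  have step: "measure S (E (Suc n) m) = (1 - (\<Sum>l<k. measure \<nu> (B l))) * measure S (E n m) 
     + (\<Sum>i<k. if m i > 0 then measure \<nu> (B i) * measure S (E n (m(i := m i - 1))) else 0)" for n m
  proof -
    have ic: "icount (Suc n) (case_nat s y) C = (if s \<in> C then 1 else 0) + icount n y C" for s y C
      unfolding icount_def by (subst sum.lessThan_Suc_shift) simp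
    have meas_cn: "(\<lambda>(s, y). case_nat s y) \<in> \<nu> \<Otimes>\<^sub>M S \<rightarrow>\<^sub>M S" by measurable
    \<comment> \<open>\<open>a s\<close> is the probability of the event given that the first point
      is \<open>s\<close>; exactly one of its indicators is 1.\<close>
    define a where "a s = indicator rest s * measure S (E n m) + (\<Sum>i<k. indicator (B i) s * (if m i > 0 then measure S (E n (m(i := m i - 1))) else 0))" for s
    have hb: "has_bochner_integral \<nu> a (measure \<nu> rest * measure S (E n m) + (\<Sum>i<k. measure \<nu> (B i) * (if m i > 0 then measure S (E n (m(i := m i - 1))) else 0)))"
      unfolding a_def using restm B \<nu>(2)
      by (intro has_bochner_integral_add has_bochner_integral_sum has_bochner_integral_mult_left has_bochner_integral_real_indicator)
         (auto simp: \<nu>.emeasure_finite less_top[symmetric])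
    have slice: "measure S {y. case_nat s y \<in> E (Suc n) m} = a s" for s
    proof (cases "\<exists>i<k. s \<in> B i")
      case True
      then obtain i where i: "i < k" "s \<in> B i" by blast
      have sB: "s \<in> B l \<longleftrightarrow> l = i" if "l < k" for l using disj i that by (auto simp: disjoint_family_on_def)
      have "{y. case_nat s y \<in> E (Suc n) m} = (if m i > 0 then E n (m(i := m i - 1)) else {})"
      proof (cases "m i > 0")
        case m: True
        have "(\<forall>l<k. (if s \<in> B l then 1 else 0) + icount n y (B l) = m l) \<longleftrightarrow> (\<forall>l<k. icount n y (B l) = (m(i := m i - 1)) l)" for y
          using sB m i(1) by (intro all_cong imp_cong refl) auto
        thus ?thesis using m by (simp add: E_def ic)
      next
        case False
        thus ?thesis using i sB[of i] by (auto simp: E_def ic)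
      qed
      moreover have "a s = (if m i > 0 then measure S (E n (m(i := m i - 1))) else 0)"
      proof -
        have "(\<Sum>l<k. indicator (B l) s * (if m l > 0 then measure S (E n (m(l := m l - 1))) else 0)) 
            = (\<Sum>l<k. if l = i then (if m l > 0 then measure S (E n (m(l := m l - 1))) else 0) else 0)"
          using sB by (intro sum.cong refl) (auto simp: indicator_def)
        also have "\<dots> = (if m i > 0 then measure S (E n (m(i := m i - 1))) else 0)"
          using i(1) by (subst sum.delta) auto
        moreover have "s \<notin> rest" using i by (auto simp: rest_def)
        ultimately show ?thesis by (simp add: a_def)
      qed
      ultimately show ?thesis by simp
    next
      case False
      hence "{y. case_nat s y \<in> E (Suc n) m} = E n m" by (auto simp: E_def ic)
      moreover have "a s = measure S (E n m)" using False by (simp add: a_def rest_def)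
      ultimately show ?thesis by simp
    qed
    have a0: "a s \<ge> 0" for s unfolding slice[symmetric] by simp
    have "emeasure S (E (Suc n) m) = emeasure (distr (\<nu> \<Otimes>\<^sub>M S) S (\<lambda>(s, y). case_nat s y)) (E (Suc n) m)"
      by (simp add: PiM_iter)
    also have "\<dots> = emeasure (\<nu> \<Otimes>\<^sub>M S) ((\<lambda>(s, y). case_nat s y) -` E (Suc n) m \<inter> space (\<nu> \<Otimes>\<^sub>M S))"
      by (rule emeasure_distr[OF meas_cn Em])
    also have "\<dots> = (\<integral>\<^sup>+s. emeasure S (Pair s -` ((\<lambda>(s, y). case_nat s y) -` E (Suc n) m \<inter> space (\<nu> \<Otimes>\<^sub>M S))) \<partial>\<nu>)"
      by (rule P.emeasure_pair_measure_alt) (rule measurable_sets[OF meas_cn Em])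
    also have "\<dots> = (\<integral>\<^sup>+s. ennreal (a s) \<partial>\<nu>)"
    proof (rule nn_integral_cong)
      fix s
      have "Pair s -` ((\<lambda>(s, y). case_nat s y) -` E (Suc n) m \<inter> space (\<nu> \<Otimes>\<^sub>M S)) = {y. case_nat s y \<in> E (Suc n) m}"
        by (auto simp: space_pair_measure \<nu>sp Ssp)
      thus "emeasure S (Pair s -` ((\<lambda>(s, y). case_nat s y) -` E (Suc n) m \<inter> space (\<nu> \<Otimes>\<^sub>M S))) = ennreal (a s)"
        by (simp add: P.emeasure_eq_measure slice)
    qed
    also have "\<dots> = ennreal (\<integral>s. a s \<partial>\<nu>)"
      using hb a0 by (intro nn_integral_eq_integral) (auto simp: has_bochner_integral_iff)
    finally have "measure S (E (Suc n) m) = (\<integral>s. a s \<partial>\<nu>)"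
      using a0 by (simp add: P.emeasure_eq_measure integral_nonneg)
    also have "\<dots> = measure \<nu> rest * measure S (E n m) + (\<Sum>i<k. measure \<nu> (B i) * (if m i > 0 then measure S (E n (m(i := m i - 1))) else 0))"
      using hb by (simp add: has_bochner_integral_iff)
    finally show ?thesis unfolding mrest by (simp add: if_distrib cong: if_cong)
  qed
  have "measure S (E n m) = multinom k (\<lambda>l. measure \<nu> (B l)) (1 - (\<Sum>l<k. measure \<nu> (B l))) n m"
  proof (rule multinom_unique[where g = "\<lambda>n m. measure S (E n m)", OF _ step])
    fix m
    have "E 0 m = (if \<forall>i<k. m i = 0 then space S else {})" by (auto simp: E_def icount_def Ssp)
    thus "measure S (E 0 m) = (if \<forall>i<k. m i = 0 then 1 else 0)" using P.prob_space by auto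
  qed
  thus ?thesis by (simp add: E_def Ssp)
qed

text \<open>Splitting by the value of \<open>pcount\<close> gives disjoint rectangles, to which the
  product formula and then \<open>poisson_multinom_mix\<close> apply.\<close>

lemma poisson_piece:
  fixes k :: nat
  assumes \<nu>: "prob_space \<nu>" "sets \<nu> = sets borel" and r: "r \<ge> 0"
    and B: "\<And>l. l < k \<Longrightarrow> B l \<in> sets borel" and disj: "disjoint_family_on B {..<k}"
  shows "{x. \<forall>l<k. icount (pcount r (fst x)) (snd x) (B l) = m l} \<in> sets (unif \<Otimes>\<^sub>M PiM UNIV (\<lambda>_::nat. \<nu>))" (is ?th1)
    and "measure (unif \<Otimes>\<^sub>M PiM UNIV (\<lambda>_::nat. \<nu>)) {x. \<forall>l<k. icount (pcount r (fst x)) (snd x) (B l) = m l}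
      = (\<Prod>l<k. poisson_pmf_real (r * measure \<nu> (B l)) (m l))" (is ?th2)
proof -
  interpret \<nu>: prob_space \<nu> by fact
  interpret S: prob_space "PiM UNIV (\<lambda>_::nat. \<nu>)" by (rule prob_space_PiM) (rule \<nu>(1))
  interpret U: prob_space unif by (rule unif_prob)
  interpret US: pair_prob_space unif "PiM UNIV (\<lambda>_::nat. \<nu>)" ..
  have \<nu>sp: "space \<nu> = UNIV" using sets_eq_imp_space_eq[OF \<nu>(2)] by simp
  have Ssp: "space (PiM UNIV (\<lambda>_::nat. \<nu>)) = UNIV" by (simp add: space_PiM \<nu>sp)
  define E where "E n = {y. \<forall>l<k. icount n y (B l) = m l}" for n
  have Em: "E n \<in> sets (PiM UNIV (\<lambda>_::nat. \<nu>))" for n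
  proof -
    have "{y\<in>space (PiM UNIV (\<lambda>_::nat. \<nu>)). \<forall>l\<in>{..<k}. icount n y (B l) = m l} \<in> sets (PiM UNIV (\<lambda>_::nat. \<nu>))"
    proof (rule sets.sets_Collect_finite_All)
      fix l assume "l \<in> {..<k}"
      hence "(\<lambda>y. icount n y (B l)) \<in> PiM UNIV (\<lambda>_::nat. \<nu>) \<rightarrow>\<^sub>M count_space UNIV" using B \<nu>(2) by (intro icount_measurable) auto
      from measurable_sets[OF this, of "{m l}"] show "{y\<in>space (PiM UNIV (\<lambda>_::nat. \<nu>)). icount n y (B l) = m l} \<in> sets (PiM UNIV (\<lambda>_::nat. \<nu>))"
        by (simp add: vimage_def Collect_conj_eq Int_commute)
    qed simp
    thus ?thesis by (simp add: E_def Ssp Ball_def)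
  qed
  have Um: "{u. pcount r u = n} \<in> sets unif" for n
  proof -
    have "{u. pcount r u = n} \<in> sets borel" by measurable
    thus ?thesis by simp
  qed
  have eq: "{x. \<forall>l<k. icount (pcount r (fst x)) (snd x) (B l) = m l} = (\<Union>n. {u. pcount r u = n} \<times> E n)"
    by (auto simp: E_def)
  show ?th1 unfolding eq using Um Em by (intro sets.countable_UN) auto
  have "(\<lambda>n. measure (unif \<Otimes>\<^sub>M PiM UNIV (\<lambda>_::nat. \<nu>)) ({u. pcount r u = n} \<times> E n)) sums 
     measure (unif \<Otimes>\<^sub>M PiM UNIV (\<lambda>_::nat. \<nu>)) (\<Union>n. {u. pcount r u = n} \<times> E n)"
    using Um Em by (intro US.P.finite_measure_UNION) (auto simp: disjoint_family_on_def)
  moreover have "measure (unif \<Otimes>\<^sub>M PiM UNIV (\<lambda>_::nat. \<nu>)) ({u. pcount r u = n} \<times> E n) 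
     = poisson_pmf_real r n * multinom k (\<lambda>l. measure \<nu> (B l)) (1 - (\<Sum>l<k. measure \<nu> (B l))) n m" for n
  proof -
    have "measure (unif \<Otimes>\<^sub>M PiM UNIV (\<lambda>_::nat. \<nu>)) ({u. pcount r u = n} \<times> E n) = measure unif {u. pcount r u = n} * measure (PiM UNIV (\<lambda>_::nat. \<nu>)) (E n)"
      using S.emeasure_pair_measure_Times[OF Um Em, of n] by (simp add: measure_def enn2real_mult)
    also have "measure unif {u. pcount r u = n} = poisson_pmf_real r n"
      using pcount_law[OF r] poisson_nonneg[OF r] by (simp add: measure_def)
    also have "measure (PiM UNIV (\<lambda>_::nat. \<nu>)) (E n) = multinom k (\<lambda>l. measure \<nu> (B l)) (1 - (\<Sum>l<k. measure \<nu> (B l))) n m"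
      using iid_counts[OF \<nu> B disj, of n m] by (simp add: E_def Ssp)
    finally show ?thesis .
  qed
  moreover have "(\<lambda>n. poisson_pmf_real r n * multinom k (\<lambda>l. measure \<nu> (B l)) (1 - (\<Sum>l<k. measure \<nu> (B l))) n m) sums
     (\<Prod>l<k. poisson_pmf_real (r * measure \<nu> (B l)) (m l))"
    by (rule poisson_multinom_mix) simp
  ultimately show ?th2 unfolding eq by (metis (no_types, lifting) sums_cong sums_unique2)
qed

section \<open>Construction of the Cox process\<close>

text \<open>Independence is carried through the induction by a joint event: the first
  \<open>I\<close> pieces have total counts \<open>m\<close>, and the pieces from \<open>I\<close>
  up to \<open>J\<close> have individually prescribed counts. Each step moves one piece from the
  second group into the total, where Poisson laws convolve.\<close>

lemma poisson_superposition:
  fixes Mi :: "nat \<Rightarrow> 'b measure" and V :: "nat \<Rightarrow> 'b \<Rightarrow> nat \<Rightarrow> nat" and k :: nat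
  assumes Mi: "\<And>i. prob_space (Mi i)"
    and ev: "\<And>i a. {x\<in>space (Mi i). \<forall>l<k. V i x l = a l} \<in> sets (Mi i)"
    and law: "\<And>i a. measure (Mi i) {x\<in>space (Mi i). \<forall>l<k. V i x l = a l} = (\<Prod>l<k. poisson_pmf_real (rt i l) (a l))"
    and nn: "\<And>i l. rt i l \<ge> 0"
  shows "measure (PiM UNIV Mi) {\<omega>\<in>space (PiM UNIV Mi). \<forall>l<k. (\<Sum>i<I. V i (\<omega> i) l) = m l}
    = (\<Prod>l<k. poisson_pmf_real (\<Sum>i<I. rt i l) (m l))"
proof -
  interpret product_prob_space Mi UNIV by (rule product_prob_spaceI) (rule Mi)
  let ?P = "PiM UNIV Mi"
  define E where "E I J m a = {\<omega>\<in>space ?P. (\<forall>l<k. (\<Sum>i<I. V i (\<omega> i) l) = m l) \<and> (\<forall>i\<in>{I..<J}. \<forall>l<k. V i (\<omega> i) l = a i l)}"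
    for I J and m :: "nat \<Rightarrow> nat" and a :: "nat \<Rightarrow> nat \<Rightarrow> nat"
  have claim: "E I J m a \<in> sets ?P \<and> measure ?P (E I J m a) = (\<Prod>l<k. poisson_pmf_real (\<Sum>i<I. rt i l) (m l)) * (\<Prod>i\<in>{I..<J}. \<Prod>l<k. poisson_pmf_real (rt i l) (a i l))"
    if "I \<le> J" for I J m a
    using that
  proof (induction I arbitrary: m a)
    case 0
    define X where "X i = {x\<in>space (Mi i). \<forall>l<k. V i x l = a i l}" for i
    have col: "emeasure ?P {\<omega>\<in>space ?P. \<forall>i\<in>{0..<J}. \<omega> i \<in> X i} = (\<Prod>i\<in>{0..<J}. emeasure (Mi i) (X i))"
      by (rule emeasure_PiM_Collect) (auto simp: X_def ev)
    have eq: "{\<omega>\<in>space ?P. \<forall>i\<in>{0..<J}. \<omega> i \<in> X i} = {\<omega>\<in>space ?P. \<forall>i\<in>{0..<J}. \<forall>l<k. V i (\<omega> i) l = a i l}"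
      by (auto simp: X_def space_PiM PiE_iff)
    have meas: "{\<omega>\<in>space ?P. \<forall>i\<in>{0..<J}. \<omega> i \<in> X i} \<in> sets ?P"
    proof (rule sets.sets_Collect_finite_All)
      fix i assume "i \<in> {0..<J}"
      have "(\<lambda>\<omega>. \<omega> i) \<in> ?P \<rightarrow>\<^sub>M Mi i" by (rule measurable_component_singleton) simp
      hence "(\<lambda>\<omega>. \<omega> i) -` X i \<inter> space ?P \<in> sets ?P" by (rule measurable_sets) (simp only: X_def ev)
      moreover have "(\<lambda>\<omega>. \<omega> i) -` X i \<inter> space ?P = {\<omega>\<in>space ?P. \<omega> i \<in> X i}" by blast
      ultimately show "{\<omega>\<in>space ?P. \<omega> i \<in> X i} \<in> sets ?P" by simp
    qed simp
    show ?case
    proof (cases "\<forall>l<k. m l = 0")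
      case True
      have E0: "E 0 J m a = {\<omega>\<in>space ?P. \<forall>i\<in>{0..<J}. \<omega> i \<in> X i}" unfolding eq using True by (auto simp: E_def)
      have "ennreal (measure ?P (E 0 J m a)) = (\<Prod>i\<in>{0..<J}. ennreal (measure (Mi i) (X i)))"
        unfolding E0 P.emeasure_eq_measure[symmetric] col by (simp add: M.emeasure_eq_measure)
      also have "\<dots> = ennreal (\<Prod>i\<in>{0..<J}. measure (Mi i) (X i))" by (rule prod_ennreal) simp
      finally have "measure ?P (E 0 J m a) = (\<Prod>i\<in>{0..<J}. measure (Mi i) (X i))" by (simp add: prod_nonneg)
      also have "\<dots> = (\<Prod>i\<in>{0..<J}. \<Prod>l<k. poisson_pmf_real (rt i l) (a i l))" by (simp only: X_def law)
      moreover have "(\<Prod>l<k. poisson_pmf_real (\<Sum>i<0. rt i l) (m l)) = 1"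
        using True by (intro prod.neutral) (auto simp: poisson_pmf_real_def)
      ultimately show ?thesis using meas by (simp only: E0 mult_1_left)
    next
      case False
      then obtain l where l: "l < k" "m l \<noteq> 0" by blast
      hence "E 0 J m a = {}" by (auto simp: E_def)
      moreover have "(\<Prod>l<k. poisson_pmf_real (\<Sum>i<0. rt i l) (m l)) = 0"
        using l by (intro prod_zero) (auto simp: poisson_pmf_real_def intro!: bexI[of _ l])
      ultimately show ?thesis by simp
    qed
  next
    case (Suc I)
    \<comment> \<open>All possible shares of piece \<open>I\<close> in the totals \<open>m\<close>,
      taken as extensional functions so that each occurs once.\<close>
    define D where "D = PiE {..<k} (\<lambda>l. {..m l})"
    define m' where "m' b l = m l - b l" for b l
    have finD: "finite D" unfolding D_def by (intro finite_PiE) auto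
    have ins: "{I..<J} = insert I {Suc I..<J}" using Suc.prems by auto
    have eq: "E (Suc I) J m a = (\<Union>b\<in>D. E I J (m' b) (a(I := b)))"
    proof (intro equalityI subsetI)
      fix \<omega> assume \<omega>: "\<omega> \<in> E (Suc I) J m a"
      define b where "b = restrict (\<lambda>l. V I (\<omega> I) l) {..<k}"
      have s: "(\<Sum>i<I. V i (\<omega> i) l) + V I (\<omega> I) l = m l" if "l < k" for l using \<omega> that by (simp add: E_def)
      have "b \<in> D" using s by (auto simp: D_def b_def) (metis le_add2)
      moreover have "\<omega> \<in> E I J (m' b) (a(I := b))"
        unfolding E_def ins using \<omega> s by (auto simp: E_def m'_def b_def) (metis add_diff_cancel_right')
      ultimately show "\<omega> \<in> (\<Union>b\<in>D. E I J (m' b) (a(I := b)))" by blast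
    next
      fix \<omega> assume "\<omega> \<in> (\<Union>b\<in>D. E I J (m' b) (a(I := b)))"
      then obtain b where b: "b \<in> D" "\<omega> \<in> E I J (m' b) (a(I := b))" by blast
      have "(\<Sum>i<Suc I. V i (\<omega> i) l) = m l" if "l < k" for l
      proof -
        have "(\<Sum>i<I. V i (\<omega> i) l) = m l - b l" "V I (\<omega> I) l = b l" using b(2) that Suc.prems by (auto simp: E_def m'_def ins)
        moreover have "b l \<le> m l" using b(1) that by (auto simp: D_def)
        ultimately show ?thesis by simp
      qed
      moreover have "V i (\<omega> i) l = a i l" if "i \<in> {Suc I..<J}" "l < k" for i l
        using b(2) that by (force simp: E_def ins)
      ultimately show "\<omega> \<in> E (Suc I) J m a" using b(2) by (auto simp: E_def)
    qed
    have disj: "disjoint_family_on (\<lambda>b. E I J (m' b) (a(I := b))) D"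
    proof -
      have "b = b'" if "b \<in> D" "b' \<in> D" "\<omega> \<in> E I J (m' b) (a(I := b))" "\<omega> \<in> E I J (m' b') (a(I := b'))" for b b' \<omega>
      proof (rule PiE_ext[of b "{..<k}" "\<lambda>l. {..m l}" b'])
        fix l assume "l \<in> {..<k}"
        thus "b l = b' l" using that(3,4) by (auto simp: E_def ins)
      qed (use that in \<open>auto simp: D_def\<close>)
      thus ?thesis unfolding disjoint_family_on_def by blast
    qed
    have IH: "E I J (m' b) (a(I := b)) \<in> sets ?P" 
      "measure ?P (E I J (m' b) (a(I := b))) = (\<Prod>l<k. poisson_pmf_real (\<Sum>i<I. rt i l) (m' b l)) * (\<Prod>i\<in>{I..<J}. \<Prod>l<k. poisson_pmf_real (rt i l) ((a(I := b)) i l))" for b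
      using Suc.IH[OF Suc_leD[OF Suc.prems], of "m' b" "a(I := b)"] by blast+
    have meas: "E (Suc I) J m a \<in> sets ?P" unfolding eq using finD IH(1) by (intro sets.finite_UN) auto
    have "measure ?P (E (Suc I) J m a) = (\<Sum>b\<in>D. measure ?P (E I J (m' b) (a(I := b))))"
      unfolding eq by (rule P.finite_measure_finite_Union[OF finD _ disj]) (use IH(1) in auto)
    also have "\<dots> = (\<Sum>b\<in>D. (\<Prod>l<k. poisson_pmf_real (\<Sum>i<I. rt i l) (m l - b l) * poisson_pmf_real (rt I l) (b l)) * (\<Prod>i\<in>{Suc I..<J}. \<Prod>l<k. poisson_pmf_real (rt i l) (a i l)))"
    proof (intro sum.cong refl)
      fix b assume "b \<in> D"
      have "(\<Prod>i\<in>{I..<J}. \<Prod>l<k. poisson_pmf_real (rt i l) ((a(I := b)) i l)) 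
        = (\<Prod>l<k. poisson_pmf_real (rt I l) (b l)) * (\<Prod>i\<in>{Suc I..<J}. \<Prod>l<k. poisson_pmf_real (rt i l) (a i l))"
        unfolding ins by (subst prod.insert) (auto intro!: prod.cong)
      thus "measure ?P (E I J (m' b) (a(I := b))) = (\<Prod>l<k. poisson_pmf_real (\<Sum>i<I. rt i l) (m l - b l) * poisson_pmf_real (rt I l) (b l)) * (\<Prod>i\<in>{Suc I..<J}. \<Prod>l<k. poisson_pmf_real (rt i l) (a i l))"
        unfolding IH(2) m'_def by (simp only: prod.distrib mult.assoc)
    qed
    also have "\<dots> = (\<Sum>b\<in>D. \<Prod>l<k. poisson_pmf_real (\<Sum>i<I. rt i l) (m l - b l) * poisson_pmf_real (rt I l) (b l)) * (\<Prod>i\<in>{Suc I..<J}. \<Prod>l<k. poisson_pmf_real (rt i l) (a i l))"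
      by (rule sum_distrib_right[symmetric])
    also have "(\<Sum>b\<in>D. \<Prod>l<k. poisson_pmf_real (\<Sum>i<I. rt i l) (m l - b l) * poisson_pmf_real (rt I l) (b l)) 
       = (\<Prod>l<k. \<Sum>c\<le>m l. poisson_pmf_real (\<Sum>i<I. rt i l) (m l - c) * poisson_pmf_real (rt I l) c)"
      unfolding D_def by (rule prod_sum_PiE[symmetric]) auto
    also have "\<dots> = (\<Prod>l<k. poisson_pmf_real (\<Sum>i<Suc I. rt i l) (m l))"
      by (simp add: poisson_add)
    finally show ?case using meas by blast
  qed
  have eq: "E I I m (\<lambda>_ _. 0) = {\<omega>\<in>space ?P. \<forall>l<k. (\<Sum>i<I. V i (\<omega> i) l) = m l}" by (auto simp: E_def)
  show ?thesis using conjunct2[OF claim[OF order_refl, of I m "\<lambda>_ _. 0"]]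
    unfolding eq by (simp only: atLeastLessThan_empty[OF order_refl] prod.empty mult_1_right)
qed

lemma gamma_dens_nonneg: "\<alpha> > -1 \<Longrightarrow> gamma_dens \<alpha> z \<ge> 0"
  unfolding gamma_dens_def using Gamma_real_pos[of "\<alpha> + 1"] by auto

lemma gamma_dens_measurable [measurable]: "gamma_dens \<alpha> \<in> borel_measurable borel"
  unfolding gamma_dens_def by measurable

lemma gamma_dens_prob:
  assumes "\<alpha> > -1"
  shows "prob_space (density lborel (\<lambda>z. ennreal (gamma_dens \<alpha> z)))"
proof (rule prob_spaceI)
  have G: "Gamma (\<alpha> + 1) > 0" using assms by (intro Gamma_real_pos) auto
  have "has_bochner_integral lborel (\<lambda>t. indicator {0<..} t * (t powr \<alpha> * exp (- t)) / Gamma (\<alpha> + 1)) (Gamma (\<alpha> + 1) / Gamma (\<alpha> + 1))"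
    using Gamma_has_bochner_integral[of "\<alpha> + 1"] assms by (intro has_bochner_integral_divide_zero) simp
  also have "(\<lambda>t. indicator {0<..} t * (t powr \<alpha> * exp (- t)) / Gamma (\<alpha> + 1)) = gamma_dens \<alpha>"
    by (auto simp: gamma_dens_def fun_eq_iff)
  finally have "has_bochner_integral lborel (gamma_dens \<alpha>) 1" using G by simp
  hence "(\<integral>\<^sup>+z. ennreal (gamma_dens \<alpha> z) \<partial>lborel) = 1"
    using gamma_dens_nonneg[OF assms] by (subst nn_integral_eq_integral) (auto simp: has_bochner_integral_iff)
  thus "emeasure (density lborel (\<lambda>z. ennreal (gamma_dens \<alpha> z))) (space (density lborel (\<lambda>z. ennreal (gamma_dens \<alpha> z)))) = 1"
    by (simp add: emeasure_density)
qed

text \<open>Shells exhaust the points above 0 and up to 1 by pieces on which a locally finite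
  measure is finite, so infinite mass near 0 can be treated piece by piece.\<close>

definition shell :: "nat \<Rightarrow> real set" where
  "shell i = {1 / real (i + 2)<..1 / real (i + 1)}"

lemma shell_borel [measurable]: "shell i \<in> sets borel"
  by (simp add: shell_def)

lemma shell_range: "shell i \<subseteq> {1 / real (i + 2)..1}" "shell i \<subseteq> {0<..1}"
proof -
  have "1 / real (i + 2) < x \<and> 0 < x \<and> x \<le> 1" if "x \<in> shell i" for x
  proof -
    have "1 / real (i + 2) < x" "x \<le> 1 / real (i + 1)" using that unfolding shell_def by simp_all
    moreover have "1 / real (i + 1) \<le> 1" "0 < 1 / real (i + 2)" by simp_all
    ultimately show ?thesis by linarith
  qed
  thus "shell i \<subseteq> {1 / real (i + 2)..1}" "shell i \<subseteq> {0<..1}" by (simp_all add: subset_iff less_imp_le)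
qed

lemma shell_disjoint: "i \<noteq> j \<Longrightarrow> shell i \<inter> shell j = {}"
proof -
  have "\<not> (x \<in> shell i \<and> x \<in> shell j)" if "i < j" for i j x
  proof -
    have "1 / real (j + 1) \<le> 1 / real (i + 2)" using that by (intro divide_left_mono) auto
    thus ?thesis by (auto simp: shell_def)
  qed
  thus "i \<noteq> j \<Longrightarrow> shell i \<inter> shell j = {}" by (meson disjoint_iff linorder_neqE_nat)
qed

text \<open>A set bounded below by \<open>a\<close> meets only finitely many shells, which turns its
  count into a finite sum.\<close>

lemma shell_cover:
  assumes "0 < a" "a \<le> x" "x \<le> 1"
  shows "\<exists>i<nat \<lceil>1 / a\<rceil>. x \<in> shell i"
proof -
  define k where "k = nat \<lfloor>1 / x\<rfloor>"
  have x: "0 < x" "1 \<le> 1 / x" using assms by auto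
  have k: "real k \<le> 1 / x" "1 / x < real k + 1" "k \<ge> 1" unfolding k_def using x(2) by linarith+
  have "1 / x \<le> 1 / a" using assms by (intro divide_left_mono) auto
  hence "k \<le> nat \<lceil>1 / a\<rceil>" using k(1) by linarith
  moreover have "x \<in> shell (k - 1)"
    unfolding shell_def using k x(1) by (auto simp: of_nat_diff field_simps)
  ultimately show ?thesis using k(3) by (intro exI[of _ "k - 1"]) auto
qed

lemma icount_eq_card: "icount n y B = card {j. j < n \<and> y j \<in> B}"
  unfolding icount_def by (simp add: sum.If_cases) (intro arg_cong[of _ _ card], auto)

locale cox_construction =
  fixes \<Lambda> :: "real measure" and \<alpha> :: real
  assumes Lambda: "\<Lambda> \<in> LF" and alpha: "\<alpha> > -1"
begin

definition rate :: "nat \<Rightarrow> real" where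
  "rate i = measure \<Lambda> (shell i)"

text \<open>On a shell of mass zero no point is ever drawn, so the law there is arbitrary.\<close>

definition \<nu> :: "nat \<Rightarrow> real measure" where
  "\<nu> i = (if rate i = 0 then return borel 0 else uniform_measure \<Lambda> (shell i))"

lemma Lambda_finite: "emeasure \<Lambda> (B \<inter> shell i) < \<infinity>"
  by (rule LF_finite[OF Lambda, of "1 / real (i + 2)"]) (use shell_range in auto)

lemma rate_nonneg: "rate i \<ge> 0"
  by (simp add: rate_def)

lemma emeasure_rate: "emeasure \<Lambda> (shell i) = ennreal (rate i)"
  using Lambda_finite[of UNIV i] by (simp add: rate_def emeasure_eq_ennreal_measure less_top)

lemma \<nu>_sets [measurable_cong, simp]: "sets (\<nu> i) = sets borel"
  by (simp add: \<nu>_def LF_sets[OF Lambda])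

lemma \<nu>_space [simp]: "space (\<nu> i) = UNIV"
  using sets_eq_imp_space_eq[OF \<nu>_sets[of i]] by simp

lemma \<nu>_prob: "prob_space (\<nu> i)"
proof (cases "rate i = 0")
  case True
  thus ?thesis by (simp add: \<nu>_def prob_space_return)
next
  case False
  hence "emeasure \<Lambda> (shell i) \<noteq> 0" "emeasure \<Lambda> (shell i) \<noteq> \<infinity>" using rate_nonneg[of i] by (auto simp: emeasure_rate)
  thus ?thesis using False by (simp add: \<nu>_def prob_space_uniform_measure)
qed

lemma rate_\<nu>:
  assumes "B \<in> sets borel"
  shows "rate i * measure (\<nu> i) (B \<inter> shell i) = measure \<Lambda> (B \<inter> shell i)"
proof (cases "rate i = 0")
  case True
  have "emeasure \<Lambda> (B \<inter> shell i) \<le> emeasure \<Lambda> (shell i)" using LF_sets[OF Lambda] by (intro emeasure_mono) auto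
  hence "emeasure \<Lambda> (B \<inter> shell i) = 0" using True by (simp add: emeasure_rate)
  thus ?thesis using True by (simp add: measure_def)
next
  case False
  have s: "shell i \<in> sets \<Lambda>" "B \<inter> shell i \<in> sets \<Lambda>" using assms LF_sets[OF Lambda] by auto
  have "measure (\<nu> i) (B \<inter> shell i) = measure \<Lambda> (shell i \<inter> (B \<inter> shell i)) / measure \<Lambda> (shell i)"
    using False s emeasure_rate[of i] rate_nonneg[of i] by (simp add: \<nu>_def measure_uniform_measure)
  also have "shell i \<inter> (B \<inter> shell i) = B \<inter> shell i" by auto
  finally show ?thesis using False by (simp add: rate_def)
qed

definition pieces :: "(nat \<Rightarrow> real \<times> (nat \<Rightarrow> real)) measure" where
  "pieces = PiM UNIV (\<lambda>i. unif \<Otimes>\<^sub>M PiM UNIV (\<lambda>_::nat. \<nu> i))"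

text \<open>One coordinate for \<open>Z\<close> and, for each shell, a uniform variable that decides
  the number of points together with a sequence of their positions.\<close>

definition \<Omega> :: "(real \<times> (nat \<Rightarrow> real \<times> (nat \<Rightarrow> real))) measure" where
  "\<Omega> = density lborel (\<lambda>z. ennreal (gamma_dens \<alpha> z)) \<Otimes>\<^sub>M pieces"

text \<open>A position drawn for a shell need not lie in it at every sample point; discarding the
  strays puts \<open>\<xi> x\<close> in \<open>LF\<close> everywhere and not just almost
  surely.\<close>

definition idx :: "real \<times> (nat \<Rightarrow> real \<times> (nat \<Rightarrow> real)) \<Rightarrow> (nat \<times> nat) set" where
  "idx x = {(i, j). j < pcount (fst x * rate i) (fst (snd x i)) \<and> snd (snd x i) j \<in> shell i}"

definition \<xi> :: "real \<times> (nat \<Rightarrow> real \<times> (nat \<Rightarrow> real)) \<Rightarrow> real measure" where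
  "\<xi> x = distr (count_space (idx x)) borel (\<lambda>(i, j). snd (snd x i) j)"

definition total :: "nat \<Rightarrow> real set \<Rightarrow> real \<times> (nat \<Rightarrow> real \<times> (nat \<Rightarrow> real)) \<Rightarrow> nat" where
  "total I B x = (\<Sum>i<I. icount (pcount (fst x * rate i) (fst (snd x i))) (snd (snd x i)) (B \<inter> shell i))"

lemma piece_prob: "prob_space (unif \<Otimes>\<^sub>M PiM UNIV (\<lambda>_::nat. \<nu> i))"
proof -
  interpret S: prob_space "PiM UNIV (\<lambda>_::nat. \<nu> i)" by (rule prob_space_PiM) (rule \<nu>_prob)
  interpret U: prob_space unif by (rule unif_prob)
  interpret US: pair_prob_space unif "PiM UNIV (\<lambda>_::nat. \<nu> i)" ..
  show ?thesis by (rule US.P.prob_space_axioms)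
qed

lemma pieces_prob: "prob_space pieces"
  unfolding pieces_def by (rule prob_space_PiM) (rule piece_prob)

lemma pieces_space [simp]: "space pieces = UNIV"
  by (auto simp: pieces_def space_PiM space_pair_measure)

lemma \<Omega>_space [simp]: "space \<Omega> = UNIV"
  by (auto simp: \<Omega>_def space_pair_measure)

lemma \<Omega>_prob: "prob_space \<Omega>"
proof -
  interpret G: prob_space "density lborel (\<lambda>z. ennreal (gamma_dens \<alpha> z))" by (rule gamma_dens_prob[OF alpha])
  interpret P: prob_space pieces by (rule pieces_prob)
  interpret GP: pair_prob_space "density lborel (\<lambda>z. ennreal (gamma_dens \<alpha> z))" pieces ..
  show ?thesis unfolding \<Omega>_def by (rule GP.P.prob_space_axioms)
qed

lemma emeasure_\<xi>:
  assumes B: "B \<in> sets borel" "B \<subseteq> {a..1}" and a: "0 < a"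
  shows "emeasure (\<xi> x) B = of_nat (total (nat \<lceil>1 / a\<rceil>) B x)"
proof -
  let ?I = "nat \<lceil>1 / a\<rceil>"
  define T where "T = {(i, j)\<in>idx x. snd (snd x i) j \<in> B}"
  define K where "K i = pcount (fst x * rate i) (fst (snd x i))" for i
  have "T = Sigma {..<?I} (\<lambda>i. {j. j < K i \<and> snd (snd x i) j \<in> B \<inter> shell i})"
  proof (intro equalityI subsetI)
    fix p assume "p \<in> T"
    then obtain i j where p: "p = (i, j)" "j < K i" "snd (snd x i) j \<in> shell i" "snd (snd x i) j \<in> B"
      by (auto simp: T_def idx_def K_def)
    have "snd (snd x i) j \<in> {a..1}" using p(4) B(2) by blast
    then obtain i' where i': "i' < ?I" "snd (snd x i) j \<in> shell i'" using shell_cover[OF a, of "snd (snd x i) j"] by auto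
    hence "i' = i" using shell_disjoint[of i i'] p(3) by blast
    thus "p \<in> Sigma {..<?I} (\<lambda>i. {j. j < K i \<and> snd (snd x i) j \<in> B \<inter> shell i})" using p i' by auto
  qed (auto simp: T_def idx_def K_def)
  hence T: "T = Sigma {..<?I} (\<lambda>i. {j. j < K i \<and> snd (snd x i) j \<in> B \<inter> shell i})" .
  have fin: "finite {j. j < K i \<and> snd (snd x i) j \<in> B \<inter> shell i}" for i by simp
  have finT: "finite T" unfolding T by (intro finite_SigmaI fin) auto
  have "emeasure (\<xi> x) B = emeasure (count_space (idx x)) ((\<lambda>(i, j). snd (snd x i) j) -` B \<inter> idx x)"
    unfolding \<xi>_def using B by (subst emeasure_distr) auto
  also have "(\<lambda>(i, j). snd (snd x i) j) -` B \<inter> idx x = T" by (auto simp: T_def)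
  also have "emeasure (count_space (idx x)) T = of_nat (card T)"
    using finT by (intro emeasure_count_space_finite) (auto simp: T_def)
  also have "card T = total ?I B x"
    unfolding T total_def by (subst card_SigmaI) (auto simp: icount_eq_card K_def intro: fin)
  finally show ?thesis .
qed

lemma \<xi>_LF: "\<xi> x \<in> LF"
proof -
  have "emeasure (\<xi> x) (- {0<..1}) = emeasure (count_space (idx x)) ((\<lambda>(i, j). snd (snd x i) j) -` (- {0<..1}) \<inter> idx x)"
    unfolding \<xi>_def by (subst emeasure_distr) auto
  also have "(\<lambda>(i, j). snd (snd x i) j) -` (- {0<..1}) \<inter> idx x = {}" using shell_range(2) by (auto simp: idx_def)
  finally have "emeasure (\<xi> x) (- {0<..1}) = 0" by simp
  moreover have "emeasure (\<xi> x) {a..1} < \<infinity>" if "a > 0" for a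
    using emeasure_\<xi>[of "{a..1}" a x] that by (simp add: less_top[symmetric])
  ultimately show ?thesis by (simp add: LF_def \<xi>_def)
qed

lemma fst_measurable_\<Omega> [measurable]: "fst \<in> \<Omega> \<rightarrow>\<^sub>M borel"
proof -
  have "fst \<in> \<Omega> \<rightarrow>\<^sub>M density lborel (\<lambda>z. ennreal (gamma_dens \<alpha> z))" unfolding \<Omega>_def by (rule measurable_fst)
  thus ?thesis by (simp cong: measurable_cong_sets)
qed

lemma total_measurable [measurable]:
  assumes [measurable]: "B \<in> sets borel"
  shows "total I B \<in> \<Omega> \<rightarrow>\<^sub>M count_space UNIV"
proof -
  have comp: "(\<lambda>x. snd x i) \<in> \<Omega> \<rightarrow>\<^sub>M unif \<Otimes>\<^sub>M PiM UNIV (\<lambda>_::nat. \<nu> i)" for i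
  proof -
    have "(\<lambda>\<omega>. \<omega> i) \<in> pieces \<rightarrow>\<^sub>M unif \<Otimes>\<^sub>M PiM UNIV (\<lambda>_::nat. \<nu> i)"
      unfolding pieces_def by (rule measurable_component_singleton) simp
    moreover have "snd \<in> \<Omega> \<rightarrow>\<^sub>M pieces" unfolding \<Omega>_def by (rule measurable_snd)
    ultimately show ?thesis by (rule measurable_compose[rotated])
  qed
  have f: "(\<lambda>x. fst (snd x i)) \<in> borel_measurable \<Omega>" for i
    using measurable_compose[OF comp measurable_fst] by (simp cong: measurable_cong_sets)
  have s: "(\<lambda>x. icount n (snd (snd x i)) (B \<inter> shell i)) \<in> \<Omega> \<rightarrow>\<^sub>M count_space UNIV" for n i
    by (rule measurable_compose[OF measurable_compose[OF comp measurable_snd] icount_measurable]) auto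
  have "(\<lambda>x. icount (pcount (fst x * rate i) (fst (snd x i))) (snd (snd x i)) (B \<inter> shell i)) \<in> \<Omega> \<rightarrow>\<^sub>M count_space UNIV" for i
    using f by (intro measurable_compose_countable[OF s] pcount_measurable borel_measurable_times) auto
  hence "(\<lambda>x. \<Sum>i<I. icount (pcount (fst x * rate i) (fst (snd x i))) (snd (snd x i)) (B \<inter> shell i)) \<in> \<Omega> \<rightarrow>\<^sub>M count_space UNIV"
    by (intro measurable_sum_nat) auto
  thus ?thesis by (simp add: total_def[abs_def])
qed

lemma random_counts_\<Omega>: "random_counts \<Omega> \<xi>"
proof -
  interpret prob_space \<Omega> by (rule \<Omega>_prob)
  show ?thesis
  proof unfold_locales
    show "\<xi> x \<in> LF" for x by (rule \<xi>_LF)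
    have eq: "emeasure (\<xi> x) (cell R i) = of_nat (total (nat \<lceil>1 / (1 / real R)\<rceil>) (cell R i) x)" if "i < R - 1" for x R i
      using that by (intro emeasure_\<xi> cell_subset cell_borel) auto
    show "\<exists>c. emeasure (\<xi> x) (cell R i) = of_nat c" if "i < R - 1" for x R i using eq[OF that] by blast
    show "{x\<in>space \<Omega>. emeasure (\<xi> x) (cell R i) = of_nat c} \<in> sets \<Omega>" if "i < R - 1" for R i c
    proof -
      have "{x\<in>space \<Omega>. total (nat \<lceil>1 / (1 / real R)\<rceil>) (cell R i) x = c} \<in> sets \<Omega>" by measurable
      thus ?thesis unfolding eq[OF that] by simp
    qed
  qed
qed

text \<open>For fixed \<open>z\<close> the independent pieces are superposed over the finitely many
  shells that meet \<open>{a..1}\<close>, and their rates add up to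
  \<open>z * measure \<Lambda> (B l)\<close>.\<close>

lemma total_law:
  assumes z: "z \<ge> 0" and a: "a > 0" and B: "\<And>l. l < k \<Longrightarrow> B l \<in> sets borel" "\<And>l. l < k \<Longrightarrow> B l \<subseteq> {a..1}"
    and disj: "disjoint_family_on B {..<(k::nat)}"
  shows "measure pieces {\<omega>. \<forall>l<k. total (nat \<lceil>1 / a\<rceil>) (B l) (z, \<omega>) = m l} = (\<Prod>l<k. poisson_pmf_real (z * measure \<Lambda> (B l)) (m l))"
proof -
  let ?I = "nat \<lceil>1 / a\<rceil>"
  define V where "V i x l = icount (pcount (z * rate i) (fst x)) (snd x) (B l \<inter> shell i)" for i and x :: "real \<times> (nat \<Rightarrow> real)" and l
  have sp: "space (unif \<Otimes>\<^sub>M PiM UNIV (\<lambda>_::nat. \<nu> i)) = UNIV" for i by (auto simp: space_pair_measure space_PiM)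
  have dj: "disjoint_family_on (\<lambda>l. B l \<inter> shell i) {..<k}" for i using disj by (auto simp: disjoint_family_on_def)
  have piece: "{x. \<forall>l<k. V i x l = c l} \<in> sets (unif \<Otimes>\<^sub>M PiM UNIV (\<lambda>_::nat. \<nu> i))"
    "measure (unif \<Otimes>\<^sub>M PiM UNIV (\<lambda>_::nat. \<nu> i)) {x. \<forall>l<k. V i x l = c l} = (\<Prod>l<k. poisson_pmf_real (z * rate i * measure (\<nu> i) (B l \<inter> shell i)) (c l))" for i c
    unfolding V_def
    using poisson_piece[OF \<nu>_prob[of i] \<nu>_sets[of i], where r = "z * rate i" and k = k and B = "\<lambda>l. B l \<inter> shell i" and m = c] dj B(1) z rate_nonneg by auto
  have "measure pieces {\<omega>\<in>space pieces. \<forall>l<k. (\<Sum>i<?I. V i (\<omega> i) l) = m l} = (\<Prod>l<k. poisson_pmf_real (\<Sum>i<?I. z * rate i * measure (\<nu> i) (B l \<inter> shell i)) (m l))"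
    unfolding pieces_def using piece piece_prob z rate_nonneg by (intro poisson_superposition) (auto simp: sp)
  also have "{\<omega>\<in>space pieces. \<forall>l<k. (\<Sum>i<?I. V i (\<omega> i) l) = m l} = {\<omega>. \<forall>l<k. total ?I (B l) (z, \<omega>) = m l}"
    by (simp add: total_def V_def)
  also have "(\<Prod>l<k. poisson_pmf_real (\<Sum>i<?I. z * rate i * measure (\<nu> i) (B l \<inter> shell i)) (m l)) = (\<Prod>l<k. poisson_pmf_real (z * measure \<Lambda> (B l)) (m l))"
  proof (intro prod.cong refl arg_cong2[of _ _ _ _ poisson_pmf_real])
    fix l assume "l \<in> {..<k}"
    hence l: "l < k" by simp
    have cover: "B l = (\<Union>i<?I. B l \<inter> shell i)" using shell_cover[OF a] B(2)[OF l] by fastforce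
    have "measure \<Lambda> (B l) = measure \<Lambda> (\<Union>i<?I. B l \<inter> shell i)" using cover by simp
    also have "\<dots> = (\<Sum>i<?I. measure \<Lambda> (B l \<inter> shell i))"
      using B(1)[OF l] LF_sets[OF Lambda] Lambda_finite shell_disjoint
      by (intro measure_finite_Union) (auto simp: disjoint_family_on_def less_top[symmetric], blast)
    finally have "measure \<Lambda> (B l) = (\<Sum>i<?I. rate i * measure (\<nu> i) (B l \<inter> shell i))" by (simp add: rate_\<nu>[OF B(1)[OF l]])
    thus "(\<Sum>i<?I. z * rate i * measure (\<nu> i) (B l \<inter> shell i)) = z * measure \<Lambda> (B l)"
      by (simp add: sum_distrib_left mult.assoc)
  qed
  finally show ?thesis .
qed

lemma cox_gamma_\<Omega>: "cox_gamma \<Omega> fst \<xi> \<alpha> \<Lambda>"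
  unfolding cox_gamma_def
proof (intro conjI allI impI)
  interpret random_counts \<Omega> \<xi> by (rule random_counts_\<Omega>)
  show "prob_space \<Omega>" by (rule \<Omega>_prob)
  show "fst \<in> borel_measurable \<Omega>" by measurable
  show "\<forall>x\<in>space \<Omega>. \<xi> x \<in> LF" using \<xi>_LF by simp
  show "{x\<in>space \<Omega>. \<xi> x \<in> U} \<in> sets \<Omega>" if "openin vague_topology U" for U by (rule vague_open_sets[OF that])
  fix k :: nat and B :: "nat \<Rightarrow> real set" and m :: "nat \<Rightarrow> nat" and A :: "real set" and a :: real
  assume asm: "0 < a \<and> (\<forall>i<k. B i \<in> sets borel \<and> B i \<subseteq> {a..1}) \<and> disjoint_family_on B {..<k} \<and> A \<in> sets borel"
  let ?I = "nat \<lceil>1 / a\<rceil>" and ?G = "density lborel (\<lambda>z. ennreal (gamma_dens \<alpha> z))"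
  interpret G: prob_space ?G by (rule gamma_dens_prob[OF alpha])
  interpret P: prob_space pieces by (rule pieces_prob)
  interpret GP: pair_prob_space ?G pieces ..
  define T where "T = {x. \<forall>l<k. total ?I (B l) x = m l}"
  have T: "T \<in> sets \<Omega>"
  proof -
    have "{x\<in>space \<Omega>. \<forall>l\<in>{..<k}. total ?I (B l) x = m l} \<in> sets \<Omega>"
    proof (rule sets.sets_Collect_finite_All)
      fix l assume "l \<in> {..<k}"
      hence "total ?I (B l) \<in> \<Omega> \<rightarrow>\<^sub>M count_space UNIV" using asm by (intro total_measurable) auto
      from measurable_sets[OF this, of "{m l}"] show "{x\<in>space \<Omega>. total ?I (B l) x = m l} \<in> sets \<Omega>" by (simp add: vimage_def)
    qed simp
    thus ?thesis by (simp add: T_def Ball_def)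
  qed
  define D where "D = {x. fst x \<in> A} \<inter> T"
  have D: "D \<in> sets \<Omega>"
    unfolding D_def using T measurable_sets[OF fst_measurable_\<Omega>, of A] asm by (auto simp: vimage_def)
  have "{x\<in>space \<Omega>. fst x \<in> A \<and> (\<forall>i<k. emeasure (\<xi> x) (B i) = of_nat (m i))} = D"
    using asm emeasure_\<xi>[of "B _" a] by (auto simp: D_def T_def)
  moreover have "emeasure \<Omega> D = (\<integral>\<^sup>+z. ennreal (indicator A z * ((\<Prod>l<k. poisson_pmf_real (z * measure \<Lambda> (B l)) (m l)) * gamma_dens \<alpha> z)) \<partial>lborel)"
  proof -
    have "emeasure \<Omega> D = (\<integral>\<^sup>+z. emeasure pieces (Pair z -` D) \<partial>?G)"
      unfolding \<Omega>_def by (rule P.emeasure_pair_measure_alt) (rule D[unfolded \<Omega>_def])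
    also have "\<dots> = (\<integral>\<^sup>+z. ennreal (gamma_dens \<alpha> z) * emeasure pieces (Pair z -` D) \<partial>lborel)"
    proof (rule nn_integral_density)
      have "(\<lambda>z. emeasure pieces (Pair z -` D)) \<in> borel_measurable ?G"
        by (rule P.measurable_emeasure_Pair) (rule D[unfolded \<Omega>_def])
      thus "(\<lambda>z. emeasure pieces (Pair z -` D)) \<in> borel_measurable lborel" by simp
    qed simp
    also have "\<dots> = (\<integral>\<^sup>+z. ennreal (indicator A z * ((\<Prod>l<k. poisson_pmf_real (z * measure \<Lambda> (B l)) (m l)) * gamma_dens \<alpha> z)) \<partial>lborel)"
    proof (rule nn_integral_cong)
      fix z :: real
      show "ennreal (gamma_dens \<alpha> z) * emeasure pieces (Pair z -` D) = ennreal (indicator A z * ((\<Prod>l<k. poisson_pmf_real (z * measure \<Lambda> (B l)) (m l)) * gamma_dens \<alpha> z))"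
      \<comment> \<open>\<open>total_law\<close> requires nonnegative rates. For
        \<open>z \<le> 0\<close> the Gamma density vanishes, and for \<open>z\<close> outside
        \<open>A\<close> the section of \<open>D\<close> is empty.\<close>
      proof (cases "z > 0 \<and> z \<in> A")
        case True
        have "Pair z -` D = {\<omega>. \<forall>l<k. total ?I (B l) (z, \<omega>) = m l}" using True by (auto simp: D_def T_def)
        hence "emeasure pieces (Pair z -` D) = ennreal (\<Prod>l<k. poisson_pmf_real (z * measure \<Lambda> (B l)) (m l))"
          using total_law[of z a k B m] True asm by (simp add: P.emeasure_eq_measure)
        moreover have "(\<Prod>l<k. poisson_pmf_real (z * measure \<Lambda> (B l)) (m l)) \<ge> 0" using True by (intro prod_nonneg) (auto simp: poisson_nonneg)
        ultimately show ?thesis using True gamma_dens_nonneg[OF alpha, of z] by (simp add: ennreal_mult mult.commute)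
      next
        case False
        thus ?thesis by (cases "z > 0") (auto simp: D_def gamma_dens_def)
      qed
    qed
    finally show ?thesis .
  qed
  moreover have "(LINT z:A|lborel. (\<Prod>l<k. poisson_pmf_real (z * measure \<Lambda> (B l)) (m l)) * gamma_dens \<alpha> z)
     = enn2real (\<integral>\<^sup>+z. ennreal (indicator A z * ((\<Prod>l<k. poisson_pmf_real (z * measure \<Lambda> (B l)) (m l)) * gamma_dens \<alpha> z)) \<partial>lborel)"
    unfolding set_lebesgue_integral_def real_scaleR_def
  proof (rule integral_eq_nn_integral)
    have "A \<in> sets borel" using asm by simp
    thus "(\<lambda>z. indicator A z * ((\<Prod>l<k. poisson_pmf_real (z * measure \<Lambda> (B l)) (m l)) * gamma_dens \<alpha> z)) \<in> borel_measurable lborel"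
      unfolding poisson_pmf_real_def by measurable
    have "0 \<le> indicator A z * ((\<Prod>l<k. poisson_pmf_real (z * measure \<Lambda> (B l)) (m l)) * gamma_dens \<alpha> z)" for z :: real
    proof (cases "z > 0")
      case True
      thus ?thesis using gamma_dens_nonneg[OF alpha, of z] by (intro mult_nonneg_nonneg prod_nonneg) (auto simp: poisson_nonneg)
    qed (simp add: gamma_dens_def)
    thus "AE z in lborel. 0 \<le> indicator A z * ((\<Prod>l<k. poisson_pmf_real (z * measure \<Lambda> (B l)) (m l)) * gamma_dens \<alpha> z)" by simp
  qed
  ultimately show "measure \<Omega> {x\<in>space \<Omega>. fst x \<in> A \<and> (\<forall>i<k. emeasure (\<xi> x) (B i) = of_nat (m i))} 
     = (LINT z:A|lborel. (\<Prod>i<k. poisson_pmf_real (z * measure \<Lambda> (B i)) (m i)) * gamma_dens \<alpha> z)"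
    by (simp add: measure_def)
qed

end

text \<open>The image space carries the largest sigma-algebra that makes \<open>(Z, \<xi>)\<close> measurable, so that an event is
  measurable in one space iff it is in the other; non-measurable ones have \<open>measure\<close> zero in both.\<close>

lemma cox_pushforward:
  fixes \<Omega> :: "'a measure"
  assumes cox: "cox_gamma \<Omega> Z \<xi> \<alpha> \<Lambda>" and rc: "random_counts \<Omega> \<xi>"
  shows "\<exists>M :: (real \<times> real measure) measure. cox_gamma M fst snd \<alpha> \<Lambda> \<and> random_counts M snd"
proof -
  interpret random_counts \<Omega> \<xi> by (rule rc)
  define h where "h x = (Z x, \<xi> x)" for x
  define H where "H = h ` space \<Omega>"
  define \<S> where "\<S> = {A. A \<subseteq> H \<and> h -` A \<inter> space \<Omega> \<in> sets \<Omega>}"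
  define N where "N = sigma H \<S>"
  have alg: "sigma_algebra H \<S>"
  proof (rule sigma_algebra.intro)
    show "algebra H \<S>" unfolding algebra_iff_Un
    proof (intro conjI ballI)
      show "\<S> \<subseteq> Pow H" by (auto simp: \<S>_def)
      show "{} \<in> \<S>" by (simp add: \<S>_def)
      fix A assume A: "A \<in> \<S>"
      have "h -` (H - A) \<inter> space \<Omega> = space \<Omega> - (h -` A \<inter> space \<Omega>)" by (auto simp: H_def)
      thus "H - A \<in> \<S>" using A by (auto simp: \<S>_def)
      fix A' assume A': "A' \<in> \<S>"
      have "h -` (A \<union> A') \<inter> space \<Omega> = (h -` A \<inter> space \<Omega>) \<union> (h -` A' \<inter> space \<Omega>)" by auto
      thus "A \<union> A' \<in> \<S>" using A A' by (auto simp: \<S>_def)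
    qed
    show "sigma_algebra_axioms \<S>"
    proof
      fix A :: "nat \<Rightarrow> _" assume A: "range A \<subseteq> \<S>"
      have "h -` (\<Union>i. A i) \<inter> space \<Omega> = (\<Union>i. h -` A i \<inter> space \<Omega>)" by auto
      moreover have Ai: "h -` A i \<inter> space \<Omega> \<in> sets \<Omega>" "A i \<subseteq> H" for i using A by (auto simp: \<S>_def)
      moreover have "(\<Union>i. h -` A i \<inter> space \<Omega>) \<in> sets \<Omega>" by (intro sets.countable_UN) (use Ai in auto)
      moreover have "(\<Union>i. A i) \<subseteq> H" using Ai(2) by blast
      ultimately show "(\<Union>i. A i) \<in> \<S>" unfolding \<S>_def by simp
    qed
  qed
  have N: "space N = H" "sets N = \<S>"
    unfolding N_def using sigma_algebra.sigma_sets_eq[OF alg] by (auto simp: \<S>_def intro!: sets_measure_of[THEN trans] space_measure_of)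
  have h: "h \<in> \<Omega> \<rightarrow>\<^sub>M N"
    by (rule measurableI) (auto simp: N H_def \<S>_def)
  define M where "M = distr \<Omega> N h"
  have M: "space M = H" "sets M = \<S>" by (simp_all add: M_def N)
  have sets_M: "{y\<in>space M. Q y} \<in> sets M \<longleftrightarrow> {x\<in>space \<Omega>. Q (h x)} \<in> sets \<Omega>" for Q
  proof -
    have "h -` {y\<in>H. Q y} \<inter> space \<Omega> = {x\<in>space \<Omega>. Q (h x)}" by (auto simp: H_def)
    thus ?thesis unfolding M by (auto simp: \<S>_def)
  qed
  have measure_M: "measure M {y\<in>space M. Q y} = measure \<Omega> {x\<in>space \<Omega>. Q (h x)}" for Q
  proof (cases "{x\<in>space \<Omega>. Q (h x)} \<in> sets \<Omega>")
    case False
    thus ?thesis using sets_M[of Q] by (simp add: measure_notin_sets)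
  next
    case True
    have "{y\<in>space M. Q y} \<in> sets N" using sets_M[of Q] True by (simp add: M N)
    hence "measure M {y\<in>space M. Q y} = measure \<Omega> (h -` {y\<in>space M. Q y} \<inter> space \<Omega>)"
      unfolding M_def by (intro measure_distr h)
    also have "h -` {y\<in>space M. Q y} \<inter> space \<Omega> = {x\<in>space \<Omega>. Q (h x)}" by (auto simp: M H_def)
    finally show ?thesis .
  qed
  have pM: "prob_space M" unfolding M_def by (rule prob_space_distr[OF h])
  have Zm: "Z \<in> borel_measurable \<Omega>" using cox by (simp add: cox_gamma_def)
  have "fst \<in> borel_measurable M"
  proof (rule measurableI)
    fix A :: "real set" assume A: "A \<in> sets borel"
    have "{x\<in>space \<Omega>. fst (h x) \<in> A} \<in> sets \<Omega>" using measurable_sets[OF Zm A] by (simp add: h_def vimage_def Collect_conj_eq Int_commute)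
    hence "{y\<in>space M. fst y \<in> A} \<in> sets M" by (simp add: sets_M)
    thus "fst -` A \<inter> space M \<in> sets M" by (simp add: vimage_def Collect_conj_eq Int_commute)
  qed simp
  moreover have LF: "snd y \<in> LF" if "y \<in> space M" for y using that xi_LF by (auto simp: M H_def h_def)
  moreover have "{y\<in>space M. snd y \<in> U} \<in> sets M" if "openin vague_topology U" for U
    unfolding sets_M using vague_open_sets[OF that] by (simp add: h_def)
  moreover have "measure M {y\<in>space M. fst y \<in> A \<and> (\<forall>i<k. emeasure (snd y) (B i) = of_nat (m i))}
        = (LINT z:A|lborel. (\<Prod>i<k. poisson_pmf_real (z * measure \<Lambda> (B i)) (m i)) * gamma_dens \<alpha> z)"
    if "0 < a \<and> (\<forall>i<k. B i \<in> sets borel \<and> B i \<subseteq> {a..1}) \<and> disjoint_family_on B {..<k} \<and> A \<in> sets borel"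
    for k :: nat and B m A a
    using cox that unfolding measure_M cox_gamma_def h_def fst_conv snd_conv by blast
  ultimately have "cox_gamma M fst snd \<alpha> \<Lambda>" unfolding cox_gamma_def using pM by blast
  moreover have "random_counts M snd"
  proof (rule random_counts.intro[OF pM], unfold_locales)
    show "snd y \<in> LF" if "y \<in> space M" for y by (rule LF[OF that])
    show "\<exists>c. emeasure (snd y) (cell R i) = of_nat c" if "y \<in> space M" "i < R - 1" for y R i
      using that xi_count by (auto simp: M H_def h_def)
    show "{y\<in>space M. emeasure (snd y) (cell R i) = of_nat c} \<in> sets M" if "i < R - 1" for R i c
      unfolding sets_M using xi_meas[OF that] by (simp add: h_def)
  qed
  ultimately show ?thesis by blast
qed

section \<open>The limit theorem\<close>

lemma has_cells_pp: "has_cells R (pp n ks) m \<longleftrightarrow> length m = R - 1 \<and> (\<forall>i<R-1. cell_counts R n ks i = m ! i)"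
  by (simp add: has_cells_def emeasure_pp_cell)

text \<open>The left endpoint has mass zero by letting the closed intervals shrink to it.\<close>

lemma measure_halfopen:
  fixes \<Lambda> :: "real measure"
  assumes LF: "\<Lambda> \<in> LF"
    and int: "\<And>a b. 0 < a \<Longrightarrow> a < b \<Longrightarrow> b \<le> 1 \<Longrightarrow> emeasure \<Lambda> {a..b} = ennreal (a powr (- \<gamma>) - b powr (- \<gamma>))"
    and gamma: "\<gamma> \<ge> 0" and ab: "0 < a" "a < b" "b \<le> 1"
  shows "measure \<Lambda> {a<..b} = a powr (- \<gamma>) - b powr (- \<gamma>)"
proof -
  have dec: "x powr (- \<gamma>) - y powr (- \<gamma>) \<ge> 0" if "0 < x" "x < y" for x y :: real
    using that gamma by (simp add: powr_mono2')
  have fin: "B \<in> fmeasurable \<Lambda>" if "B \<subseteq> {a..1}" "B \<in> sets borel" for B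
    using LF_finite[OF LF ab(1) that(1)] that(2) by (simp add: fmeasurable_def LF_sets[OF LF])
  have closed: "measure \<Lambda> {a..y} = a powr (- \<gamma>) - y powr (- \<gamma>)" if "a < y" "y \<le> 1" for y
    using int[OF ab(1) that] dec[OF ab(1) that(1)] by (simp add: measure_def)
  have "measure \<Lambda> {a} \<le> a powr (- \<gamma>) - a powr (- \<gamma>)"
  proof (rule tendsto_lowerbound)
    show "((\<lambda>y. a powr (- \<gamma>) - y powr (- \<gamma>)) \<longlongrightarrow> a powr (- \<gamma>) - a powr (- \<gamma>)) (at_right a)"
      using ab by (intro tendsto_intros) auto
    have "eventually (\<lambda>y. y \<in> {a<..<b}) (at_right a)" by (rule eventually_at_right_real[OF ab(2)])
    thus "eventually (\<lambda>y. measure \<Lambda> {a} \<le> a powr (- \<gamma>) - y powr (- \<gamma>)) (at_right a)"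
    proof eventually_elim
      case (elim y)
      have "measure \<Lambda> {a} \<le> measure \<Lambda> {a..y}"
        using elim ab by (intro measure_mono_fmeasurable fin) (auto simp: LF_sets[OF LF])
      thus ?case using closed[of y] elim ab by simp
    qed
  qed simp
  hence "measure \<Lambda> {a} = 0" using measure_nonneg[of \<Lambda> "{a}"] by linarith
  moreover have "measure \<Lambda> ({a} \<union> {a<..b}) = measure \<Lambda> {a} + measure \<Lambda> {a<..b}"
    using ab by (intro measure_Un_AE fin) (auto intro!: fin)
  moreover have "{a} \<union> {a<..b} = {a..b}" using ab by auto
  ultimately show ?thesis using closed[of b] ab by simp
qed

text \<open>On the logarithmic scale the ratio of \<open>j * p j\<close> to \<open>n * p n\<close>
  deviates from 0 by three terms: the asymptotic errors at \<open>j\<close> and at \<open>n\<close>,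
  and the variation of \<open>L\<close> between them. Each is below \<open>d\<close>, a third of
  \<open>ln (1 + e)\<close>.\<close>

lemma regular_local_ratio:
  fixes w :: "nat \<Rightarrow> real"
  assumes L: "slowly_varying L" and c: "c > 0"
    and asymp: "(\<lambda>n. real n * p n) \<sim>[sequentially] (\<lambda>n. c * L (real n))" and e: "e > 0"
  shows "\<forall>\<^sub>F n in sequentially. p n > 0 \<and> 
        (\<forall>j. n \<le> 2 * j \<and> j \<le> n \<longrightarrow> \<bar>real j * p j - real n * p n\<bar> \<le> e * (real n * p n))"
proof -
  define d where "d = ln (1 + e) / 3"
  have d: "d > 0" using e by (simp add: d_def)
  obtain X where X: "X > 0" "\<And>x. x \<ge> X \<Longrightarrow> L x > 0" "\<And>x y. x \<ge> X \<Longrightarrow> y \<in> {x..2*x} \<Longrightarrow> \<bar>ln (L y) - ln (L x)\<bar> < d"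
    using slowly_varying_local_ln[OF L d] by meson
  have "eventually (\<lambda>n. L (real n) > 0) sequentially"
    by (rule eventually_compose_filterlim[OF slowly_varyingD(2)[OF L] filterlim_real_sequentially])
  hence "eventually (\<lambda>n. real n * p n \<noteq> 0 \<or> c * L (real n) \<noteq> 0) sequentially"
    using c by (auto elim: eventually_mono)
  hence lim: "(\<lambda>n. real n * p n / (c * L (real n))) \<longlonglongrightarrow> 1" by (rule asymp_equivD_strong[OF asymp])
  hence "(\<lambda>n. ln (real n * p n / (c * L (real n)))) \<longlonglongrightarrow> ln 1" by (intro tendsto_ln) auto
  hence "eventually (\<lambda>n. \<bar>ln (real n * p n / (c * L (real n)))\<bar> < d) sequentially"
    using d by (auto dest!: tendstoD[of _ _ _ d] simp: dist_real_def)
  moreover have "eventually (\<lambda>n. real n * p n / (c * L (real n)) > 0) sequentially"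
    using lim by (rule order_tendstoD(1)) simp
  ultimately have "eventually (\<lambda>n. \<bar>ln (real n * p n / (c * L (real n)))\<bar> < d \<and> real n * p n / (c * L (real n)) > 0 \<and> real n \<ge> X) sequentially"
    using eventually_ge_at_top[of "nat \<lceil>X\<rceil>"]
  proof eventually_elim
    case (elim n)
    thus ?case by (auto simp: nat_ceiling_le_eq)
  qed
  then obtain N where N: "\<And>n. n \<ge> N \<Longrightarrow> \<bar>ln (real n * p n / (c * L (real n)))\<bar> < d"
    "\<And>n. n \<ge> N \<Longrightarrow> real n * p n / (c * L (real n)) > 0" "\<And>n. n \<ge> N \<Longrightarrow> real n \<ge> X"
    by (auto simp: eventually_sequentially)
  have pos: "real n * p n > 0" "L (real n) > 0" if "n \<ge> N" for n
  proof -
    show L: "L (real n) > 0" by (rule X(2)[OF N(3)[OF that]])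
    have "real n * p n = real n * p n / (c * L (real n)) * (c * L (real n))" using L c by simp
    thus "real n * p n > 0" using mult_pos_pos[OF N(2)[OF that] mult_pos_pos[OF c L]] by linarith
  qed
  show ?thesis
  proof (rule eventually_sequentiallyI[of "2 * N"], intro conjI allI impI)
    fix n assume n: "2 * N \<le> n"
    show "p n > 0" using pos[of n] n by (auto simp: zero_less_mult_iff)
    fix j assume j: "n \<le> 2 * j \<and> j \<le> n"
    have jN: "j \<ge> N" "n \<ge> N" using j n by auto
    have exp_ln: "ln (real i * p i) = ln (real i * p i / (c * L (real i))) + ln c + ln (L (real i))" if "i \<ge> N" for i
    proof -
      have "real i * p i = real i * p i / (c * L (real i)) * (c * L (real i))" using pos[OF that] c by simp
      thus ?thesis using N(2)[OF that] pos(2)[OF that] c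
        by (metis ln_mult_pos mult_pos_pos add.assoc)
    qed
    have "\<bar>ln (L (real n)) - ln (L (real j))\<bar> < d" using j by (intro X(3) N(3) jN) auto
    hence t: "\<bar>ln (real j * p j) - ln (real n * p n)\<bar> < ln (1 + e)"
      using N(1)[OF jN(1)] N(1)[OF jN(2)] unfolding exp_ln[OF jN(1)] exp_ln[OF jN(2)] d_def by linarith
    define y where "y = real j * p j / (real n * p n)"
    have y: "y > 0" "ln y = ln (real j * p j) - ln (real n * p n)" using pos[OF jN(1)] pos[OF jN(2)] by (auto simp: y_def ln_div)
    have "ln y < ln (1 + e)" "ln (1 / y) < ln (1 + e)" using t y by (auto simp: ln_div)
    hence "y < 1 + e" "1 / y < 1 + e" using y(1) e by (auto simp: ln_less_cancel_iff)
    hence "1 < (1 + e) * y" using y(1) by (simp add: field_simps)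
    have "\<bar>y - 1\<bar> \<le> e"
    proof -
      have "1 / (1 + e) < y" using \<open>1 < (1 + e) * y\<close> e by (simp add: field_simps)
      moreover have "1 - e \<le> 1 / (1 + e)" using e by (simp add: field_simps)
      ultimately show ?thesis using \<open>y < 1 + e\<close> by (simp add: abs_le_iff)
    qed
    hence "\<bar>y - 1\<bar> * (real n * p n) \<le> e * (real n * p n)" using pos(1)[OF jN(2)] by (intro mult_right_mono) auto
    also have "\<bar>y - 1\<bar> * (real n * p n) = \<bar>(y - 1) * (real n * p n)\<bar>" using pos(1)[OF jN(2)]
      by (subst abs_mult[of "y - 1"]) (simp only: abs_of_pos)
    also have "(y - 1) * (real n * p n) = real j * p j - real n * p n"
    proof -
      have "real n * p n \<noteq> 0" using pos(1)[OF jN(2)] by linarith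
      from iffD1[OF nonzero_eq_divide_eq[OF this] y_def] show ?thesis by (simp only: left_diff_distrib mult_1_left)
    qed
    finally show "\<bar>real j * p j - real n * p n\<bar> \<le> e * (real n * p n)" .
  qed
qed

lemma regular_times_powr:
  assumes L: "slowly_varying L" and c: "c > 0"
    and asymp: "(\<lambda>n. real n * p n) \<sim>[sequentially] (\<lambda>n. c * L (real n))" and e: "e > 0"
  shows "filterlim (\<lambda>n. real n powr e * (real n * p n)) at_top sequentially"
proof -
  have ev: "eventually (\<lambda>n. L (real n) > 0) sequentially"
    by (rule eventually_compose_filterlim[OF slowly_varyingD(2)[OF L] filterlim_real_sequentially])
  hence "eventually (\<lambda>n. real n * p n \<noteq> 0 \<or> c * L (real n) \<noteq> 0) sequentially"
    using c by (auto elim: eventually_mono)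
  hence lim: "(\<lambda>n. real n * p n / (c * L (real n))) \<longlonglongrightarrow> 1" by (rule asymp_equivD_strong[OF asymp])
  have "(\<lambda>n. c * (real n * p n / (c * L (real n)))) \<longlonglongrightarrow> c * 1" by (intro tendsto_mult lim tendsto_const)
  hence "filterlim (\<lambda>n. c * (real n * p n / (c * L (real n))) * (real n powr e * L (real n))) at_top sequentially"
    using c by (intro filterlim_tendsto_pos_mult_at_top[where c = c] filterlim_compose[OF slowly_varying_times_powr[OF L e] filterlim_real_sequentially]) auto
  moreover have "eventually (\<lambda>n. c * (real n * p n / (c * L (real n))) * (real n powr e * L (real n)) = real n powr e * (real n * p n)) sequentially"
    using ev by eventually_elim (use c in simp)
  ultimately show ?thesis using filterlim_cong[OF refl refl, of "\<lambda>n. c * (real n * p n / (c * L (real n))) * (real n powr e * L (real n))" "\<lambda>n. real n powr e * (real n * p n)" sequentially at_top] by simp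
qed

text \<open>The choice \<open>A = UNIV\<close> in the joint law integrates \<open>Z\<close> out;
  \<open>measure_halfopen\<close> carries the interval formula for \<Lambda> over to the
  cells.\<close>

lemma (in gibbs_big_jump) mixed_prob_eq:
  assumes LF: "\<Lambda> \<in> LF"
    and int: "\<And>a b. 0 < a \<Longrightarrow> a < b \<Longrightarrow> b \<le> 1 \<Longrightarrow> emeasure \<Lambda> {a..b} = ennreal (a powr (- \<gamma>) - b powr (- \<gamma>))"
    and gamma: "\<gamma> \<ge> 0" and R: "R \<ge> 2" and cox: "cox_gamma M Z \<xi> \<alpha> \<Lambda>" and len: "length m = R - 1"
  shows "measure M {\<omega>\<in>space M. has_cells R (\<xi> \<omega>) m} = mixed_prob R (\<lambda>i. m ! i)"
proof -
  have *: "0 < 1 / real R \<and> (\<forall>i<R-1. cell R i \<in> sets borel \<and> cell R i \<subseteq> {1 / real R..1}) \<and> disjoint_family_on (cell R) {..<R-1} \<and> (UNIV :: real set) \<in> sets borel"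
    using R cell_subset cell_disjoint by (auto simp: disjoint_family_on_def)
  have "{\<omega>\<in>space M. has_cells R (\<xi> \<omega>) m} = {\<omega>\<in>space M. Z \<omega> \<in> UNIV \<and> (\<forall>i<R-1. emeasure (\<xi> \<omega>) (cell R i) = of_nat (m ! i))}"
    using len by (auto simp: has_cells_def)
  also have "measure M \<dots> = (LINT z:UNIV|lborel. (\<Prod>i<R-1. poisson_pmf_real (z * measure \<Lambda> (cell R i)) (m ! i)) * gamma_dens \<alpha> z)"
    using cox * unfolding cox_gamma_def by blast
  also have "\<dots> = (LINT z:{0<..}|lborel. z powr \<alpha> * (exp (- z) * (\<Prod>i<R-1. poisson_pmf_real (z * ((real (Suc i) / real R) powr (-\<gamma>) - (real (Suc (Suc i)) / real R) powr (-\<gamma>))) (m ! i)))  / Gamma (\<alpha> + 1))"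
    unfolding set_lebesgue_integral_def
  proof (rule Bochner_Integration.integral_cong[OF refl])
    fix z :: real
    have "measure \<Lambda> (cell R i) = (real (Suc i) / real R) powr (-\<gamma>) - (real (Suc (Suc i)) / real R) powr (-\<gamma>)" if "i < R - 1" for i
    proof -
      have "Suc (Suc i) \<le> R" using that by simp
      hence "real (Suc (Suc i)) / real R \<le> 1" using R by (simp only: divide_le_eq_1_pos of_nat_le_iff of_nat_0_less_iff)
      thus ?thesis unfolding cell_def using R by (intro measure_halfopen[OF LF int gamma]) (auto intro!: divide_strict_right_mono)
    qed
    thus "indicator UNIV z *\<^sub>R ((\<Prod>i<R-1. poisson_pmf_real (z * measure \<Lambda> (cell R i)) (m ! i)) * gamma_dens \<alpha> z) 
       = indicator {0<..} z *\<^sub>R (z powr \<alpha> * (exp (- z) * (\<Prod>i<R-1. poisson_pmf_real (z * ((real (Suc i) / real R) powr (-\<gamma>) - (real (Suc (Suc i)) / real R) powr (-\<gamma>))) (m ! i))) / Gamma (\<alpha> + 1))"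
      by (simp add: gamma_dens_def)
  qed
  also have "\<dots> = mixed_prob R (\<lambda>i. m ! i)"
    unfolding mixed_prob_def by (simp add: set_lebesgue_integral_def)
  finally show ?thesis .
qed

text \<open>Tilting does not change the law: \<rho> enters with exponent
  \<open>sum_list ks = n\<close>, the same for all compositions, and the powers of \<open>W\<close>
  cancel by length.\<close>

lemma gibbs_P_normalize:
  assumes "W > 0" "\<rho> > (0::real)" "ks \<in> all_comps n" "u > 0"
  shows "v (length ks) * prod_list (map w ks) / (u / \<rho> ^ n) = (v (length ks) * W ^ length ks) * prod_list (map (\<lambda>n. w n * \<rho> ^ n / W) ks) / u"
proof -
  have "prod_list (map (\<lambda>n. w n * \<rho> ^ n / W) ks) = prod_list (map w ks) * \<rho> ^ sum_list ks / W ^ length ks"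
    by (induction ks) (auto simp: power_add)
  thus ?thesis using assms by (simp add: all_comps_def)
qed

theorem theorem1p4:
  fixes w :: "nat \<Rightarrow> real" and v :: "nat \<Rightarrow> real"
    and \<rho> \<alpha> \<gamma> :: real and Lw Lv :: "real \<Rightarrow> real" and \<Lambda> :: "real measure"
  assumes w_nonneg: "\<And>n. w n \<ge> 0"
    and v_nonneg: "\<And>k. k \<ge> 1 \<Longrightarrow> v k \<ge> 0"
    and rho_pos: "\<rho> > 0"
    and alpha: "\<alpha> > -1"
    and Lw: "slowly_varying Lw" and Lv: "slowly_varying Lv"
    and w_asymp: "w \<sim>[sequentially] (\<lambda>n. Lw (real n) * real n powr (-1) * \<rho> powr (- real n))"
    and W_summable: "summable (\<lambda>n. w n * \<rho> ^ n)"
    and W_pos: "(\<Sum>n. w n * \<rho> ^ n) > 0"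
    and v_asymp: "v \<sim>[sequentially]
          (\<lambda>n. Lv (real n) * real n powr (\<alpha> - 1) * (\<Sum>m. w m * \<rho> ^ m) powr (- real n))"
    and gamma: "\<gamma> \<ge> 0"
    and tail: "\<And>t. 0 < t \<Longrightarrow> t < 1 \<Longrightarrow>
          ((\<lambda>n. (\<Sum>m. if real m > real n powr t then w m * \<rho> ^ m / (\<Sum>j. w j * \<rho> ^ j) else 0)
               / (\<Sum>m. if real m > real n then w m * \<rho> ^ m / (\<Sum>j. w j * \<rho> ^ j) else 0))
           \<longlongrightarrow> t powr (- \<gamma>)) sequentially"
    and Lambda_LF: "\<Lambda> \<in> LF"
    and Lambda_intervals: "\<And>a b. 0 < a \<Longrightarrow> a < b \<Longrightarrow> b \<le> 1 \<Longrightarrow>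
          emeasure \<Lambda> {a..b} = ennreal (a powr (- \<gamma>) - b powr (- \<gamma>))"
  shows "\<exists>(M :: (real \<times> real measure) measure) Z \<xi>. cox_gamma M Z \<xi> \<alpha> \<Lambda> \<and>
           (\<forall>F. continuous_map vague_topology euclideanreal F \<and>
                 (\<exists>C. \<forall>\<mu>\<in>LF. \<bar>F \<mu>\<bar> \<le> C) \<longrightarrow>
              ((\<lambda>n. gibbs_E w v n (\<lambda>ks. F (pp n ks)))
                 \<longlongrightarrow> (\<integral>\<omega>. F (\<xi> \<omega>) \<partial>M)) sequentially)"
proof -
  define W where "W = (\<Sum>n. w n * \<rho> ^ n)"
  have W: "W > 0" using W_pos by (simp add: W_def)
  define p where "p n = w n * \<rho> ^ n / W" for n
  define q where "q k = v k * W ^ k" for k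
  have np_asymp: "(\<lambda>n. real n * p n) \<sim>[sequentially] (\<lambda>n. 1 / W * Lw (real n))"
  proof -
    have 1: "(\<lambda>n. real n * \<rho> ^ n / W * w n) \<sim>[sequentially] (\<lambda>n. real n * \<rho> ^ n / W * (Lw (real n) * real n powr (-1) * \<rho> powr (- real n)))"
      by (intro asymp_equiv_intros w_asymp)
    have "eventually (\<lambda>n. real n * \<rho> ^ n / W * (Lw (real n) * real n powr (-1) * \<rho> powr (- real n)) = 1 / W * Lw (real n)) sequentially"
      using eventually_gt_at_top[of 0]
    proof eventually_elim
      case (elim n)
      thus ?case using rho_pos by (simp add: powr_minus powr_realpow field_simps)
    qed
    moreover have "eventually (\<lambda>n. real n * \<rho> ^ n / W * w n = real n * p n) sequentially"
      by (intro always_eventually allI) (simp add: p_def)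
    ultimately show ?thesis using asymp_equiv_cong 1 by fast
  qed
  have q_asymp: "q \<sim>[sequentially] (\<lambda>k. Lv (real k) * real k powr (\<alpha> - 1))"
  proof -
    have 1: "(\<lambda>k. v k * W ^ k) \<sim>[sequentially] (\<lambda>k. Lv (real k) * real k powr (\<alpha> - 1) * W powr (- real k) * W ^ k)"
      using v_asymp unfolding W_def[symmetric] by (intro asymp_equiv_intros)
    also have "(\<lambda>k. Lv (real k) * real k powr (\<alpha> - 1) * W powr (- real k) * W ^ k) = (\<lambda>k. Lv (real k) * real k powr (\<alpha> - 1))"
      using W by (auto simp: fun_eq_iff powr_minus powr_realpow)
    finally show ?thesis by (simp add: q_def[abs_def])
  qed
  interpret gibbs_big_jump p \<gamma> q Lv \<alpha>
  proof
    show "0 \<le> p n" for n using w_nonneg W rho_pos by (simp add: p_def)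
    have "(\<lambda>n. w n * \<rho> ^ n) sums W" using W_summable by (simp add: W_def summable_sums)
    from sums_divide[OF this, of W] show "p sums 1" using W by (simp add: p_def[abs_def])
    show "\<forall>\<^sub>F n in sequentially. p n > 0 \<and> (\<forall>j. n \<le> 2 * j \<and> j \<le> n \<longrightarrow> \<bar>real j * p j - real n * p n\<bar> \<le> e * (real n * p n))" if "e > 0" for e
      by (rule regular_local_ratio[OF Lw _ np_asymp that]) (use W in simp)
    show "filterlim (\<lambda>n. real n powr e * (real n * p n)) at_top sequentially" if "e > 0" for e
      by (rule regular_times_powr[OF Lw _ np_asymp that]) (use W in simp)
    show "(\<lambda>n. (\<Sum>m. if real m > real n powr t then p m else 0) / (\<Sum>m. if real m > real n then p m else 0)) \<longlonglongrightarrow> t powr (-\<gamma>)"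
      if "0 < t" "t < 1" for t
      using tail[OF that] unfolding p_def W_def .
    show "q k \<ge> 0" if "k \<ge> 1" for k using v_nonneg[OF that] W by (simp add: q_def)
  qed (fact alpha Lv q_asymp)+
  interpret cox_construction \<Lambda> \<alpha> by unfold_locales (fact Lambda_LF alpha)+
  \<comment> \<open>The statement prescribes sample points of type
    \<open>real \<times> real measure\<close>, while the construction uses sequences of points; the
    pushforward bridges the two.\<close>
  obtain M :: "(real \<times> real measure) measure" where cox: "cox_gamma M fst snd \<alpha> \<Lambda>" and rc: "random_counts M snd"
    using cox_pushforward[OF cox_gamma_\<Omega> random_counts_\<Omega>] by blast
  interpret random_counts M snd by (rule rc)
  have "(\<lambda>n. gibbs_E w v n (\<lambda>ks. F (pp n ks))) \<longlonglongrightarrow> (\<integral>\<omega>. F (snd \<omega>) \<partial>M)"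
    if F: "continuous_map vague_topology euclideanreal F" "\<And>\<mu>. \<mu> \<in> LF \<Longrightarrow> \<bar>F \<mu>\<bar> \<le> C" for F C
  proof -
    have "(\<lambda>n. infsum (\<lambda>ks. gibbs_weight n ks * F (pp n ks)) (all_comps n)) \<longlonglongrightarrow> (\<integral>\<omega>. F (snd \<omega>) \<partial>M)"
    proof (rule weak_convergence[OF F])
      show "\<forall>\<^sub>F n in sequentially. (\<forall>x\<in>all_comps n. 0 \<le> gibbs_weight n x) \<and> gibbs_weight n summable_on all_comps n \<and> infsum (gibbs_weight n) (all_comps n) = 1"
        using gibbs_weight_total by eventually_elim (auto intro: gibbs_weight_nonneg)
      show "pp n ks \<in> LF" if "ks \<in> all_comps n" for n ks by (rule pp_LF[OF that])
      show "\<forall>\<^sub>F n in sequentially. infsum (gibbs_weight n) {ks\<in>all_comps n. has_cells R (pp n ks) m} \<ge> measure M {\<omega>\<in>space M. has_cells R (snd \<omega>) m} - d"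
        if "R \<ge> 2" "d > 0" "length m = R - 1" for R m d
      proof -
        have "measure M {\<omega>\<in>space M. has_cells R (snd \<omega>) m} = mixed_prob R (\<lambda>i. m ! i)"
          by (rule mixed_prob_eq[OF Lambda_LF _ gamma that(1) cox that(3)]) (rule Lambda_intervals)
        thus ?thesis using gibbs_counts_lower[OF that(1,2), of "\<lambda>i. m ! i"] that(3) by (simp add: has_cells_pp)
      qed
    qed
    \<comment> \<open>The partition function is known to be a convergent positive series only for
      large \<open>n\<close>, so the two expectations are identified eventually.\<close>
    moreover have "eventually (\<lambda>n. infsum (\<lambda>ks. gibbs_weight n ks * F (pp n ks)) (all_comps n) = gibbs_E w v n (\<lambda>ks. F (pp n ks))) sequentially"
      using partition_fun_upper[OF zero_less_one] gibbs_weight_total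
    proof eventually_elim
      case (elim n)
      have "v (Suc k) * wconv w (Suc k) n = q (Suc k) * convp p (Suc k) n / \<rho> ^ n" for k
      proof -
        have "p = (\<lambda>n. 1 / W * w n * \<rho> ^ n)" by (simp add: p_def[abs_def])
        hence "convp p (Suc k) n = (1 / W) ^ Suc k * convp w (Suc k) n * \<rho> ^ n" by (simp only: convp_scale)
        hence "q (Suc k) * convp p (Suc k) n = v (Suc k) * convp w (Suc k) n * \<rho> ^ n * (W * (1 / W)) ^ Suc k"
          by (simp only: q_def power_mult_distrib ac_simps)
        thus ?thesis using W rho_pos by (simp add: wconv_eq_convp)
      qed
      hence u: "gibbs_u w v n = partition_fun n / \<rho> ^ n"
        unfolding gibbs_u_def partition_fun_def using elim by (simp add: suminf_divide)
      have "gibbs_weight n ks = gibbs_P w v n ks" if "ks \<in> all_comps n" for ks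
      proof -
        have "gibbs_P w v n ks = (v (length ks) * W ^ length ks) * prod_list (map (\<lambda>n. w n * \<rho> ^ n / W) ks) / partition_fun n"
          unfolding gibbs_P_def u by (rule gibbs_P_normalize[OF W rho_pos that]) (use elim in simp)
        moreover have "map p ks = map (\<lambda>n. w n * \<rho> ^ n / W) ks" by (simp add: p_def)
        ultimately show ?thesis by (simp only: gibbs_weight_def q_def)
      qed
      thus ?case unfolding gibbs_E_def by (intro infsum_cong) simp
    qed
    ultimately show ?thesis by (simp add: tendsto_cong)
  qed
  thus ?thesis using cox by blast
qed

end
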